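(* Let $n\ge2$. Suppose that for every $p\in\mathbb{N}$, every $K\in\mathcal{K}(\mathbb{R}^n)$ with $\dim(K)=n$ and every $\bm t\in\Theta_p$ one has $$\frac{|D_p^{\bm t}K|}{|K|^p}\leq\frac{|D_p^{\bm t}S_n|}{|S_n|^p},$$ where $S_n\in\mathcal{K}(\mathbb{R}^n)$ is an $n$-simplex, and that if equality holds for some $\bm t\in\mathrm{relint}(\Theta_p)$, then $K$ is a simplex. Then for every $p\in\mathbb{N}$, $K\in\mathcal{K}(\mathbb{R}^n)$ and $\bm t\in\Theta_p$ one has $$\sum_{\bm j\in\mathcal{J}^n_p}\bm t^{\,n-\bm j}\,W_{p,K}(\bm j)\leq\frac{(n!)^p}{(np)!}\sum_{\bm j\in\mathcal{J}^n_p}\binom{n}{\bm j}\bm t^{\,n-\bm j}|K|^p,$$ and if $\dim K=n$ and equality holds in the latter inequality for some $\bm t\in\mathrm{relint}(\Theta_p)$, then $K$ is a simplex.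
   Context: $\mathcal{K}(\mathbb{R}^n)$ denotes the set of convex bodies, i.e. nonempty compact convex subsets of $\mathbb{R}^n$; $|\cdot|$ is Lebesgue measure (in the dimension of the ambient space); $\dim K$ is the dimension of the affine span of $K$; a simplex is the convex hull of affinely independent points, an $n$-simplex that of $n+1$ such points. The mixed volume of $K_1,\dots,K_N\in\mathcal{K}(\mathbb{R}^N)$ is $V(K_1,\dots,K_N)=\frac1{N!}\frac{\partial^N}{\partial s_1\cdots\partial s_N}\big|_{s_1=\dots=s_N=0}|s_1K_1+\dots+s_NK_N|$ (Minkowski sums; the volume is a homogeneous polynomial of degree $N$ in $s_1,\dots,s_N\ge0$). $L[k]$ means that $L$ is repeated $k$ times. Identify $\mathbb{R}^{pn}=(\mathbb{R}^n)^p$; $\Delta_p(x)=(x,\dots,x)$ is the diagonal embedding $\mathbb{R}^n\to\mathbb{R}^{pn}$ and $\iota_i:\mathbb{R}^n\to\mathbb{R}^{pn}$, $1\le i\le p$, the inclusion into the $i$-th factor. $\mathcal{J}_p^n=\{\bm j=(j_0,\dots,j_p)\in\mathbb{N}_0^{p+1}:j_0+\dots+j_p=n\}$; $\binom{n}{\bm j}=\frac{n!}{j_0!\cdots j_p!}$; $W_{p,K}(\bm j)=V\big(-\Delta_pK[n-j_0],\iota_1K[n-j_1],\dots,\iota_pK[n-j_p]\big)$. $\Theta_p=\{\bm t=(t_0,\dots,t_p)\in\mathbb{R}^{p+1}:t_l\ge0,\ t_0+\dots+t_p=1\}$, with relative interior $\mathrm{relint}(\Theta_p)$ (all $t_l>0$);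 $\bm t^{\,n-\bm j}=\prod_{l=0}^pt_l^{n-j_l}$, with $0^0=1$. The higher-order unbalanced difference body is the Minkowski sum $D_p^{\bm t}K=-t_0\Delta_pK+\sum_{l=1}^pt_l\iota_lK\subset\mathbb{R}^{np}$. (The ratio $|D_p^{\bm t}S_n|/|S_n|^p$ does not depend on the choice of the $n$-simplex, by affine invariance.) *)

theory Defs
  imports "HOL-Analysis.Analysis"
begin

definition convex_bodies :: "'a::euclidean_space set set" where
  "convex_bodies = {K. K \<noteq> {} \<and> compact K \<and> convex K}"

text \<open>
  The space $(R^n)^p$ is modelled by the extensional functions from \<open>{1..p}\<close> to \<open>real^'n\<close>,
  since \<open>p\<close> has to be quantified inside formulas. \<open>power_volume p\<close> is its Lebesgue measure.
\<close>

definition power_volume :: "nat \<Rightarrow> (nat \<Rightarrow> real^'n) set \<Rightarrow> real" where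
  "power_volume p A = measure (completion (Pi\<^sub>M {1..p} (\<lambda>_. lborel))) A"

definition diag :: "nat \<Rightarrow> real^'n \<Rightarrow> nat \<Rightarrow> real^'n" where
  "diag p x = (\<lambda>k\<in>{1..p}. x)"

definition incl :: "nat \<Rightarrow> nat \<Rightarrow> real^'n \<Rightarrow> nat \<Rightarrow> real^'n" where
  "incl p i x = (\<lambda>k\<in>{1..p}. if k = i then x else 0)"

definition power_neg :: "nat \<Rightarrow> (nat \<Rightarrow> real^'n) set \<Rightarrow> (nat \<Rightarrow> real^'n) set" where
  "power_neg p A = (\<lambda>x. \<lambda>k\<in>{1..p}. - x k) ` A"

text \<open>The Minkowski combination $s_0 K_0 + \dots + s_{N-1} K_{N-1}$ of subsets of $(R^n)^p$.\<close>

definition minkowski_comb ::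
    "nat \<Rightarrow> (nat \<Rightarrow> real) \<Rightarrow> (nat \<Rightarrow> real^'n) set list \<Rightarrow> (nat \<Rightarrow> real^'n) set" where
  "minkowski_comb p s Ks =
     {(\<lambda>k\<in>{1..p}. \<Sum>i<length Ks. s i *\<^sub>R x i k) | x. \<forall>i<length Ks. x i \<in> Ks ! i}"

text \<open>
  The partial derivative in the \<open>i\<close>-th variable of a function on the orthant
  $s_0, s_1, \dots \ge 0$; it is one-sided at $s_i = 0$. The volume of a Minkowski combination is
  a polynomial in the coefficients only on this orthant.
\<close>

definition partial_deriv :: "nat \<Rightarrow> ((nat \<Rightarrow> real) \<Rightarrow> real) \<Rightarrow> (nat \<Rightarrow> real) \<Rightarrow> real" where
  "partial_deriv i f s = vector_derivative (\<lambda>u. f (s(i := u))) (at (s i) within {0..})"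

text \<open>
  Only meaningful when the number of bodies is the dimension of the ambient space,
  i.e. \<open>length Ks = p * CARD('n)\<close>.
\<close>

definition mixed_volume :: "nat \<Rightarrow> (nat \<Rightarrow> real^'n) set list \<Rightarrow> real" where
  "mixed_volume p Ks =
     1 / fact (length Ks) *
       foldr partial_deriv [0..<length Ks] (\<lambda>s. power_volume p (minkowski_comb p s Ks)) (\<lambda>_. 0)"

definition multi_indices :: "nat \<Rightarrow> nat \<Rightarrow> (nat \<Rightarrow> nat) set" where
  "multi_indices n p = {j \<in> {0..p} \<rightarrow>\<^sub>E UNIV. (\<Sum>l=0..p. j l) = n}"

definition multinomial :: "nat \<Rightarrow> nat \<Rightarrow> (nat \<Rightarrow> nat) \<Rightarrow> real" where
  "multinomial n p j = fact n / (\<Prod>l=0..p. fact (j l))"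

definition W :: "nat \<Rightarrow> (real^'n) set \<Rightarrow> (nat \<Rightarrow> nat) \<Rightarrow> real" where
  "W p K j =
     mixed_volume p
       (replicate (CARD('n) - j 0) (power_neg p (diag p ` K)) @
        concat (map (\<lambda>i. replicate (CARD('n) - j i) (incl p i ` K)) [1..<Suc p]))"

definition Theta :: "nat \<Rightarrow> (nat \<Rightarrow> real) set" where
  "Theta p = {t \<in> {0..p} \<rightarrow>\<^sub>E UNIV. (\<forall>l\<le>p. 0 \<le> t l) \<and> (\<Sum>l=0..p. t l) = 1}"

definition relint_Theta :: "nat \<Rightarrow> (nat \<Rightarrow> real) set" where
  "relint_Theta p = {t \<in> Theta p. \<forall>l\<le>p. 0 < t l}"

definition monomial :: "nat \<Rightarrow> nat \<Rightarrow> (nat \<Rightarrow> real) \<Rightarrow> (nat \<Rightarrow> nat) \<Rightarrow> real" where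
  "monomial n p t j = (\<Prod>l=0..p. t l ^ (n - j l))"

text \<open>In the list below, $-\Delta_p K$ has position 0 and $\iota_l K$ has position \<open>l\<close>.\<close>

definition diff_body :: "nat \<Rightarrow> (nat \<Rightarrow> real) \<Rightarrow> (real^'n) set \<Rightarrow> (nat \<Rightarrow> real^'n) set" where
  "diff_body p t K =
     minkowski_comb p t (power_neg p (diag p ` K) # map (\<lambda>l. incl p l ` K) [1..<Suc p])"

end

(* Write F(t) = |D_p^t K|. By Fubini in one factor, F is in each variable separately an integral of
   volumes of Minkowski sums A + tB in R^n; such a volume is a polynomial of degree at most n, because for
   polytopes it is the integral of det(H + t H'), H and H' the Hessians of the log-sum-exp functions of
   the vertices, whose gradients sweep out the polytopes. Together with homogeneity, F(t) is the sum of
   c_j t^(n-j), and iterated differentiation gives W_{p,K}(j) = c_j prod (n-j_l)! / (np)!.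
   Hence integrating F(x_0 t_0, ..., x_p t_p) against exp(-x_0 - ... - x_p) turns F into
   (np)! sum_j t^(n-j) W_{p,K}(j), so the theorem is the integrated form of the hypothesis. For the
   standard simplex the transform factorises over the coordinates and equals (sum_c prod_{l /= c} t_l)^n,
   which the multinomial theorem expands. Equality of the integrals forces equality at some x > 0. *)
theory Submission
  imports Defs "HOL-Probability.Probability"
begin

section \<open>Polynomials on the half-line via Lagrange interpolation\<close>

text \<open>The polynomial structure of F on the orthant is needed in all p+1 variables, and t_0 is
  the awkward one, since -t_0 Delta_p K enters every coordinate. The difference body is therefore
  described symmetrically: with z_0 = 0, a point z lies in it iff the sets t_l K - z_l, 0 <= l <= p,
  have a common point. This condition is invariant under a common shift of all z_l, so any index may
  be the one normalised to 0, and each t_l becomes the variable of one Fubini factor. Degree at most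
  n in each variable together with total degree np leaves exactly the exponents n - j with j in
  J_p^n. Exponential weights are the right kernel because their k-th moment is k!, the factor that
  iterated differentiation produces. For the simplex, the obstacle to factorising is a maximum of
  coordinates m; it is removed by writing exp(-s m) as the integral of s exp(-s r) over r >= m. The
  hypothesis is used at weights x_l t_l, which need not sum to 1; homogeneity carries it
  there.\<close>

definition lagrange_basis :: "nat \<Rightarrow> nat \<Rightarrow> real poly" where
  "lagrange_basis n k = (\<Prod>i\<in>{..n}-{k}. smult (1 / (real k - real i)) [:- real i, 1:])"

lemma degree_lagrange_basis:
  assumes "k \<le> n" shows "degree (lagrange_basis n k) \<le> n"
proof -
  have "degree (lagrange_basis n k) \<le> sum (degree \<circ> (\<lambda>i. smult (1 / (real k - real i)) [:- real i, 1:])) ({..n}-{k})"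
    unfolding lagrange_basis_def by (rule degree_prod_sum_le) simp
  also have "\<dots> \<le> (\<Sum>i\<in>{..n}-{k}. 1)"
    by (rule sum_mono) (simp add: degree_smult_le)
  also have "\<dots> = n" using assms by simp
  finally show ?thesis .
qed

lemma poly_lagrange_basis:
  assumes "k \<le> n" "j \<le> n"
  shows "poly (lagrange_basis n k) (real j) = (if j = k then 1 else 0)"
proof (cases "j = k")
  case True
  have "poly (lagrange_basis n k) (real k) = (\<Prod>i\<in>{..n}-{k}. 1)"
    unfolding lagrange_basis_def poly_prod
  proof (rule prod.cong)
    fix i assume "i \<in> {..n} - {k}"
    then have "real k - real i \<noteq> 0" by auto
    then show "poly (smult (1 / (real k - real i)) [:- real i, 1:]) (real k) = 1"
      by (simp add: diff_divide_distrib[symmetric])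
  qed simp
  then show ?thesis using True by simp
next
  case False
  have "poly (lagrange_basis n k) (real j) = 0"
    unfolding lagrange_basis_def poly_prod
    by (rule prod_zero) (use False assms in \<open>auto intro!: bexI[of _ j]\<close>)
  then show ?thesis using False by simp
qed

text \<open>The difference has degree at most \<open>n\<close> and vanishes at \<open>n + 1\<close>
  nodes. The nodes 0, ..., n are nonnegative, so the identity makes sense for functions known only
  on the half-line.\<close>

lemma lagrange_interpolation:
  assumes "degree q \<le> n"
  shows "q = (\<Sum>k\<le>n. smult (poly q (real k)) (lagrange_basis n k))"
proof -
  define r where "r = q - (\<Sum>k\<le>n. smult (poly q (real k)) (lagrange_basis n k))"
  have deg: "degree r \<le> n" unfolding r_def
    by (intro degree_diff_le assms degree_sum_le) (auto intro: degree_lagrange_basis order_trans[OF degree_smult_le])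
  have z: "poly r (real j) = 0" if "j \<le> n" for j
    using that by (simp add: r_def poly_sum poly_lagrange_basis if_distrib sum.delta cong: if_cong)
  have "r = 0"
  proof (rule ccontr)
    assume "r \<noteq> 0"
    have "card (real ` {..n}) \<le> card {x. poly r x = 0}"
      by (rule card_mono) (use z poly_roots_finite[OF \<open>r \<noteq> 0\<close>] in auto)
    also have "\<dots> \<le> n" using card_poly_roots_bound[OF \<open>r \<noteq> 0\<close>] deg by linarith
    finally show False by (simp add: card_image)
  qed
  then show ?thesis by (simp add: r_def)
qed

text \<open>Polynomiality is encoded by Lagrange's identity because that passes to limits and integrals.\<close>

definition poly_on_nonneg :: "nat \<Rightarrow> (real \<Rightarrow> real) \<Rightarrow> bool" where
  "poly_on_nonneg n f \<longleftrightarrow> (\<forall>t\<ge>0. f t = (\<Sum>k\<le>n. f (real k) * poly (lagrange_basis n k) t))"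

lemma poly_on_nonnegI:
  assumes "degree q \<le> n" "\<And>t. t \<ge> 0 \<Longrightarrow> f t = poly q t"
  shows "poly_on_nonneg n f"
  unfolding poly_on_nonneg_def
proof (intro allI impI)
  fix t :: real assume "t \<ge> 0"
  have "poly q t = poly (\<Sum>k\<le>n. smult (poly q (real k)) (lagrange_basis n k)) t"
    using lagrange_interpolation[OF assms(1)] by simp
  then show "f t = (\<Sum>k\<le>n. f (real k) * poly (lagrange_basis n k) t)"
    using assms(2) \<open>t \<ge> 0\<close> by (simp add: poly_sum)
qed

lemma poly_on_nonneg_limit:
  assumes "\<And>k. poly_on_nonneg n (F k)" "\<And>t. t \<ge> 0 \<Longrightarrow> (\<lambda>k. F k t) \<longlonglongrightarrow> f t"
  shows "poly_on_nonneg n f"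
  unfolding poly_on_nonneg_def
proof (intro allI impI)
  fix t :: real assume t: "t \<ge> 0"
  have "(\<lambda>k. \<Sum>i\<le>n. F k (real i) * poly (lagrange_basis n i) t)
      \<longlonglongrightarrow> (\<Sum>i\<le>n. f (real i) * poly (lagrange_basis n i) t)"
    by (intro tendsto_intros assms) simp
  moreover have "(\<Sum>i\<le>n. F k (real i) * poly (lagrange_basis n i) t) = F k t" for k
    using assms(1)[of k] t unfolding poly_on_nonneg_def by metis
  ultimately show "f t = (\<Sum>k\<le>n. f (real k) * poly (lagrange_basis n k) t)"
    using assms(2)[OF t] LIMSEQ_unique by auto
qed

lemma poly_on_nonneg_sum:
  assumes "\<And>k. k \<in> I \<Longrightarrow> poly_on_nonneg n (\<lambda>t. F k t)"
  shows "poly_on_nonneg n (\<lambda>t. \<Sum>k\<in>I. F k t * c k)"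
  unfolding poly_on_nonneg_def
proof (intro allI impI)
  fix t :: real assume t: "t \<ge> 0"
  have "(\<Sum>k\<in>I. F k t * c k) = (\<Sum>k\<in>I. (\<Sum>i\<le>n. F k (real i) * poly (lagrange_basis n i) t) * c k)"
    by (rule sum.cong) (use assms t in \<open>auto simp: poly_on_nonneg_def\<close>)
  also have "\<dots> = (\<Sum>i\<le>n. \<Sum>k\<in>I. F k (real i) * poly (lagrange_basis n i) t * c k)"
    unfolding sum_distrib_right by (rule sum.swap)
  also have "\<dots> = (\<Sum>i\<le>n. (\<Sum>k\<in>I. F k (real i) * c k) * poly (lagrange_basis n i) t)"
    unfolding sum_distrib_right by (simp add: mult_ac)
  finally show "(\<Sum>k\<in>I. F k t * c k) = (\<Sum>i\<le>n. (\<Sum>k\<in>I. F k (real i) * c k) * poly (lagrange_basis n i) t)" .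
qed

section \<open>Separately polynomial and homogeneous functions on the orthant\<close>

lemma sum_PiE_insert:
  assumes "l \<notin> A" "finite A"
  shows "(\<Sum>e\<in>insert l A \<rightarrow>\<^sub>E M. h e) = (\<Sum>m\<in>M. \<Sum>e\<in>A \<rightarrow>\<^sub>E M. h (e(l := m)))"
proof -
  have "(\<Sum>e\<in>insert l A \<rightarrow>\<^sub>E M. h e) = (\<Sum>(m, e)\<in>M \<times> (A \<rightarrow>\<^sub>E M). h (e(l := m)))"
    unfolding PiE_insert_eq
    using sum.reindex[OF inj_combinator[OF assms(1)], of h]
    by (simp add: case_prod_unfold)
  then show ?thesis by (simp add: sum.cartesian_product)
qed

lemma poly_eq_sum_atMost:
  fixes q :: "real poly"
  assumes "degree q \<le> n"
  shows "poly q x = (\<Sum>m\<le>n. coeff q m * x ^ m)"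
  unfolding poly_altdef
  by (rule sum.mono_neutral_left) (use assms in \<open>auto simp: coeff_eq_0\<close>)

text \<open>Induction on the set of variables. Interpolation in the variable \<open>l\<close>
  expresses \<open>f\<close> through its values at \<open>t l = 0, ..., n\<close>, and each of these
  is again separately polynomial in the remaining variables. The last hypothesis says that
  \<open>f\<close> ignores coordinates outside \<open>A\<close>.\<close>

lemma separately_polynomial:
  fixes f :: "('i \<Rightarrow> real) \<Rightarrow> real"
  assumes "finite A"
    and "\<And>l t. l \<in> A \<Longrightarrow> \<forall>i\<in>A. t i \<ge> 0 \<Longrightarrow> poly_on_nonneg n (\<lambda>u. f (t(l := u)))"
    and "\<And>s t. \<forall>i\<in>A. s i = t i \<Longrightarrow> f s = f t"
  shows "\<exists>c. \<forall>t. (\<forall>i\<in>A. t i \<ge> 0) \<longrightarrow> f t = (\<Sum>e\<in>A \<rightarrow>\<^sub>E {..n}. c e * (\<Prod>i\<in>A. t i ^ e i))"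
  using assms
proof (induction A arbitrary: f rule: finite_induct)
  case empty
  have "f t = f (\<lambda>_. 0)" for t by (rule empty) auto
  then show ?case by (intro exI[of _ "\<lambda>_. f (\<lambda>_. 0)"]) (auto simp: fun_eq_iff)
next
  case (insert l A)
  \<comment> \<open>\<open>g m\<close> is the coefficient of \<open>t l ^ m\<close> in the
    interpolation polynomial of \<open>f\<close> in the variable \<open>l\<close>.\<close>
  define g where "g m t = (\<Sum>k\<le>n. f (t(l := real k)) * coeff (lagrange_basis n k) m)" for m t
  have "\<exists>c. \<forall>t. (\<forall>i\<in>A. t i \<ge> 0) \<longrightarrow> g m t = (\<Sum>e\<in>A \<rightarrow>\<^sub>E {..n}. c e * (\<Prod>i\<in>A. t i ^ e i))" for m
  proof (rule insert.IH)
    fix i and t :: "'i \<Rightarrow> real" assume i: "i \<in> A" "\<forall>i\<in>A. t i \<ge> 0"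
    then have "l \<noteq> i" using insert by auto
    show "poly_on_nonneg n (\<lambda>u. g m (t(i := u)))" unfolding g_def
    proof (rule poly_on_nonneg_sum)
      fix k
      show "poly_on_nonneg n (\<lambda>u. f (t(i := u, l := real k)))"
        unfolding fun_upd_twist[OF \<open>l \<noteq> i\<close>[symmetric], of t] by (rule insert.prems(1)) (use i in auto)
    qed
  next
    fix s t :: "'i \<Rightarrow> real" assume "\<forall>i\<in>A. s i = t i"
    then show "g m s = g m t"
      unfolding g_def by (auto intro!: sum.cong insert.prems(2))
  qed
  then obtain cc where cc: "\<And>m t. (\<forall>i\<in>A. t i \<ge> 0) \<Longrightarrow>
      g m t = (\<Sum>e\<in>A \<rightarrow>\<^sub>E {..n}. cc m e * (\<Prod>i\<in>A. t i ^ e i))"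
    by metis
  show ?case
  proof (intro exI[of _ "\<lambda>e. cc (e l) (restrict e A)"] allI impI)
    fix t :: "'i \<Rightarrow> real" assume t: "\<forall>i\<in>insert l A. t i \<ge> 0"
    have "poly_on_nonneg n (\<lambda>u. f (t(l := u)))" by (rule insert.prems(1)) (use t in auto)
    then have "f (t(l := t l)) = (\<Sum>k\<le>n. f (t(l := real k)) * poly (lagrange_basis n k) (t l))"
      using t unfolding poly_on_nonneg_def by blast
    also have "\<dots> = (\<Sum>k\<le>n. f (t(l := real k)) * (\<Sum>m\<le>n. coeff (lagrange_basis n k) m * t l ^ m))"
      by (intro sum.cong refl) (simp add: poly_eq_sum_atMost[OF degree_lagrange_basis])
    also have "\<dots> = (\<Sum>m\<le>n. g m t * t l ^ m)"
      unfolding g_def sum_distrib_left sum_distrib_right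
      by (subst sum.swap) (simp add: mult_ac)
    also have "\<dots> = (\<Sum>m\<le>n. \<Sum>e\<in>A \<rightarrow>\<^sub>E {..n}. cc m e * (\<Prod>i\<in>A. t i ^ e i) * t l ^ m)"
      using cc[of t] t by (simp add: sum_distrib_right)
    also have "\<dots> = (\<Sum>m\<le>n. \<Sum>e\<in>A \<rightarrow>\<^sub>E {..n}.
       cc ((e(l := m)) l) (restrict (e(l := m)) A) * (\<Prod>i\<in>insert l A. t i ^ (e(l := m)) i))"
    proof (intro sum.cong refl)
      fix m e assume e: "e \<in> A \<rightarrow>\<^sub>E {..n}"
      have "restrict (e(l := m)) A = e"
        using PiE_arb[OF e] insert.hyps(2) by (intro ext) (auto simp: restrict_def)
      moreover have "(\<Prod>i\<in>A. t i ^ (e(l := m)) i) = (\<Prod>i\<in>A. t i ^ e i)"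
        using insert.hyps by (intro prod.cong) auto
      ultimately show "cc m e * (\<Prod>i\<in>A. t i ^ e i) * t l ^ m =
         cc ((e(l := m)) l) (restrict (e(l := m)) A) * (\<Prod>i\<in>insert l A. t i ^ (e(l := m)) i)"
        using insert.hyps by simp
    qed
    also have "\<dots> = (\<Sum>e\<in>insert l A \<rightarrow>\<^sub>E {..n}. cc (e l) (restrict e A) * (\<Prod>i\<in>insert l A. t i ^ e i))"
      using insert.hyps by (subst sum_PiE_insert) auto
    finally show "f t = \<dots>" by simp
  qed
qed

text \<open>Along the ray through \<open>t\<close> the representation is a polynomial in
  \<open>r\<close>, which agrees with \<open>r ^ N * f t\<close> for infinitely many
  \<open>r\<close>. Comparing the coefficients of \<open>r ^ N\<close> keeps exactly the monomials
  of total degree \<open>N\<close>.\<close>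

lemma homogeneous_part:
  fixes f :: "('i \<Rightarrow> real) \<Rightarrow> real"
  assumes "finite E"
    and rep: "\<And>t. (\<forall>i\<in>A. t i \<ge> 0) \<Longrightarrow> f t = (\<Sum>e\<in>E. c e * (\<Prod>i\<in>A. t i ^ e i))"
    and hom: "\<And>t r. (\<forall>i\<in>A. t i \<ge> 0) \<Longrightarrow> r > 0 \<Longrightarrow> f (\<lambda>i. r * t i) = r ^ N * f t"
    and t: "\<forall>i\<in>A. t i \<ge> 0"
  shows "f t = (\<Sum>e | e \<in> E \<and> sum e A = N. c e * (\<Prod>i\<in>A. t i ^ e i))"
proof -
  define P where "P = (\<Sum>e\<in>E. monom (c e * (\<Prod>i\<in>A. t i ^ e i)) (sum e A))"
  have eq: "poly (P - monom (f t) N) r = 0" if "r > 0" for r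
  proof -
    have "r ^ N * f t = (\<Sum>e\<in>E. c e * (\<Prod>i\<in>A. (r * t i) ^ e i))"
      using hom[OF t that] rep[of "\<lambda>i. r * t i"] t that by simp
    also have "\<dots> = poly P r"
      by (simp add: P_def poly_sum poly_monom power_mult_distrib prod.distrib power_sum mult_ac)
    finally show ?thesis by (simp add: poly_monom mult_ac)
  qed
  have "P - monom (f t) N = 0"
  proof (rule ccontr)
    assume "P - monom (f t) N \<noteq> 0"
    then have "finite {r. poly (P - monom (f t) N) r = 0}" by (rule poly_roots_finite)
    moreover have "{0<..} \<subseteq> {r. poly (P - monom (f t) N) r = 0}" using eq by auto
    ultimately show False using infinite_Ioi finite_subset by blast
  qed
  then have "f t = coeff P N" by simp
  also have "\<dots> = (\<Sum>e\<in>E. if sum e A = N then c e * (\<Prod>i\<in>A. t i ^ e i) else 0)"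
    by (simp add: P_def coeff_sum)
  also have "\<dots> = (\<Sum>e | e \<in> E \<and> sum e A = N. c e * (\<Prod>i\<in>A. t i ^ e i))"
    using assms(1) by (subst sum.inter_filter[symmetric]) auto
  finally show ?thesis .
qed

section \<open>Gradients of log-sum-exp functions\<close>

text \<open>On the segment from the identity to \<open>M\<close> the quadratic form stays positive
  before the endpoint, so the determinant starts at 1 and never vanishes there; at the endpoint it
  is a limit of positive numbers.\<close>

lemma pos_semidef_det_nonneg:
  fixes M :: "real^'n^'n"
  assumes "\<And>u. u \<bullet> (M *v u) \<ge> 0"
  shows "det M \<ge> 0"
proof -
  define D where "D s = det ((1 - s) *\<^sub>R mat 1 + s *\<^sub>R M)" for s :: real
  have entries: "((1 - s) *\<^sub>R mat 1 + s *\<^sub>R M) $ i $ j = (1 - s) * (mat 1 :: real^'n^'n) $ i $ j + s * M $ i $ j" for s i j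
    by simp
  have cont: "continuous_on UNIV D"
    unfolding D_def det_def entries by (intro continuous_intros)
  have nz: "D s \<noteq> 0" if "0 \<le> s" "s < 1" for s
  proof
    assume "D s = 0"
    then obtain u where u: "u \<noteq> 0" "((1 - s) *\<^sub>R mat 1 + s *\<^sub>R M) *v u = 0"
      unfolding D_def using invertible_det_nz matrix_left_invertible_ker invertible_left_inverse by blast
    have "0 = u \<bullet> (((1 - s) *\<^sub>R mat 1 + s *\<^sub>R M) *v u)" using u by simp
    also have "\<dots> = (1 - s) * (u \<bullet> u) + s * (u \<bullet> (M *v u))"
      by (simp add: matrix_vector_mult_add_rdistrib inner_add_right scaleR_matrix_vector_assoc[symmetric])
    also have "\<dots> > 0" using that u assms[of u] by (intro add_pos_nonneg mult_pos_pos mult_nonneg_nonneg) auto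
    finally show False by simp
  qed
  have pos: "D s > 0" if s: "0 \<le> s" "s < 1" for s
  proof (rule ccontr)
    assume "\<not> D s > 0"
    moreover have "D 0 = 1" by (simp add: D_def)
    ultimately have "\<exists>x\<ge>0. x \<le> s \<and> D x = 0"
      using IVT2'[of D s 0 0] s continuous_on_subset[OF cont] by (auto)
    then show False using nz s by force
  qed
  have "(D \<longlongrightarrow> D 1) (at_left 1)"
    using cont by (auto simp: continuous_on_def intro: tendsto_within_subset)
  moreover have "\<forall>\<^sub>F s in at_left 1. 0 \<le> D s"
  proof (rule eventually_mono[OF eventually_at_left_real])
    show "(0::real) < 1" by simp
    show "0 \<le> D s" if "s \<in> {0<..<1}" for s using pos[of s] that by simp
  qed
  ultimately have "D 1 \<ge> 0"
    by (rule tendsto_lowerbound) simp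
  then show ?thesis by (simp add: D_def)
qed

lemma det_pencil_poly:
  fixes M N :: "real^'n^'n"
  shows "poly_on_nonneg CARD('n) (\<lambda>t. det (M + t *\<^sub>R N))"
proof (rule poly_on_nonnegI)
  let ?q = "\<Sum>p | p permutes (UNIV :: 'n set). smult (of_int (sign p)) (\<Prod>i\<in>UNIV. [:M $ i $ p i, N $ i $ p i:])"
  show "degree ?q \<le> CARD('n)"
  proof (rule degree_sum_le)
    fix p :: "'n \<Rightarrow> 'n" assume "p \<in> {p. p permutes UNIV}"
    have "degree (\<Prod>i\<in>UNIV. [:M $ i $ p i, N $ i $ p i:]) \<le> (\<Sum>i\<in>(UNIV::'n set). 1)"
      by (rule order_trans[OF degree_prod_sum_le[OF finite] sum_mono]) (simp add: degree_pCons_eq_if)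
    then show "degree (smult (of_int (sign p)) (\<Prod>i\<in>UNIV. [:M $ i $ p i, N $ i $ p i:])) \<le> CARD('n)"
      by (intro order_trans[OF degree_smult_le]) simp
  qed simp
  show "det (M + t *\<^sub>R N) = poly ?q t" for t
    by (simp add: det_def poly_sum poly_prod)
qed

text \<open>The softmax weights of the points of \<open>V\<close>. They are the weights that appear
  in the gradient of the log-sum-exp function of \<open>V\<close>: this gradient is the mean
  \<open>gibbs_mean\<close>.\<close>

definition gibbs :: "'a::real_inner set \<Rightarrow> 'a \<Rightarrow> 'a \<Rightarrow> real" where
  "gibbs V x v = exp (v \<bullet> x) / (\<Sum>w\<in>V. exp (w \<bullet> x))"

definition gibbs_mean :: "'a::real_inner set \<Rightarrow> 'a \<Rightarrow> 'a" where
  "gibbs_mean V x = (\<Sum>v\<in>V. gibbs V x v *\<^sub>R v)"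

text \<open>The covariance of the Gibbs distribution, applied to \<open>u\<close>; it is the Hessian
  of log-sum-exp.\<close>

definition gibbs_hess :: "'a::real_inner set \<Rightarrow> 'a \<Rightarrow> 'a \<Rightarrow> 'a" where
  "gibbs_hess V x u = (\<Sum>v\<in>V. (gibbs V x v * ((v - gibbs_mean V x) \<bullet> u)) *\<^sub>R (v - gibbs_mean V x))"

lemma gibbs_Z_pos: "finite V \<Longrightarrow> V \<noteq> {} \<Longrightarrow> (\<Sum>w\<in>V. exp (w \<bullet> x)) > 0" for x :: "'a::real_inner"
  by (rule sum_pos) auto

lemma gibbs_pos: "finite V \<Longrightarrow> V \<noteq> {} \<Longrightarrow> gibbs V x v > 0"
  unfolding gibbs_def by (simp add: gibbs_Z_pos)

lemma gibbs_sum: "finite V \<Longrightarrow> V \<noteq> {} \<Longrightarrow> (\<Sum>v\<in>V. gibbs V x v) = 1"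
  using gibbs_Z_pos[of V x] by (simp add: gibbs_def sum_divide_distrib[symmetric])

lemma gibbs_mean_in_hull: "finite V \<Longrightarrow> V \<noteq> {} \<Longrightarrow> gibbs_mean V x \<in> convex hull V"
  unfolding convex_hull_finite gibbs_mean_def mem_Collect_eq
  by (intro exI[of _ "gibbs V x"] conjI ballI less_imp_le gibbs_pos gibbs_sum refl)

lemma log_sum_exp_has_derivative:
  fixes V :: "'a::real_inner set"
  assumes "finite V" "V \<noteq> {}"
  shows "((\<lambda>x. ln (\<Sum>v\<in>V. exp (v \<bullet> x))) has_derivative (\<lambda>u. gibbs_mean V x \<bullet> u)) (at x)"
proof -
  have "((\<lambda>x. ln (\<Sum>v\<in>V. exp (v \<bullet> x))) has_derivative
      (\<lambda>u. (\<Sum>v\<in>V. exp (v \<bullet> x) * (v \<bullet> u)) / (\<Sum>v\<in>V. exp (v \<bullet> x)))) (at x)"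
    using gibbs_Z_pos[OF assms, of x] by (auto intro!: derivative_eq_intros simp: divide_inverse mult_ac)
  moreover have "(\<Sum>v\<in>V. exp (v \<bullet> x) * (v \<bullet> u)) / (\<Sum>v\<in>V. exp (v \<bullet> x)) = gibbs_mean V x \<bullet> u" for u
    by (simp add: gibbs_mean_def gibbs_def inner_sum_left sum_divide_distrib)
  ultimately show ?thesis by simp
qed

lemma gibbs_has_derivative:
  fixes V :: "'a::real_inner set"
  assumes "finite V" "V \<noteq> {}"
  shows "((\<lambda>x. gibbs V x v) has_derivative (\<lambda>u. gibbs V x v * ((v - gibbs_mean V x) \<bullet> u))) (at x)"
proof -
  let ?L = "\<lambda>x. ln (\<Sum>v\<in>V. exp (v \<bullet> x))"
  have eq: "gibbs V y v = exp (v \<bullet> y - ?L y)" for y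
    using gibbs_Z_pos[OF assms, of y] by (simp add: gibbs_def exp_diff)
  have "((\<lambda>x. exp (v \<bullet> x - ?L x)) has_derivative
     (\<lambda>u. exp (v \<bullet> x - ?L x) * (v \<bullet> u - gibbs_mean V x \<bullet> u))) (at x)"
    by (rule has_derivative_eq_rhs, rule has_derivative_exp, rule has_derivative_diff,
        rule has_derivative_inner_right, rule has_derivative_ident,
        rule log_sum_exp_has_derivative[OF assms]) (simp add: mult_ac)
  then show ?thesis by (simp add: eq[symmetric] inner_diff_left)
qed

lemma gibbs_mean_has_derivative:
  fixes V :: "'a::euclidean_space set"
  assumes "finite V" "V \<noteq> {}"
  shows "(gibbs_mean V has_derivative gibbs_hess V x) (at x)"
proof -
  have "((\<lambda>x. \<Sum>v\<in>V. gibbs V x v *\<^sub>R v) has_derivative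
     (\<lambda>u. \<Sum>v\<in>V. (gibbs V x v * ((v - gibbs_mean V x) \<bullet> u)) *\<^sub>R v)) (at x)"
    by (intro has_derivative_sum has_derivative_scaleR_left gibbs_has_derivative assms)
  moreover have "(\<Sum>v\<in>V. (gibbs V x v * ((v - gibbs_mean V x) \<bullet> u)) *\<^sub>R v) = gibbs_hess V x u" for u
  proof -
    have "(\<Sum>v\<in>V. gibbs V x v * ((v - gibbs_mean V x) \<bullet> u))
       = gibbs_mean V x \<bullet> u - (\<Sum>v\<in>V. gibbs V x v) * (gibbs_mean V x \<bullet> u)"
      by (simp add: inner_diff_left algebra_simps sum_subtractf sum_distrib_right sum_distrib_left)
        (simp add: gibbs_mean_def inner_sum_left mult_ac)
    then have "(\<Sum>v\<in>V. gibbs V x v * ((v - gibbs_mean V x) \<bullet> u)) = 0"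
      using gibbs_sum[OF assms] by simp
    then have "(\<Sum>v\<in>V. (gibbs V x v * ((v - gibbs_mean V x) \<bullet> u)) *\<^sub>R gibbs_mean V x) = 0"
      by (metis scaleR_sum_left scaleR_zero_left)
    then show ?thesis by (simp add: gibbs_hess_def scaleR_diff_right sum_subtractf)
  qed
  ultimately show ?thesis unfolding gibbs_mean_def[abs_def] by simp
qed

lemma gibbs_hess_nonneg:
  assumes "finite V" "V \<noteq> {}"
  shows "u \<bullet> gibbs_hess V x u \<ge> 0"
  unfolding gibbs_hess_def inner_sum_right
proof (rule sum_nonneg)
  fix v
  have "u \<bullet> (gibbs V x v * ((v - gibbs_mean V x) \<bullet> u)) *\<^sub>R (v - gibbs_mean V x)
     = gibbs V x v * ((v - gibbs_mean V x) \<bullet> u)\<^sup>2"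
    by (simp add: power2_eq_square inner_commute)
  then show "0 \<le> u \<bullet> (gibbs V x v * ((v - gibbs_mean V x) \<bullet> u)) *\<^sub>R (v - gibbs_mean V x)"
    using gibbs_pos[OF assms, of x v] by (metis less_imp_le mult_nonneg_nonneg zero_le_power2)
qed

text \<open>The pairing equals the symmetrised relative entropy of the two Gibbs distributions, a
  sum of terms (p - q)(ln p - ln q) >= 0. It vanishes only if all weights agree, and then
  \<open>v \<bullet> (x - y)\<close> is the difference of the two log-sum-exp values for every
  \<open>v\<close>.\<close>

lemma gibbs_mean_monotone:
  fixes V :: "'a::real_inner set"
  assumes "finite V" "V \<noteq> {}"
  shows "(gibbs_mean V x - gibbs_mean V y) \<bullet> (x - y) \<ge> 0"
    and "(gibbs_mean V x - gibbs_mean V y) \<bullet> (x - y) = 0 \<Longrightarrow> \<exists>c. \<forall>v\<in>V. v \<bullet> (x - y) = c"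
proof -
  let ?L = "\<lambda>x. ln (\<Sum>v\<in>V. exp (v \<bullet> x))"
  let ?p = "gibbs V x" and ?q = "gibbs V y"
  have eq: "ln (gibbs V z v) = v \<bullet> z - ?L z" for z v
    using gibbs_Z_pos[OF assms, of z] by (simp add: gibbs_def ln_div)
  have s0: "(\<Sum>v\<in>V. (?p v - ?q v)) = 0" by (simp add: sum_subtractf gibbs_sum[OF assms])
  have "(gibbs_mean V x - gibbs_mean V y) \<bullet> (x - y) = (\<Sum>v\<in>V. (?p v - ?q v) * (v \<bullet> (x - y)))"
    by (simp add: gibbs_mean_def inner_sum_left sum_subtractf[symmetric] inner_diff_left left_diff_distrib)
  \<comment> \<open>Inserting the logarithms of the weights adds the constant
    \<open>?L x - ?L y\<close>, which drops out because both families of weights sum to 1.\<close>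
  also have "\<dots> = (\<Sum>v\<in>V. (?p v - ?q v) * (ln (?p v) - ln (?q v)) + (?p v - ?q v) * (?L x - ?L y))"
    by (rule sum.cong) (auto simp: eq algebra_simps inner_diff_right)
  also have "\<dots> = (\<Sum>v\<in>V. (?p v - ?q v) * (ln (?p v) - ln (?q v)))"
    by (simp only: sum.distrib sum_distrib_right[symmetric] s0 mult_zero_left add_0_right)
  finally have main: "(gibbs_mean V x - gibbs_mean V y) \<bullet> (x - y) = (\<Sum>v\<in>V. (?p v - ?q v) * (ln (?p v) - ln (?q v)))" .
  have nn: "(?p v - ?q v) * (ln (?p v) - ln (?q v)) \<ge> 0" for v
    using gibbs_pos[OF assms, of x v] gibbs_pos[OF assms, of y v]
    by (cases "?p v \<le> ?q v") (auto intro: mult_nonneg_nonneg mult_nonpos_nonpos)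
  show "(gibbs_mean V x - gibbs_mean V y) \<bullet> (x - y) \<ge> 0"
    unfolding main by (rule sum_nonneg) (rule nn)
  assume "(gibbs_mean V x - gibbs_mean V y) \<bullet> (x - y) = 0"
  then have z: "\<forall>v\<in>V. (?p v - ?q v) * (ln (?p v) - ln (?q v)) = 0"
    unfolding main using sum_nonneg_eq_0_iff[OF assms(1), of "\<lambda>v. (?p v - ?q v) * (ln (?p v) - ln (?q v))"] nn by blast
  have "v \<bullet> (x - y) = ?L x - ?L y" if "v \<in> V" for v
  proof -
    have "ln (?p v) = ln (?q v)" using z that by force
    then show ?thesis unfolding eq by (simp add: inner_diff_right)
  qed
  then show "\<exists>c. \<forall>v\<in>V. v \<bullet> (x - y) = c" by blast
qed

text \<open>Log-sum-exp dominates the support function of the hull, which is a maximum over the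
  vertices.\<close>

lemma hull_inner_le_log_sum_exp:
  fixes V :: "'a::real_inner set"
  assumes "finite V" "V \<noteq> {}" "a \<in> convex hull V"
  shows "a \<bullet> x \<le> ln (\<Sum>v\<in>V. exp (v \<bullet> x))"
proof -
  let ?h = "{a. x \<bullet> a \<le> ln (\<Sum>v\<in>V. exp (v \<bullet> x))}"
  have "V \<subseteq> ?h"
  proof
    fix v assume "v \<in> V"
    then have "exp (v \<bullet> x) \<le> (\<Sum>v\<in>V. exp (v \<bullet> x))"
      using assms(1) by (intro member_le_sum) auto
    then show "v \<in> ?h" using gibbs_Z_pos[OF assms(1,2), of x] by (simp add: inner_commute ln_ge_iff)
  qed
  then have "convex hull V \<subseteq> ?h" by (rule hull_minimal) (rule convex_halfspace_le)
  then show ?thesis using assms(3) by (auto simp: inner_commute)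
qed

section \<open>Volumes of Minkowski sums of polytopes\<close>

definition dilated_sum :: "'a::real_vector set \<Rightarrow> real \<Rightarrow> 'a set \<Rightarrow> 'a set" where
  "dilated_sum A t B = {a + t *\<^sub>R b | a b. a \<in> A \<and> b \<in> B}"

lemma dilated_sum_eq_image: "dilated_sum A t B = (\<lambda>(a, b). a + t *\<^sub>R b) ` (A \<times> B)"
  by (auto simp: dilated_sum_def)

lemma convex_dilated_sum:
  assumes "convex A" "convex B" shows "convex (dilated_sum A t B)"
proof -
  have "dilated_sum A t B = (\<Union>x\<in>A. \<Union>y\<in>(*\<^sub>R) t ` B. {x + y})"
    by (auto simp: dilated_sum_def)
  then show ?thesis using convex_sums[OF assms(1) convex_scaling[OF assms(2), of t]] by simp
qed

lemma compact_dilated_sum: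
  fixes A :: "'a::real_normed_vector set"
  assumes "compact A" "compact B" shows "compact (dilated_sum A t B)"
  unfolding dilated_sum_eq_image case_prod_unfold
  by (intro compact_continuous_image compact_Times assms continuous_intros)

text \<open>The function \<open>\<Phi>\<close> has gradient (gradient map) - y, so a minimiser of
  \<open>\<Phi>\<close> is a preimage of \<open>y\<close>. A minimiser exists because a ball around
  \<open>y\<close> inside the body forces \<open>\<Phi>\<close> to grow linearly.\<close>

lemma gibbs_mean_sum_surj:
  fixes V W :: "'a::euclidean_space set"
  assumes V: "finite V" "V \<noteq> {}" and W: "finite W" "W \<noteq> {}" and "t \<ge> 0"
    and y: "y \<in> interior (dilated_sum (convex hull V) t (convex hull W))"
  shows "y \<in> range (\<lambda>x. gibbs_mean V x + t *\<^sub>R gibbs_mean W x)"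
proof -
  define \<Phi> where "\<Phi> x = ln (\<Sum>v\<in>V. exp (v \<bullet> x)) + t * ln (\<Sum>v\<in>W. exp (v \<bullet> x)) - y \<bullet> x" for x
  have der: "(\<Phi> has_derivative (\<lambda>u. (gibbs_mean V x + t *\<^sub>R gibbs_mean W x - y) \<bullet> u)) (at x)" for x
    unfolding \<Phi>_def
    using has_derivative_diff[OF has_derivative_add[OF log_sum_exp_has_derivative[OF V, of x]
        has_derivative_mult_right[OF log_sum_exp_has_derivative[OF W, of x], of t]]
        has_derivative_inner_right[OF has_derivative_ident, of y]]
    by (simp add: inner_add_left inner_diff_left)
  obtain e where e: "e > 0" "cball y e \<subseteq> dilated_sum (convex hull V) t (convex hull W)"
    using y unfolding mem_interior_cball by blast
  have lower: "\<Phi> x \<ge> e * norm x" for x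
  proof -
    \<comment> \<open>The point of the ball farthest in the direction of \<open>x\<close>. For
      \<open>x = 0\<close> the quotient is 0 by convention and the point is \<open>y\<close>
      itself.\<close>
    have "y + (e / norm x) *\<^sub>R x \<in> cball y e" using e(1) by (auto simp: dist_norm)
    then obtain a b where ab: "a \<in> convex hull V" "b \<in> convex hull W" "y + (e / norm x) *\<^sub>R x = a + t *\<^sub>R b"
      using e(2) unfolding dilated_sum_def by blast
    have "y \<bullet> x + e * norm x = (y + (e / norm x) *\<^sub>R x) \<bullet> x"
      by (simp add: inner_add_left dot_square_norm power2_eq_square)
    also have "\<dots> = a \<bullet> x + t * (b \<bullet> x)" by (simp add: ab(3) inner_add_left)
    also have "\<dots> \<le> ln (\<Sum>v\<in>V. exp (v \<bullet> x)) + t * ln (\<Sum>v\<in>W. exp (v \<bullet> x))"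
      using \<open>t \<ge> 0\<close> by (intro add_mono mult_left_mono hull_inner_le_log_sum_exp V W ab)
    finally show ?thesis by (simp add: \<Phi>_def)
  qed
  \<comment> \<open>Beyond this radius the linear lower bound exceeds \<open>\<Phi> 0\<close>, so
    the minimum over the ball is a global one.\<close>
  define R where "R = (\<bar>\<Phi> 0\<bar> + 1) / e"
  have "R > 0" using e by (simp add: R_def)
  have "continuous_on (cball 0 R) \<Phi>"
    using der by (meson has_derivative_continuous continuous_at_imp_continuous_on)
  then obtain x where x: "x \<in> cball 0 R" "\<forall>z\<in>cball 0 R. \<Phi> x \<le> \<Phi> z"
    using continuous_attains_inf[of "cball 0 R" \<Phi>] \<open>R > 0\<close> by auto
  have min: "\<Phi> x \<le> \<Phi> z" for z
  proof (cases "z \<in> cball 0 R")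
    case False
    then have "R \<le> norm z" by simp
    then have "e * R \<le> e * norm z" using e by (intro mult_left_mono) auto
    then have "\<Phi> 0 \<le> \<Phi> z" using lower[of z] e by (simp add: R_def)
    moreover have "\<Phi> x \<le> \<Phi> 0" using x \<open>R > 0\<close> by auto
    ultimately show ?thesis by simp
  qed (use x in auto)
  have "(\<lambda>u. (gibbs_mean V x + t *\<^sub>R gibbs_mean W x - y) \<bullet> u) = (\<lambda>v. 0)"
    by (rule differential_zero_maxmin[of x UNIV, OF _ _ der]) (use min in auto)
  then have "(gibbs_mean V x + t *\<^sub>R gibbs_mean W x - y) \<bullet> (gibbs_mean V x + t *\<^sub>R gibbs_mean W x - y) = 0"
    by meson
  then show ?thesis by (intro image_eqI[of _ _ x]) auto
qed

text \<open>Both summands are monotone, so equal values force equality in the monotonicity for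
  \<open>V\<close>. Distinct arguments would then place all of \<open>V\<close> in a hyperplane,
  against the nonempty interior of its hull.\<close>

lemma gibbs_mean_sum_inj:
  fixes V W :: "'a::euclidean_space set"
  assumes V: "finite V" "interior (convex hull V) \<noteq> {}" and W: "finite W" "W \<noteq> {}" and "t \<ge> 0"
  shows "inj (\<lambda>x. gibbs_mean V x + t *\<^sub>R gibbs_mean W x)"
proof (rule injI)
  fix x y assume eq: "gibbs_mean V x + t *\<^sub>R gibbs_mean W x = gibbs_mean V y + t *\<^sub>R gibbs_mean W y"
  have "V \<noteq> {}" using V by auto
  have "0 = (gibbs_mean V x + t *\<^sub>R gibbs_mean W x - (gibbs_mean V y + t *\<^sub>R gibbs_mean W y)) \<bullet> (x - y)"
    using eq by simp
  also have "\<dots> = (gibbs_mean V x - gibbs_mean V y) \<bullet> (x - y) + t * ((gibbs_mean W x - gibbs_mean W y) \<bullet> (x - y))"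
    by (simp add: inner_add_left inner_diff_left algebra_simps)
  finally have "(gibbs_mean V x - gibbs_mean V y) \<bullet> (x - y) = 0"
    using gibbs_mean_monotone(1)[OF V(1) \<open>V \<noteq> {}\<close>, of x y] gibbs_mean_monotone(1)[OF W, of x y]
      mult_nonneg_nonneg[OF \<open>t \<ge> 0\<close>] by fastforce
  then obtain c where c: "\<forall>v\<in>V. v \<bullet> (x - y) = c"
    using gibbs_mean_monotone(2)[OF V(1) \<open>V \<noteq> {}\<close>] by blast
  show "x = y"
  proof (rule ccontr)
    assume "x \<noteq> y"
    have "convex hull V \<subseteq> {v. (x - y) \<bullet> v = c}"
    proof (rule hull_minimal)
      show "V \<subseteq> {v. (x - y) \<bullet> v = c}" using c by (auto simp: inner_commute)
    qed (rule convex_hyperplane)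
    then have "interior (convex hull V) \<subseteq> interior {v. (x - y) \<bullet> v = c}" by (rule interior_mono)
    then show False using V(2) interior_hyperplane[of "x - y" c] \<open>x \<noteq> y\<close> by auto
  qed
qed

text \<open>Change of variables along the gradient map. Its range lies between the interior of the
  convex set and the set, hence fills it up to the negligible frontier. As the Hessians are positive
  semidefinite, the Jacobian determinant is nonnegative; dropping the absolute value is what makes
  the integrand polynomial in \<open>t\<close>.\<close>

lemma volume_polytope_sum:
  fixes V W :: "(real^'m::{finite,wellorder}) set"
  assumes V: "finite V" "interior (convex hull V) \<noteq> {}" and W: "finite W" "W \<noteq> {}" and "t \<ge> 0"
  shows "((\<lambda>x. det (matrix (gibbs_hess V x) + t *\<^sub>R matrix (gibbs_hess W x)))
      has_integral measure lebesgue (dilated_sum (convex hull V) t (convex hull W))) UNIV"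
proof -
  have V0: "V \<noteq> {}" using V by auto
  let ?C = "dilated_sum (convex hull V) t (convex hull W)"
  let ?g = "\<lambda>x. gibbs_mean V x + t *\<^sub>R gibbs_mean W x"
  let ?g' = "\<lambda>x u. gibbs_hess V x u + t *\<^sub>R gibbs_hess W x u"
  have der: "(?g has_derivative ?g' x) (at x)" for x
    by (intro derivative_intros gibbs_mean_has_derivative V W V0)
  have lin: "linear (gibbs_hess V x)" "linear (gibbs_hess W x)" for x
    using gibbs_mean_has_derivative V W V0 has_derivative_linear by blast+
  have mat: "matrix (?g' x) = matrix (gibbs_hess V x) + t *\<^sub>R matrix (gibbs_hess W x)" for x
    by (simp add: matrix_def vec_eq_iff)
  have C: "convex ?C" "compact ?C"
    using V W by (auto intro!: convex_dilated_sum compact_dilated_sum finite_imp_compact_convex_hull)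
  have sub: "range ?g \<subseteq> ?C"
    unfolding dilated_sum_def using gibbs_mean_in_hull[OF V(1) V0] gibbs_mean_in_hull[OF W] by blast
  have sup: "interior ?C \<subseteq> range ?g"
    using gibbs_mean_sum_surj[OF V(1) V0 W \<open>t \<ge> 0\<close>] by blast
  have neg: "negligible (?C - range ?g)"
    by (rule negligible_subset[OF negligible_convex_frontier[OF C(1)]])
      (use sup closure_subset[of ?C] in \<open>auto simp: frontier_def\<close>)
  have symd: "sym_diff ?C (range ?g) = ?C - range ?g" using sub by auto
  have lm: "?C \<in> lmeasurable" using C by (simp add: lmeasurable_compact)
  have lm2: "range ?g \<in> lmeasurable"
    by (rule lmeasurable_negligible_symdiff[OF lm]) (use neg symd in auto)
  have meas: "measure lebesgue (range ?g) = measure lebesgue ?C"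
    by (rule measure_negligible_symdiff[OF lm]) (use neg symd in auto)
  have det_nn: "det (matrix (?g' x)) \<ge> 0" for x
  proof (rule pos_semidef_det_nonneg)
    fix u
    have "matrix (?g' x) *v u = ?g' x u"
      using has_derivative_linear[OF der] by (simp add: matrix_works)
    then show "u \<bullet> (matrix (?g' x) *v u) \<ge> 0"
      using gibbs_hess_nonneg[OF V(1) V0, of u x] gibbs_hess_nonneg[OF W, of u x] \<open>t \<ge> 0\<close>
      by (simp add: inner_add_right)
  qed
  \<comment> \<open>The change of variables theorem is stated for vector-valued integrands, so the
    constant 1 is taken in dimension one.\<close>
  have "(\<lambda>_. 1 :: real^1) absolutely_integrable_on (range ?g)"
    by (rule absolutely_integrable_on_const[OF lm2])
  moreover have "integral (range ?g) (\<lambda>_. 1 :: real^1) = vec (measure lebesgue ?C)"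
    using lmeasure_integral[OF lm2] meas by (simp add: integral_on_1_eq)
  ultimately have "(\<lambda>x. \<bar>det (matrix (?g' x))\<bar> *\<^sub>R (1 :: real^1)) absolutely_integrable_on UNIV \<and>
      integral UNIV (\<lambda>x. \<bar>det (matrix (?g' x))\<bar> *\<^sub>R (1 :: real^1)) = vec (measure lebesgue ?C)"
    using has_absolute_integral_change_of_variables[of UNIV ?g ?g' "\<lambda>_. 1 :: real^1"]
      der gibbs_mean_sum_inj[OF V W \<open>t \<ge> 0\<close>] by simp
  then have "(\<lambda>x. \<bar>det (matrix (?g' x))\<bar>) absolutely_integrable_on UNIV"
    "integral UNIV (\<lambda>x. \<bar>det (matrix (?g' x))\<bar>) = measure lebesgue ?C"
    by (auto simp: absolutely_integrable_on_1_iff integral_on_1_eq vec_eq_iff)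
  then have "((\<lambda>x. \<bar>det (matrix (?g' x))\<bar>) has_integral measure lebesgue ?C) UNIV"
    using set_lebesgue_integral_eq_integral(1) by (auto simp: has_integral_iff)
  then show ?thesis using det_nn by (simp add: mat)
qed

section \<open>Polynomiality of the volume of A + tB\<close>

text \<open>Cover \<open>A\<close> by finitely many small balls centred in \<open>A\<close>, enclose
  each in a cube and take the hull of all corners. The hull stays in the convex set A + cball 0 e
  because its corners do, and a single cube already gives interior.\<close>

lemma outer_polytope:
  fixes A :: "'a::euclidean_space set"
  assumes "compact A" "convex A" "A \<noteq> {}" "e > 0"
  obtains V where "finite V" "A \<subseteq> convex hull V" "interior (convex hull V) \<noteq> {}"
    "\<And>v. v \<in> convex hull V \<Longrightarrow> \<exists>a\<in>A. dist v a \<le> e"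
proof -
  \<comment> \<open>The half side of the cubes: bounding the norm by the sum of the coordinates
    keeps each cube within distance \<open>e\<close> of its centre.\<close>
  define s where "s = e / DIM('a)"
  have s: "s > 0" using assms by (simp add: s_def)
  define Q where "Q x = cbox (x - s *\<^sub>R One) (x + s *\<^sub>R One)" for x :: 'a
  have ballQ: "ball x s \<subseteq> Q x" for x
  proof
    fix y assume "y \<in> ball x s"
    then have "\<bar>(y - x) \<bullet> b\<bar> \<le> s" if "b \<in> Basis" for b
      using Basis_le_norm[OF that, of "y - x"] by (simp add: dist_norm norm_minus_commute)
    then show "y \<in> Q x" by (fastforce simp: Q_def mem_box inner_diff_left inner_add_left abs_le_iff)
  qed
  have Qe: "dist y x \<le> e" if "y \<in> Q x" for x y
  proof -
    have "\<bar>(y - x) \<bullet> b\<bar> \<le> s" if "b \<in> Basis" for b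
      using \<open>y \<in> Q x\<close> that by (auto simp: Q_def mem_box inner_diff_left inner_add_left abs_le_iff)
    then have "(\<Sum>b\<in>Basis. \<bar>(y - x) \<bullet> b\<bar>) \<le> (\<Sum>b\<in>(Basis::'a set). s)" by (rule sum_mono)
    then have "norm (y - x) \<le> DIM('a) * s" using norm_le_l1[of "y - x"] by simp
    then show ?thesis by (simp add: s_def dist_norm)
  qed
  have "A \<subseteq> (\<Union>x\<in>A. ball x s)" using s by force
  then obtain C where C: "C \<subseteq> A" "finite C" "A \<subseteq> (\<Union>x\<in>C. ball x s)"
    using compactE_image[OF assms(1), of A "\<lambda>x. ball x s"] by blast
  have "\<exists>S. finite S \<and> Q x = convex hull S" for x
    unfolding Q_def by (metis closed_interval_as_convex_hull)
  then obtain S where S: "\<And>x. finite (S x)" "\<And>x. Q x = convex hull S x" by metis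
  define V where "V = (\<Union>x\<in>C. S x)"
  have sub: "Q x \<subseteq> convex hull V" if "x \<in> C" for x
    unfolding S(2) V_def by (rule hull_mono) (use that in auto)
  show thesis
  proof (rule that[of V])
    show "finite V" unfolding V_def using C S by auto
    show "A \<subseteq> convex hull V" using C ballQ sub by blast
    obtain x where "x \<in> C" using C assms by auto
    then have "ball x s \<subseteq> interior (convex hull V)" using ballQ sub by (intro interior_maximal) auto
    then show "interior (convex hull V) \<noteq> {}" using s by auto
    have "V \<subseteq> dilated_sum A 1 (cball 0 e)"
    proof
      fix v assume "v \<in> V"
      then obtain x where x: "x \<in> C" "v \<in> S x" unfolding V_def by auto
      then have "v \<in> Q x" unfolding S(2) by (simp add: hull_inc)
      then have "v = x + 1 *\<^sub>R (v - x)" "v - x \<in> cball 0 e" using Qe[of v x] by (auto simp: dist_norm norm_minus_commute)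
      then show "v \<in> dilated_sum A 1 (cball 0 e)" using x C unfolding dilated_sum_def by blast
    qed
    then have "convex hull V \<subseteq> dilated_sum A 1 (cball 0 e)"
      by (rule hull_minimal) (intro convex_dilated_sum assms convex_cball)
    then show "\<exists>a\<in>A. dist v a \<le> e" if v: "v \<in> convex hull V" for v
    proof -
      obtain a d where "a \<in> A" "norm d \<le> e" "v = a + d"
        using v \<open>convex hull V \<subseteq> dilated_sum A 1 (cball 0 e)\<close> unfolding dilated_sum_def by auto
      then show ?thesis by (intro bexI[of _ a]) (auto simp: dist_norm)
    qed
  qed
qed

lemma measure_infdist_neighbourhood_tendsto:
  fixes C :: "'a::euclidean_space set"
  assumes "compact C" "C \<noteq> {}" "r > 0"
  shows "(\<lambda>k. measure lborel {x. infdist x C \<le> r / real (Suc k)}) \<longlonglongrightarrow> measure lborel C"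
proof -
  have comp: "compact {x. infdist x C \<le> r / real (Suc k)}" for k
    by (rule compact_infdist_le) (use assms in auto)
  have "(\<lambda>k. measure lborel {x. infdist x C \<le> r / real (Suc k)}) \<longlonglongrightarrow>
      measure lborel (\<Inter>k. {x. infdist x C \<le> r / real (Suc k)})"
  proof (rule Lim_measure_decseq)
    show "decseq (\<lambda>k. {x. infdist x C \<le> r / real (Suc k)})"
    proof (rule decseq_SucI, rule Collect_mono, rule impI)
      fix k x assume "infdist x C \<le> r / real (Suc (Suc k))"
      also have "\<dots> \<le> r / real (Suc k)" using assms by (intro divide_left_mono) auto
      finally show "infdist x C \<le> r / real (Suc k)" .
    qed
    show "range (\<lambda>k. {x. infdist x C \<le> r / real (Suc k)}) \<subseteq> sets lborel"
      using comp by (auto intro: borel_compact)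
    show "emeasure lborel {x. infdist x C \<le> r / real (Suc k)} \<noteq> \<infinity>" for k
      using emeasure_compact_finite[OF comp[of k]] by simp
  qed
  also have "(\<Inter>k. {x. infdist x C \<le> r / real (Suc k)}) = C"
  proof (intro equalityI subsetI)
    fix x assume x: "x \<in> (\<Inter>k. {x. infdist x C \<le> r / real (Suc k)})"
    have "(\<lambda>k. r / real (Suc k)) \<longlonglongrightarrow> 0" by real_asymp
    then have "infdist x C \<le> 0" using x by (intro LIMSEQ_le_const[where X="\<lambda>k. r / real (Suc k)"]) auto
    then show "x \<in> C"
      using in_closed_iff_infdist_zero[OF compact_imp_closed[OF assms(1)] assms(2)] infdist_nonneg[of x C] by simp
  qed (use assms in auto)
  finally show ?thesis .
qed

lemma volume_polytope_sum_poly: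
  fixes V W :: "(real^'m::{finite,wellorder}) set"
  assumes "finite V" "interior (convex hull V) \<noteq> {}" "finite W" "W \<noteq> {}"
  shows "poly_on_nonneg CARD('m) (\<lambda>t. measure lebesgue (dilated_sum (convex hull V) t (convex hull W)))"
  unfolding poly_on_nonneg_def
proof (intro allI impI)
  fix t :: real assume t: "t \<ge> 0"
  let ?D = "\<lambda>t x. det (matrix (gibbs_hess V x) + t *\<^sub>R matrix (gibbs_hess W x))"
  let ?f = "\<lambda>t. measure lebesgue (dilated_sum (convex hull V) t (convex hull W))"
  have "?D t = (\<lambda>x. \<Sum>k\<le>CARD('m). ?D (real k) x * poly (lagrange_basis CARD('m) k) t)"
    using det_pencil_poly t unfolding poly_on_nonneg_def by blast
  moreover have "((\<lambda>x. \<Sum>k\<le>CARD('m). ?D (real k) x * poly (lagrange_basis CARD('m) k) t) has_integral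
     (\<Sum>k\<le>CARD('m). ?f (real k) * poly (lagrange_basis CARD('m) k) t)) UNIV"
    by (intro has_integral_sum has_integral_mult_left volume_polytope_sum assms) auto
  ultimately show "?f t = (\<Sum>k\<le>CARD('m). ?f (real k) * poly (lagrange_basis CARD('m) k) t)"
    using volume_polytope_sum[OF assms t] by (simp add: has_integral_unique)
qed

lemma measure_lebesgue_compact: "compact C \<Longrightarrow> measure lebesgue C = measure lborel C"
  by (simp add: measure_completion borel_compact)

text \<open>With outer polytopes at distance 1/(k+1), the polytope sum lies between A + tB and its
  closed neighbourhood of radius (1+t)/(k+1). So the volumes converge for each fixed
  \<open>t\<close>, and the interpolation identity survives the limit.\<close>

lemma volume_dilated_sum_poly_wellorder:
  fixes A B :: "(real^'m::{finite,wellorder}) set"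
  assumes A: "compact A" "convex A" "A \<noteq> {}" and B: "compact B" "convex B" "B \<noteq> {}"
  shows "poly_on_nonneg CARD('m) (\<lambda>t. measure lborel (dilated_sum A t B))"
proof -
  define e where "e k = 1 / real (Suc k)" for k
  have e: "e k > 0" for k by (simp add: e_def)
  have "\<forall>k. \<exists>V. finite V \<and> A \<subseteq> convex hull V \<and> interior (convex hull V) \<noteq> {} \<and>
      (\<forall>v\<in>convex hull V. \<exists>a\<in>A. dist v a \<le> e k)"
    using outer_polytope[OF A e] by metis
  then obtain V where V: "\<And>k. finite (V k)" "\<And>k. A \<subseteq> convex hull V k" "\<And>k. interior (convex hull V k) \<noteq> {}"
      "\<And>k v. v \<in> convex hull V k \<Longrightarrow> \<exists>a\<in>A. dist v a \<le> e k"
    by metis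
  have "\<forall>k. \<exists>V. finite V \<and> B \<subseteq> convex hull V \<and> (\<forall>v\<in>convex hull V. \<exists>a\<in>B. dist v a \<le> e k)"
    using outer_polytope[OF B e] by metis
  then obtain W where W: "\<And>k. finite (W k)" "\<And>k. B \<subseteq> convex hull W k"
      "\<And>k v. v \<in> convex hull W k \<Longrightarrow> \<exists>a\<in>B. dist v a \<le> e k"
    by metis
  have W0: "W k \<noteq> {}" for k using W(2)[of k] B by auto
  let ?P = "\<lambda>k t. dilated_sum (convex hull V k) t (convex hull W k)"
  have compP: "compact (?P k t)" for k t
    using V W by (intro compact_dilated_sum finite_imp_compact_convex_hull)
  show ?thesis
  proof (rule poly_on_nonneg_limit)
    show "poly_on_nonneg CARD('m) (\<lambda>t. measure lborel (?P k t))" for k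
      using volume_polytope_sum_poly[OF V(1)[of k] V(3) W(1)[of k] W0] compP by (simp add: measure_lebesgue_compact)
    fix t :: real assume t: "t \<ge> 0"
    let ?C = "dilated_sum A t B"
    have C: "compact ?C" "?C \<noteq> {}"
      using compact_dilated_sum[OF A(1) B(1)] A B by (auto simp: dilated_sum_eq_image)
    have lo: "?C \<subseteq> ?P k t" for k using V(2)[of k] W(2)[of k] unfolding dilated_sum_def by blast
    have hi: "?P k t \<subseteq> {x. infdist x ?C \<le> (1 + t) / real (Suc k)}" for k
    proof
      fix x assume "x \<in> ?P k t"
      then obtain v w where vw: "v \<in> convex hull V k" "w \<in> convex hull W k" "x = v + t *\<^sub>R w"
        unfolding dilated_sum_def by blast
      obtain a b where ab: "a \<in> A" "dist v a \<le> e k" "b \<in> B" "dist w b \<le> e k"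
        using V(4) W(3) vw by meson
      have "dist x (a + t *\<^sub>R b) \<le> dist v a + dist (t *\<^sub>R w) (t *\<^sub>R b)"
        unfolding vw by (rule dist_triangle_add)
      also have "\<dots> \<le> e k + t * e k"
        using ab t by (intro add_mono) (auto simp: dist_norm scaleR_diff_right[symmetric] mult_left_mono)
      also have "\<dots> = (1 + t) / real (Suc k)" by (simp add: e_def field_simps)
      finally have "dist x (a + t *\<^sub>R b) \<le> (1 + t) / real (Suc k)" .
      moreover have "a + t *\<^sub>R b \<in> ?C" using ab by (auto simp: dilated_sum_def)
      ultimately show "x \<in> {x. infdist x ?C \<le> (1 + t) / real (Suc k)}" by (auto intro: infdist_le2)
    qed
    have compN: "compact {x. infdist x ?C \<le> (1 + t) / real (Suc k)}" for k
      by (rule compact_infdist_le) (use C t in auto)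
    have le1: "measure lborel ?C \<le> measure lborel (?P k t)" for k
      by (rule measure_mono_fmeasurable) (use lo C compP in \<open>auto intro: borel_compact fmeasurable_compact\<close>)
    have le2: "measure lborel (?P k t) \<le> measure lborel {x. infdist x ?C \<le> (1 + t) / real (Suc k)}" for k
      by (rule measure_mono_fmeasurable[OF hi]) (use compN compP in \<open>auto intro: borel_compact fmeasurable_compact\<close>)
    show "(\<lambda>k. measure lborel (?P k t)) \<longlonglongrightarrow> measure lborel ?C"
      by (rule tendsto_sandwich[OF _ _ tendsto_const measure_infdist_neighbourhood_tendsto[OF C, of "1 + t"]])
        (use le1 le2 t in auto)
  qed
qed

text \<open>The library's change of variables formula needs a well-ordered index type.\<close>

typedef (overloaded) ('n::finite) ranked = "{..<CARD('n)}"
  morphisms rank_of Ranked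
  by (intro exI[of _ 0]) simp

instantiation ranked :: (finite) linorder
begin
definition "x \<le> y \<longleftrightarrow> rank_of x \<le> rank_of y"
definition "x < y \<longleftrightarrow> rank_of x < rank_of y"
instance
  by standard (auto simp: less_eq_ranked_def less_ranked_def rank_of_inject)
end

instance ranked :: (finite) wellorder
proof
  fix P :: "'a ranked \<Rightarrow> bool" and a
  assume step: "\<And>x. (\<And>y. y < x \<Longrightarrow> P y) \<Longrightarrow> P x"
  show "P a"
  proof (induction "rank_of a" arbitrary: a rule: less_induct)
    case less
    then show ?case by (rule step) (simp add: less_ranked_def)
  qed
qed

lemma bij_betw_rank_of: "bij_betw rank_of (UNIV :: 'n::finite ranked set) {..<CARD('n)}"
  by (rule bij_betwI[of _ _ _ Ranked]) (use rank_of in \<open>auto simp: rank_of_inverse Ranked_inverse\<close>)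

instance ranked :: (finite) finite
proof
  show "finite (UNIV :: 'a ranked set)"
    using bij_betw_finite[OF bij_betw_rank_of] by simp
qed

lemma card_ranked [simp]: "CARD('n::finite ranked) = CARD('n)"
  using bij_betw_same_card[OF bij_betw_rank_of] by simp

definition relabel :: "('m \<Rightarrow> 'n) \<Rightarrow> real^'n \<Rightarrow> real^'m" where
  "relabel \<sigma> x = (\<chi> i. x $ \<sigma> i)"

lemma linear_relabel: "linear (relabel \<sigma>)"
  by (rule linearI) (simp_all add: relabel_def vec_eq_iff)

lemma relabel_inverse: "bij \<sigma> \<Longrightarrow> relabel (inv \<sigma>) (relabel \<sigma> x) = x" "bij \<sigma> \<Longrightarrow> relabel \<sigma> (relabel (inv \<sigma>) y) = y"
  by (simp_all add: relabel_def vec_eq_iff bij_is_surj surj_f_inv_f bij_is_inj)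

lemma continuous_on_relabel: "continuous_on S (relabel \<sigma>)"
  by (rule linear_continuous_on) (simp add: linear_relabel linear_conv_bounded_linear[symmetric])

lemma Basis_real_vec: "(Basis :: (real^'n) set) = range (\<lambda>i. axis i 1)"
  unfolding Basis_vec_def by (simp add: UNION_singleton_eq_range)

lemma prod_Basis_vec: "(\<Prod>b\<in>(Basis :: (real^'n) set). g b) = (\<Prod>i\<in>UNIV. g (axis i 1))"
  unfolding Basis_real_vec
  by (subst prod.reindex) (simp_all add: inj_on_def axis_eq_axis)

text \<open>Lebesgue measure is determined by the volumes of boxes, and permuting coordinates turns
  a box into a box with the same side lengths.\<close>

lemma distr_relabel:
  fixes \<sigma> :: "'m::finite \<Rightarrow> 'n::finite"
  assumes "bij \<sigma>"
  shows "distr lborel borel (relabel \<sigma>) = lborel"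
proof (rule lborel_eqI[symmetric])
  fix l u :: "real^'m" assume lu: "\<And>b. b \<in> Basis \<Longrightarrow> l \<bullet> b \<le> u \<bullet> b"
  have meas: "relabel \<sigma> \<in> borel_measurable borel"
    by (rule borel_measurable_continuous_onI) (rule continuous_on_relabel)
  have surj: "(\<forall>i. P (\<sigma> i)) \<longleftrightarrow> (\<forall>j. P j)" for P using assms by (metis bij_pointE)
  have inv: "inv \<sigma> (\<sigma> i) = i" for i using assms by (simp add: bij_is_inj)
  have "relabel \<sigma> x \<in> box l u \<longleftrightarrow> x \<in> box (relabel (inv \<sigma>) l) (relabel (inv \<sigma>) u)" for x
    using surj[of "\<lambda>j. l $ inv \<sigma> j < x $ j \<and> x $ j < u $ inv \<sigma> j"]
    unfolding mem_box_cart relabel_def vec_lambda_beta inv by blast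
  then have "relabel \<sigma> -` box l u = box (relabel (inv \<sigma>) l) (relabel (inv \<sigma>) u)" by blast
  then have "emeasure (distr lborel borel (relabel \<sigma>)) (box l u) = emeasure lborel (box (relabel (inv \<sigma>) l) (relabel (inv \<sigma>) u))"
    using meas by (subst emeasure_distr) auto
  also have "\<dots> = ennreal (\<Prod>b\<in>Basis. (relabel (inv \<sigma>) u - relabel (inv \<sigma>) l) \<bullet> b)"
  proof (rule emeasure_lborel_box)
    fix b :: "real^'n" assume "b \<in> Basis"
    then obtain j where "b = axis j 1" unfolding Basis_real_vec by blast
    then show "relabel (inv \<sigma>) l \<bullet> b \<le> relabel (inv \<sigma>) u \<bullet> b"
      using lu[of "axis (inv \<sigma> j) 1"] by (simp add: inner_axis relabel_def)
  qed
  also have "(\<Prod>b\<in>Basis. (relabel (inv \<sigma>) u - relabel (inv \<sigma>) l) \<bullet> b) = (\<Prod>j\<in>UNIV. u $ inv \<sigma> j - l $ inv \<sigma> j)"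
    by (simp add: prod_Basis_vec inner_axis relabel_def)
  also have "\<dots> = (\<Prod>i\<in>UNIV. u $ i - l $ i)"
    by (rule prod.reindex_bij_betw) (use assms in \<open>simp add: bij_imp_bij_inv\<close>)
  also have "\<dots> = (\<Prod>b\<in>Basis. (u - l) \<bullet> b)"
    by (simp add: prod_Basis_vec inner_axis)
  finally show "emeasure (distr lborel borel (relabel \<sigma>)) (box l u) = ennreal (\<Prod>b\<in>Basis. (u - l) \<bullet> b)" .
qed simp

lemma ex_bij_ranked: "\<exists>\<sigma> :: 'n::finite ranked \<Rightarrow> 'n. bij \<sigma>"
  using finite_same_card_bij[of "UNIV :: 'n ranked set" "UNIV :: 'n set"] by auto

lemma volume_dilated_sum_poly:
  fixes A B :: "(real^'n) set"
  assumes A: "compact A" "convex A" "A \<noteq> {}" and B: "compact B" "convex B" "B \<noteq> {}"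
  shows "poly_on_nonneg CARD('n) (\<lambda>t. measure lborel (dilated_sum A t B))"
proof -
  obtain \<sigma> :: "'n ranked \<Rightarrow> 'n" where \<sigma>: "bij \<sigma>" using ex_bij_ranked by blast
  let ?r = "relabel \<sigma>"
  have img: "dilated_sum (?r ` A) t (?r ` B) = ?r ` dilated_sum A t B" for t
  proof -
    have "dilated_sum (?r ` A) t (?r ` B) = {?r a + t *\<^sub>R ?r b | a b. a \<in> A \<and> b \<in> B}"
      unfolding dilated_sum_def by blast
    also have "\<dots> = {?r (a + t *\<^sub>R b) | a b. a \<in> A \<and> b \<in> B}"
      by (simp only: linear_add[OF linear_relabel] linear_scale[OF linear_relabel])
    also have "\<dots> = ?r ` dilated_sum A t B"
      unfolding dilated_sum_def by blast
    finally show ?thesis .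
  qed
  have "measure lborel (?r ` dilated_sum A t B) = measure lborel (dilated_sum A t B)" for t
  proof -
    have comp: "compact (?r ` dilated_sum A t B)"
      using A B by (intro compact_continuous_image continuous_on_relabel compact_dilated_sum)
    have "measure lborel (?r ` dilated_sum A t B) = measure (distr lborel borel ?r) (?r ` dilated_sum A t B)"
      by (simp add: distr_relabel[OF \<sigma>])
    also have "\<dots> = measure lborel (?r -` ?r ` dilated_sum A t B)"
      using comp by (subst measure_distr)
        (auto intro!: borel_compact borel_measurable_continuous_onI continuous_on_relabel)
    also have "?r -` ?r ` dilated_sum A t B = dilated_sum A t B"
      by (rule inj_vimage_image_eq) (metis \<sigma> injI relabel_inverse(1))
    finally show ?thesis .
  qed
  moreover have "poly_on_nonneg CARD('n ranked) (\<lambda>t. measure lborel (dilated_sum (?r ` A) t (?r ` B)))"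
    using A B by (intro volume_dilated_sum_poly_wellorder compact_continuous_image
        convex_linear_image linear_relabel continuous_on_relabel) auto
  ultimately show ?thesis by (simp only: img card_ranked)
qed

section \<open>Translates with a common point\<close>

text \<open>For \<open>C l\<close> = t_l K and \<open>a 0 = 0\<close> this is membership of
  \<open>a\<close> in the difference body, with witness \<open>x\<close> = t_0 y_0 where y_0 in K is
  the point entering through the diagonal. All p+1 bodies play the same role here.\<close>

definition common_point :: "'i set \<Rightarrow> ('i \<Rightarrow> 'a::real_vector set) \<Rightarrow> ('i \<Rightarrow> 'a) \<Rightarrow> bool" where
  "common_point I C a \<longleftrightarrow> (\<exists>x. \<forall>i\<in>I. x + a i \<in> C i)"

lemma common_point_cong: "(\<And>i. i \<in> I \<Longrightarrow> a i = b i) \<Longrightarrow> common_point I C a = common_point I C b"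
  unfolding common_point_def by simp

lemma common_point_shift: "common_point I C (\<lambda>i. a i + v) = common_point I C a"
  unfolding common_point_def
proof
  assume "\<exists>x. \<forall>i\<in>I. x + (a i + v) \<in> C i"
  then obtain x where "\<forall>i\<in>I. (x + v) + a i \<in> C i" by (auto simp: algebra_simps)
  then show "\<exists>x. \<forall>i\<in>I. x + a i \<in> C i" by blast
next
  assume "\<exists>x. \<forall>i\<in>I. x + a i \<in> C i"
  then obtain x where "\<forall>i\<in>I. x + a i \<in> C i" by blast
  then have "\<forall>i\<in>I. (x - v) + (a i + v) \<in> C i" by simp
  then show "\<exists>x. \<forall>i\<in>I. x + (a i + v) \<in> C i" by blast
qed

text \<open>Prepares measurability: the existential quantifier over all points projects a set, and
  projections need not be Borel. Compactness replaces exact common points by approximate ones taken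
  from a countable dense set.\<close>

lemma common_point_iff_approx:
  fixes C :: "'i \<Rightarrow> 'a::euclidean_space set"
  assumes D: "\<And>X. open X \<Longrightarrow> X \<noteq> {} \<Longrightarrow> \<exists>d\<in>D. d \<in> X"
    and I: "I \<noteq> {}" and C: "\<And>i. i \<in> I \<Longrightarrow> compact (C i)" "\<And>i. i \<in> I \<Longrightarrow> C i \<noteq> {}"
  shows "common_point I C a \<longleftrightarrow> (\<forall>m::nat. \<exists>x\<in>D. \<forall>i\<in>I. infdist (x + a i) (C i) < 1 / real (Suc m))"
proof
  assume "common_point I C a"
  then obtain x0 where x0: "\<And>i. i \<in> I \<Longrightarrow> x0 + a i \<in> C i" unfolding common_point_def by blast
  show "\<forall>m::nat. \<exists>x\<in>D. \<forall>i\<in>I. infdist (x + a i) (C i) < 1 / real (Suc m)"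
  proof
    fix m :: nat
    obtain x where x: "x \<in> D" "x \<in> ball x0 (1 / real (Suc m))"
      using D[of "ball x0 (1 / real (Suc m))"] by auto
    have "infdist (x + a i) (C i) < 1 / real (Suc m)" if "i \<in> I" for i
      using infdist_le[OF x0[OF that], of "x + a i"] x(2) by (simp add: dist_commute)
    then show "\<exists>x\<in>D. \<forall>i\<in>I. infdist (x + a i) (C i) < 1 / real (Suc m)" using x(1) by blast
  qed
next
  assume "\<forall>m::nat. \<exists>x\<in>D. \<forall>i\<in>I. infdist (x + a i) (C i) < 1 / real (Suc m)"
  then obtain X where X: "\<And>m i. i \<in> I \<Longrightarrow> infdist (X m + a i) (C i) < 1 / real (Suc m)" by metis
  obtain i0 where i0: "i0 \<in> I" using I by auto
  \<comment> \<open>One body confines the whole sequence: \<open>X m + a i0\<close> stays within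
    distance 1 of the compact set \<open>C i0\<close>.\<close>
  let ?N = "{z. infdist z (C i0) \<le> 1}"
  have "compact ?N" by (rule compact_infdist_le) (use C i0 in auto)
  moreover have "X m + a i0 \<in> ?N" for m
  proof -
    have "1 / real (Suc m) \<le> 1" by simp
    with X[OF i0, of m] have "infdist (X m + a i0) (C i0) \<le> 1" by linarith
    then show ?thesis by simp
  qed
  ultimately obtain z r where zr: "strict_mono r" "((\<lambda>m. X m + a i0) \<circ> r) \<longlonglongrightarrow> z"
    unfolding compact_eq_seq_compact_metric seq_compact_def by metis
  define l where "l = z - a i0"
  have lim: "(\<lambda>m. X (r m)) \<longlonglongrightarrow> l"
    using tendsto_diff[OF zr(2) tendsto_const[of "a i0"]] by (simp add: l_def o_def)
  have "l + a i \<in> C i" if i: "i \<in> I" for i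
  proof -
    have "(\<lambda>m. infdist (X (r m) + a i) (C i)) \<longlonglongrightarrow> infdist (l + a i) (C i)"
      by (intro tendsto_infdist tendsto_add lim tendsto_const)
    moreover have "(\<lambda>m. 1 / real (Suc (r m))) \<longlonglongrightarrow> 0"
      using LIMSEQ_subseq_LIMSEQ[OF LIMSEQ_Suc[OF lim_1_over_n] zr(1)] by (simp add: o_def)
    ultimately have "infdist (l + a i) (C i) \<le> 0"
      by (rule LIMSEQ_le) (use X[OF i] in \<open>auto intro!: exI[of _ 0] less_imp_le\<close>)
    then have "infdist (l + a i) (C i) = 0" using infdist_nonneg[of "l + a i" "C i"] by linarith
    then show ?thesis
      using in_closed_iff_infdist_zero[OF compact_imp_closed[OF C(1)[OF i]] C(2)[OF i]] by blast
  qed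
  then show "common_point I C a" unfolding common_point_def by blast
qed

lemma measurable_common_point [measurable]:
  fixes C :: "'i \<Rightarrow> 'a::euclidean_space set"
  assumes I: "finite I" "I \<noteq> {}" and C: "\<And>i. i \<in> I \<Longrightarrow> compact (C i)" "\<And>i. i \<in> I \<Longrightarrow> C i \<noteq> {}"
  shows "Measurable.pred (Pi\<^sub>M I (\<lambda>_. lborel)) (common_point I C)"
proof -
  obtain D :: "'a set" where D: "countable D" "\<And>X. open X \<Longrightarrow> X \<noteq> {} \<Longrightarrow> \<exists>d\<in>D. d \<in> X"
    using countable_dense_setE by blast
  have "D \<noteq> {}" using D(2)[of UNIV] by auto
  then have e: "range (from_nat_into D) = D" using D(1) by (rule range_from_nat_into)
  have dist: "(\<lambda>a. infdist (x + a i) (C i)) \<in> borel_measurable (Pi\<^sub>M I (\<lambda>_. lborel))" if "i \<in> I" for i x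
  proof -
    have "(\<lambda>a. a i) \<in> borel_measurable (Pi\<^sub>M I (\<lambda>_. lborel :: 'a measure))"
      using measurable_component_singleton[OF that, of "\<lambda>_. lborel :: 'a measure"] by simp
    moreover have "(\<lambda>y. infdist (x + y) (C i)) \<in> borel_measurable borel"
      by (intro borel_measurable_continuous_onI continuous_intros)
    ultimately show ?thesis by (rule measurable_compose)
  qed
  have "Measurable.pred (Pi\<^sub>M I (\<lambda>_. lborel)) (\<lambda>a. infdist (x + a i) (C i) < 1 / real (Suc m))" if "i \<in> I" for i x m
    using borel_measurable_less[OF dist[OF that, of x] borel_measurable_const] by (simp only: pred_def)
  then have "Measurable.pred (Pi\<^sub>M I (\<lambda>_. lborel))
      (\<lambda>a. \<forall>m::nat. \<exists>k::nat. \<forall>i\<in>I. infdist (from_nat_into D k + a i) (C i) < 1 / real (Suc m))"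
    by (intro pred_intros_countable pred_intros_finite(3) I)
  moreover have "(\<exists>x\<in>D. P x) \<longleftrightarrow> (\<exists>k. P (from_nat_into D k))" for P
    by (metis e rangeE rangeI)
  ultimately have "Measurable.pred (Pi\<^sub>M I (\<lambda>_. lborel)) (\<lambda>a. \<forall>m::nat. \<exists>x\<in>D. \<forall>i\<in>I. infdist (x + a i) (C i) < 1 / real (Suc m))"
    by simp
  then show ?thesis
    using common_point_iff_approx[OF D(2) I(2) C] by presburger
qed

lemma product_sigma_finite_lborel: "product_sigma_finite (\<lambda>_. lborel)"
  by standard

text \<open>Fubini, one factor at a time. The abstract constant \<open>c\<close> lets the same
  statement serve translations, dilations and linear maps, and \<open>T\<close> may differ from
  factor to factor.\<close>

lemma nn_integral_PiM_map:
  fixes T :: "'i \<Rightarrow> 'a::euclidean_space \<Rightarrow> 'a"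
  assumes "finite I"
    and T: "\<And>i. i \<in> I \<Longrightarrow> T i \<in> borel_measurable borel"
      "\<And>i f. i \<in> I \<Longrightarrow> f \<in> borel_measurable borel \<Longrightarrow> (\<integral>\<^sup>+x. f (T i x) \<partial>lborel) = c * (\<integral>\<^sup>+x. f x \<partial>lborel)"
    and f: "f \<in> borel_measurable (Pi\<^sub>M I (\<lambda>_. lborel))"
  shows "(\<integral>\<^sup>+r. f (\<lambda>i\<in>I. T i (r i)) \<partial>Pi\<^sub>M I (\<lambda>_. lborel)) = c ^ card I * (\<integral>\<^sup>+r. f r \<partial>Pi\<^sub>M I (\<lambda>_. lborel))"
  using assms
proof (induction I arbitrary: f rule: finite_induct)
  case empty
  then show ?case by (simp add: PiM_empty nn_integral_count_space_finite)
next
  case (insert i I)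
  interpret product_sigma_finite "\<lambda>_::'i. lborel :: 'a measure" by (rule product_sigma_finite_lborel)
  note f = insert.prems(3)
  have Tm: "T j \<in> measurable lborel lborel" if "j \<in> insert i I" for j
    using insert.prems(1)[OF that] by simp
  have mapm: "(\<lambda>r. \<lambda>j\<in>J. T j (r j)) \<in> measurable (Pi\<^sub>M J (\<lambda>_. lborel)) (Pi\<^sub>M J (\<lambda>_. lborel))"
    if "J \<subseteq> insert i I" for J
  proof (rule measurable_restrict)
    fix j assume j: "j \<in> J"
    with that have "j \<in> insert i I" by auto
    show "(\<lambda>r. T j (r j)) \<in> measurable (Pi\<^sub>M J (\<lambda>_. lborel)) lborel"
      by (rule measurable_compose[OF measurable_component_singleton[OF j] Tm[OF \<open>j \<in> insert i I\<close>]])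
  qed
  have upd: "(\<lambda>j\<in>insert i I. T j ((r(i := y)) j)) = (\<lambda>j\<in>I. T j (r j))(i := T i y)" for r y
    using insert.hyps by (auto simp: restrict_def)
  let ?g = "\<lambda>r. \<integral>\<^sup>+y. f (r(i := y)) \<partial>lborel"
  have f2: "(\<lambda>(r, y). f (r(i := y))) \<in> borel_measurable (Pi\<^sub>M I (\<lambda>_. lborel) \<Otimes>\<^sub>M lborel)"
    using measurable_compose[OF measurable_add_dim f] unfolding case_prod_unfold .
  then have g: "?g \<in> borel_measurable (Pi\<^sub>M I (\<lambda>_. lborel))"
    using lborel.borel_measurable_nn_integral[of "\<lambda>r y. f (r(i := y))"] by simp
  have sec: "(\<lambda>y. f (r(i := y))) \<in> borel_measurable borel" if "r \<in> space (Pi\<^sub>M I (\<lambda>_. lborel))" for r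
    using measurable_compose[OF measurable_Pair1'[OF that] f2] by simp
  have "(\<integral>\<^sup>+r. f (\<lambda>j\<in>insert i I. T j (r j)) \<partial>Pi\<^sub>M (insert i I) (\<lambda>_. lborel))
     = (\<integral>\<^sup>+r. \<integral>\<^sup>+y. f ((\<lambda>j\<in>I. T j (r j))(i := T i y)) \<partial>lborel \<partial>Pi\<^sub>M I (\<lambda>_. lborel))"
    using product_nn_integral_insert[OF insert.hyps measurable_compose[OF mapm f]] by (simp only: upd order_refl)
  also have "\<dots> = (\<integral>\<^sup>+r. c * ?g (\<lambda>j\<in>I. T j (r j)) \<partial>Pi\<^sub>M I (\<lambda>_. lborel))"
  proof (rule nn_integral_cong)
    fix r :: "'i \<Rightarrow> 'a" assume "r \<in> space (Pi\<^sub>M I (\<lambda>_. lborel))"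
    then have "(\<lambda>j\<in>I. T j (r j)) \<in> space (Pi\<^sub>M I (\<lambda>_. lborel))"
      by (auto simp: space_PiM)
    then show "(\<integral>\<^sup>+y. f ((\<lambda>j\<in>I. T j (r j))(i := T i y)) \<partial>lborel) = c * ?g (\<lambda>j\<in>I. T j (r j))"
      using insert.prems(2)[of i, OF _ sec] by simp
  qed
  also have "\<dots> = c * (\<integral>\<^sup>+r. ?g (\<lambda>j\<in>I. T j (r j)) \<partial>Pi\<^sub>M I (\<lambda>_. lborel))"
    by (rule nn_integral_cmult) (rule measurable_compose[OF mapm g], auto)
  also have "(\<integral>\<^sup>+r. ?g (\<lambda>j\<in>I. T j (r j)) \<partial>Pi\<^sub>M I (\<lambda>_. lborel)) = c ^ card I * (\<integral>\<^sup>+r. ?g r \<partial>Pi\<^sub>M I (\<lambda>_. lborel))"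
    by (rule insert.IH[OF _ _ g]) (use insert.prems in auto)
  also have "(\<integral>\<^sup>+r. ?g r \<partial>Pi\<^sub>M I (\<lambda>_. lborel)) = (\<integral>\<^sup>+r. f r \<partial>Pi\<^sub>M (insert i I) (\<lambda>_. lborel))"
    by (rule product_nn_integral_insert[OF insert.hyps f, symmetric])
  finally show ?case using insert.hyps by (simp add: mult.assoc)
qed

lemma nn_integral_lborel_affine:
  fixes f :: "'a::euclidean_space \<Rightarrow> ennreal"
  assumes f: "f \<in> borel_measurable borel" and c: "c \<noteq> 0"
  shows "(\<integral>\<^sup>+x. f (t + c *\<^sub>R x) \<partial>lborel) = ennreal (1 / \<bar>c\<bar> ^ DIM('a)) * (\<integral>\<^sup>+x. f x \<partial>lborel)"
proof -
  have m: "(\<lambda>x. t + c *\<^sub>R x) \<in> borel_measurable borel" by simp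
  have "(\<integral>\<^sup>+x. f x \<partial>lborel) = ennreal (\<bar>c\<bar> ^ DIM('a)) * (\<integral>\<^sup>+x. f (t + c *\<^sub>R x) \<partial>lborel)"
    using f m by (subst lborel_affine[OF c, of t]) (simp add: nn_integral_density nn_integral_distr nn_integral_cmult)
  moreover have "ennreal (1 / \<bar>c\<bar> ^ DIM('a)) * ennreal (\<bar>c\<bar> ^ DIM('a)) = 1"
    using c by (simp add: ennreal_mult[symmetric])
  ultimately show ?thesis by (simp add: mult.assoc[symmetric])
qed

text \<open>The volume of the shift vectors, modulo common shifts, for which the translated bodies
  meet; setting coordinate \<open>b\<close> to 0 picks one representative of each class. For
  \<open>b = 0\<close> and bodies t_l K it is the volume of the difference body.\<close>

definition hit_volume :: "'i set \<Rightarrow> ('i \<Rightarrow> 'a::euclidean_space set) \<Rightarrow> 'i \<Rightarrow> ennreal" where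
  "hit_volume I C b = (\<integral>\<^sup>+a. indicator {a. common_point I C a} (a(b := 0)) \<partial>Pi\<^sub>M (I - {b}) (\<lambda>_. lborel))"

lemma measurable_indicator_common_point:
  fixes C :: "'i \<Rightarrow> 'a::euclidean_space set"
  assumes "finite I" "b \<in> I" "\<And>i. i \<in> I \<Longrightarrow> compact (C i)" "\<And>i. i \<in> I \<Longrightarrow> C i \<noteq> {}"
  shows "(\<lambda>a. indicator {a. common_point I C a} (a(b := v)) :: ennreal) \<in> borel_measurable (Pi\<^sub>M (I - {b}) (\<lambda>_. lborel))"
proof -
  have I: "insert b (I - {b}) = I" using assms by auto
  have "(\<lambda>a. a(b := v)) \<in> measurable (Pi\<^sub>M (I - {b}) (\<lambda>_. lborel :: 'a measure)) (Pi\<^sub>M I (\<lambda>_. lborel))"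
    using measurable_fun_upd[of I "I - {b}" b "\<lambda>a. a" "Pi\<^sub>M (I - {b}) (\<lambda>_. lborel)" "\<lambda>_. lborel" "\<lambda>_. v"] assms(2) by auto
  moreover have "Measurable.pred (Pi\<^sub>M I (\<lambda>_. lborel)) (common_point I C)"
    using assms by (intro measurable_common_point) auto
  ultimately have "Measurable.pred (Pi\<^sub>M (I - {b}) (\<lambda>_. lborel)) (\<lambda>a. common_point I C (a(b := v)))"
    by (rule measurable_compose)
  then show ?thesis by (simp add: indicator_def[abs_def] of_bool_def)
qed

text \<open>Moving the zero from one index to another is a common shift followed by a reflection,
  both of which preserve the measure. This freedom puts the coefficient t_0 on the same footing as
  the others.\<close>

lemma hit_volume_base:
  fixes C :: "'i \<Rightarrow> 'a::euclidean_space set"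
  assumes I: "finite I" "b \<in> I" "c \<in> I" "b \<noteq> c"
    and C: "\<And>i. i \<in> I \<Longrightarrow> compact (C i)" "\<And>i. i \<in> I \<Longrightarrow> C i \<noteq> {}"
  shows "hit_volume I C b = hit_volume I C c"
proof -
  interpret product_sigma_finite "\<lambda>_::'i. lborel :: 'a measure" by (rule product_sigma_finite_lborel)
  define R where "R = I - {b, c}"
  have R: "finite R" "b \<notin> R" "c \<notin> R" "I - {b} = insert c R" "I - {c} = insert b R"
    using I by (auto simp: R_def)
  let ?h = "\<lambda>a. indicator {a. common_point I C a} a :: ennreal"
  note ms = measurable_indicator_common_point[OF I(1) _ C]
  have meas2: "(\<lambda>r. ?h (r(c := v, b := w))) \<in> borel_measurable (Pi\<^sub>M R (\<lambda>_. lborel))" for v w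
  proof -
    have "(\<lambda>r. r(c := v)) \<in> measurable (Pi\<^sub>M R (\<lambda>_. lborel :: 'a measure)) (Pi\<^sub>M (I - {b}) (\<lambda>_. lborel))"
      using measurable_fun_upd[of "I - {b}" R c "\<lambda>a. a" "Pi\<^sub>M R (\<lambda>_. lborel)" "\<lambda>_. lborel" "\<lambda>_. v"] R by auto
    from measurable_compose[OF this ms[OF I(2), where v=w]] show ?thesis .
  qed
  \<comment> \<open>Shifting everything by \<open>- y\<close> moves the zero from \<open>b\<close>
    to \<open>c\<close>; the remaining coordinates absorb the shift by translation
    invariance.\<close>
  have inner: "(\<integral>\<^sup>+r. ?h (r(c := y, b := 0)) \<partial>Pi\<^sub>M R (\<lambda>_. lborel)) = (\<integral>\<^sup>+r. ?h (r(c := 0, b := - y)) \<partial>Pi\<^sub>M R (\<lambda>_. lborel))" for y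
  proof -
    have eq: "?h (r(c := y, b := 0)) = ?h ((\<lambda>i\<in>R. - y + 1 *\<^sub>R r i)(c := 0, b := - y))" for r
    proof -
      have "common_point I C (r(c := y, b := 0)) = common_point I C (\<lambda>i. (r(c := y, b := 0)) i + (- y))"
        by (rule common_point_shift[symmetric])
      also have "\<dots> = common_point I C ((\<lambda>i\<in>R. - y + 1 *\<^sub>R r i)(c := 0, b := - y))"
        by (rule common_point_cong) (use I in \<open>auto simp: R_def\<close>)
      finally show ?thesis by (simp add: indicator_def)
    qed
    have "(\<integral>\<^sup>+r. ?h (r(c := y, b := 0)) \<partial>Pi\<^sub>M R (\<lambda>_. lborel))
      = 1 ^ card R * (\<integral>\<^sup>+r. ?h (r(c := 0, b := - y)) \<partial>Pi\<^sub>M R (\<lambda>_. lborel))"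
      unfolding eq
    proof (rule nn_integral_PiM_map[OF R(1), where T="\<lambda>_ x. - y + 1 *\<^sub>R x" and f="\<lambda>r. ?h (r(c := 0, b := - y))"])
      show "(\<integral>\<^sup>+x. f (- y + 1 *\<^sub>R x) \<partial>lborel) = 1 * (\<integral>\<^sup>+x. f x \<partial>lborel)"
        if "f \<in> borel_measurable borel" for f :: "'a \<Rightarrow> ennreal"
        using nn_integral_lborel_affine[OF that, of 1 "- y"] by simp
    qed (use meas2 in auto)
    then show ?thesis by simp
  qed
  have meas3: "(\<lambda>y. \<integral>\<^sup>+r. ?h (r(c := 0, b := y)) \<partial>Pi\<^sub>M R (\<lambda>_. lborel)) \<in> borel_measurable borel"
  proof -
    interpret Rs: sigma_finite_measure "Pi\<^sub>M R (\<lambda>_. lborel :: 'a measure)" by (rule sigma_finite[OF R(1)])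
    have "(\<lambda>(y, r). r(b := y)) \<in> measurable (lborel \<Otimes>\<^sub>M Pi\<^sub>M R (\<lambda>_. lborel)) (Pi\<^sub>M (I - {c}) (\<lambda>_. lborel :: 'a measure))"
      unfolding R(5) using measurable_compose[OF measurable_pair_swap' measurable_add_dim] unfolding case_prod_unfold fst_conv snd_conv .
    from measurable_compose[OF this ms[OF I(3), where v=0]]
    have "(\<lambda>(y, r). ?h (r(b := y, c := 0))) \<in> borel_measurable (lborel \<Otimes>\<^sub>M Pi\<^sub>M R (\<lambda>_. lborel))"
      unfolding case_prod_unfold .
    then show ?thesis
      using Rs.borel_measurable_nn_integral[of "\<lambda>y r. ?h (r(b := y, c := 0))" lborel]
      by (simp add: fun_upd_twist[OF I(4)])
  qed
  have "hit_volume I C b = (\<integral>\<^sup>+y. \<integral>\<^sup>+r. ?h (r(c := y, b := 0)) \<partial>Pi\<^sub>M R (\<lambda>_. lborel) \<partial>lborel)"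
    unfolding hit_volume_def R(4)
    by (rule product_nn_integral_insert_rev[OF R(1,3)]) (use ms[OF I(2), where v=0] R(4) in simp)
  also have "\<dots> = (\<integral>\<^sup>+y. \<integral>\<^sup>+r. ?h (r(c := 0, b := 0 + (-1) *\<^sub>R y)) \<partial>Pi\<^sub>M R (\<lambda>_. lborel) \<partial>lborel)"
    by (simp add: inner)
  also have "\<dots> = (\<integral>\<^sup>+y. \<integral>\<^sup>+r. ?h (r(c := 0, b := y)) \<partial>Pi\<^sub>M R (\<lambda>_. lborel) \<partial>lborel)"
    by (subst nn_integral_lborel_affine[OF meas3]) simp_all
  also have "\<dots> = (\<integral>\<^sup>+y. \<integral>\<^sup>+r. ?h (r(b := y, c := 0)) \<partial>Pi\<^sub>M R (\<lambda>_. lborel) \<partial>lborel)"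
    by (simp add: fun_upd_twist[OF I(4)])
  also have "\<dots> = hit_volume I C c"
    unfolding hit_volume_def R(5)
    by (rule product_nn_integral_insert_rev[OF R(1,2), symmetric]) (use ms[OF I(3), where v=0] R(5) in simp)
  finally show ?thesis .
qed

text \<open>A common point \<open>x\<close> lies in \<open>C b\<close> and \<open>x + a i\<close> in
  \<open>C i\<close>, so \<open>a i\<close> lies in the difference C_i - C_b. The product bound
  gives finiteness, and zero volume for bodies in a hyperplane.\<close>

lemma hit_volume_le:
  fixes C :: "'i \<Rightarrow> 'a::euclidean_space set"
  assumes I: "finite I" "b \<in> I" and C: "\<And>i. i \<in> I \<Longrightarrow> compact (C i)"
  shows "hit_volume I C b \<le> (\<Prod>i\<in>I - {b}. emeasure lborel (dilated_sum (uminus ` C b) 1 (C i)))"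
proof -
  interpret product_sigma_finite "\<lambda>_::'i. lborel :: 'a measure" by (rule product_sigma_finite_lborel)
  define B where "B i = dilated_sum (uminus ` C b) 1 (C i)" for i
  have B: "compact (B i)" if "i \<in> I" for i
    unfolding B_def by (intro compact_dilated_sum compact_negations C I that)
  have sB: "Pi\<^sub>E (I - {b}) B \<in> sets (Pi\<^sub>M (I - {b}) (\<lambda>_. lborel))"
    by (rule sets_PiM_I_finite) (use I B in \<open>auto intro: borel_compact\<close>)
  have "hit_volume I C b \<le> (\<integral>\<^sup>+a. indicator (Pi\<^sub>E (I - {b}) B) a \<partial>Pi\<^sub>M (I - {b}) (\<lambda>_. lborel))"
    unfolding hit_volume_def
  proof (rule nn_integral_mono)
    fix a :: "'i \<Rightarrow> 'a" assume a: "a \<in> space (Pi\<^sub>M (I - {b}) (\<lambda>_. lborel))"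
    show "indicator {a. common_point I C a} (a(b := 0)) \<le> (indicator (Pi\<^sub>E (I - {b}) B) a :: ennreal)"
    proof (cases "common_point I C (a(b := 0))")
      case True
      then obtain x where x: "\<And>i. i \<in> I \<Longrightarrow> x + (a(b := 0)) i \<in> C i" unfolding common_point_def by blast
      have xb: "x \<in> C b" using x[OF I(2)] by simp
      have "a i \<in> B i" if "i \<in> I - {b}" for i
      proof -
        have "x + a i \<in> C i" using x[of i] that by simp
        moreover have "a i = - x + 1 *\<^sub>R (x + a i)" by simp
        ultimately show ?thesis unfolding B_def dilated_sum_def using xb by blast
      qed
      then have "a \<in> Pi\<^sub>E (I - {b}) B" using a by (auto simp: space_PiM PiE_iff)
      then show ?thesis by (auto simp: indicator_def)
    qed (simp add: indicator_def)
  qed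
  also have "\<dots> = (\<Prod>i\<in>I - {b}. emeasure lborel (B i))"
    using sB by (subst nn_integral_indicator) (use I B in \<open>auto intro!: emeasure_PiM borel_compact\<close>)
  finally show ?thesis unfolding B_def .
qed

lemma hit_volume_finite:
  fixes C :: "'i \<Rightarrow> 'a::euclidean_space set"
  assumes I: "finite I" "b \<in> I" and C: "\<And>i. i \<in> I \<Longrightarrow> compact (C i)"
  shows "hit_volume I C b < \<infinity>"
proof (rule le_less_trans[OF hit_volume_le[OF assms]])
  have "emeasure lborel (dilated_sum (uminus ` C b) 1 (C i)) < \<infinity>" if "i \<in> I" for i
    by (intro emeasure_compact_finite compact_dilated_sum compact_negations C I that)
  then show "(\<Prod>i\<in>I - {b}. emeasure lborel (dilated_sum (uminus ` C b) 1 (C i))) < \<infinity>"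
    by (auto simp: less_top[symmetric] ennreal_prod_eq_top)
qed

text \<open>With all coordinates but \<open>l\<close> frozen, the admissible values are
  \<open>C l\<close> minus the intersection of the other shifted bodies. This is where Minkowski
  sums of two bodies in the base space enter.\<close>

lemma common_point_section:
  assumes "l \<in> I"
  shows "{y. common_point I C (a(l := y))} = dilated_sum (uminus ` {x. \<forall>i\<in>I - {l}. x + a i \<in> C i}) 1 (C l)"
proof (intro equalityI subsetI)
  fix y assume "y \<in> {y. common_point I C (a(l := y))}"
  then obtain x where x: "\<And>i. i \<in> I \<Longrightarrow> x + (a(l := y)) i \<in> C i" unfolding common_point_def by blast
  have "x + y \<in> C l" using x[OF assms] by simp
  moreover have "x + a i \<in> C i" if "i \<in> I - {l}" for i using x[of i] that by auto
  moreover have "y = - x + 1 *\<^sub>R (x + y)" by simp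
  ultimately show "y \<in> dilated_sum (uminus ` {x. \<forall>i\<in>I - {l}. x + a i \<in> C i}) 1 (C l)"
    unfolding dilated_sum_def by blast
next
  fix y assume "y \<in> dilated_sum (uminus ` {x. \<forall>i\<in>I - {l}. x + a i \<in> C i}) 1 (C l)"
  then obtain x c where xc: "\<forall>i\<in>I - {l}. x + a i \<in> C i" "c \<in> C l" "y = - x + 1 *\<^sub>R c"
    unfolding dilated_sum_def by blast
  then have "\<forall>i\<in>I. x + (a(l := y)) i \<in> C i" by auto
  then show "y \<in> {y. common_point I C (a(l := y))}" unfolding common_point_def by blast
qed

lemma dilated_sum_scaleR: "dilated_sum A 1 ((*\<^sub>R) u ` K) = dilated_sum A u K"
  by (auto simp: dilated_sum_def)

text \<open>Integrate over the coordinate \<open>l\<close> first: its section is (-X) + uK with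
  \<open>X\<close> compact and convex, so the inner integral is polynomial in \<open>u\<close>, and
  interpolation commutes with the outer integral. The base index differs from \<open>l\<close> so
  that coordinate \<open>l\<close> really is integrated over.\<close>

lemma hit_volume_poly:
  fixes K :: "(real^'n) set" and C :: "'i \<Rightarrow> (real^'n) set"
  assumes I: "finite I" "b \<in> I" "l \<in> I" "b \<noteq> l"
    and C: "\<And>i. i \<in> I \<Longrightarrow> compact (C i)" "\<And>i. i \<in> I \<Longrightarrow> convex (C i)" "\<And>i. i \<in> I \<Longrightarrow> C i \<noteq> {}"
    and K: "compact K" "convex K" "K \<noteq> {}"
  shows "poly_on_nonneg CARD('n) (\<lambda>u. enn2real (hit_volume I (C(l := (*\<^sub>R) u ` K)) b))"
proof -
  interpret product_sigma_finite "\<lambda>_::'i. lborel :: (real^'n) measure" by (rule product_sigma_finite_lborel)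
  define R where "R = I - {b, l}"
  have R: "finite R" "b \<notin> R" "l \<notin> R" "I - {b} = insert l R" using I by (auto simp: R_def)
  define M where "M = Pi\<^sub>M R (\<lambda>_. lborel :: (real^'n) measure)"
  define X where "X a = {x. \<forall>i\<in>I - {l}. x + (a(b := 0)) i \<in> C i}" for a :: "'i \<Rightarrow> real^'n"
  define v where "v u a = measure lborel (dilated_sum (uminus ` X a) u K)" for u a
  have X: "compact (X a)" "convex (X a)" for a
  proof -
    have eq: "X a = (\<Inter>i\<in>I - {l}. (\<lambda>y. - (a(b := 0)) i + y) ` C i)"
    proof (intro equalityI subsetI)
      fix x assume "x \<in> X a"
      then have "x + (a(b := 0)) i \<in> C i" if "i \<in> I - {l}" for i using that unfolding X_def by blast
      moreover have "x = - (a(b := 0)) i + (x + (a(b := 0)) i)" for i by simp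
      ultimately show "x \<in> (\<Inter>i\<in>I - {l}. (\<lambda>y. - (a(b := 0)) i + y) ` C i)" by blast
    next
      fix x assume "x \<in> (\<Inter>i\<in>I - {l}. (\<lambda>y. - (a(b := 0)) i + y) ` C i)"
      then have "x + (a(b := 0)) i \<in> C i" if "i \<in> I - {l}" for i using that by force
      then show "x \<in> X a" unfolding X_def by blast
    qed
    have "compact ((\<lambda>y. w + y) ` C i)" if "i \<in> I" for w i
      by (intro compact_continuous_image continuous_intros C that)
    then show "compact (X a)" unfolding eq by (intro compact_Inter) (use I in blast)+
    show "convex (X a)" unfolding eq
      by (intro convex_INT convex_translation C) blast
  qed
  have Cu: "compact ((C(l := (*\<^sub>R) u ` K)) i)" "(C(l := (*\<^sub>R) u ` K)) i \<noteq> {}" if "i \<in> I" for u i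
    using C K that by (auto intro!: compact_scaling)
  have sec: "{y. common_point I (C(l := (*\<^sub>R) u ` K)) (a(b := 0, l := y))} = dilated_sum (uminus ` X a) u K" for u a
    unfolding common_point_section[OF I(3)] X_def by (simp add: dilated_sum_scaleR)
  have compD: "compact (dilated_sum (uminus ` X a) u K)" for a u
    by (intro compact_dilated_sum compact_negations X K)
  have vol: "emeasure lborel (dilated_sum (uminus ` X a) u K) = ennreal (v u a)" for a u
    unfolding v_def using emeasure_compact_finite[OF compD, of a u] by (intro emeasure_eq_ennreal_measure) auto
  have poly: "poly_on_nonneg CARD('n) (\<lambda>u. v u a)" for a
  proof (cases "X a = {}")
    \<comment> \<open>The other bodies may have no common point at all; then the section is empty
      for every \<open>u\<close>.\<close>
    case True
    then show ?thesis
      by (intro poly_on_nonnegI[of 0]) (auto simp: v_def dilated_sum_def)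
  next
    case False
    then show ?thesis unfolding v_def
      using X K by (intro volume_dilated_sum_poly compact_negations convex_negations) auto
  qed
  let ?h = "\<lambda>u a. indicator {a. common_point I (C(l := (*\<^sub>R) u ` K)) a} (a(b := 0)) :: ennreal"
  have meas_h: "?h u \<in> borel_measurable (Pi\<^sub>M (insert l R) (\<lambda>_. lborel))" for u
    unfolding R(4)[symmetric] by (rule measurable_indicator_common_point[OF I(1,2) Cu])
  have inner: "(\<integral>\<^sup>+y. ?h u (a(l := y)) \<partial>lborel) = ennreal (v u a)" for u a
  proof -
    have "(\<integral>\<^sup>+y. ?h u (a(l := y)) \<partial>lborel) = (\<integral>\<^sup>+y. indicator (dilated_sum (uminus ` X a) u K) y \<partial>lborel)"
      unfolding sec[symmetric] by (rule nn_integral_cong) (simp add: fun_upd_twist[OF I(4)] indicator_def)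
    also have "\<dots> = ennreal (v u a)"
      using compD by (subst nn_integral_indicator) (auto intro: borel_compact simp: vol)
    finally show ?thesis .
  qed
  have fub: "hit_volume I (C(l := (*\<^sub>R) u ` K)) b = (\<integral>\<^sup>+a. ennreal (v u a) \<partial>M)" for u
    unfolding hit_volume_def R(4) M_def
    by (subst product_nn_integral_insert[OF R(1,3) meas_h]) (simp add: inner)
  have meas_v: "v u \<in> borel_measurable M" for u
  proof -
    have "(\<lambda>(r, y). ?h u (r(l := y))) \<in> borel_measurable (M \<Otimes>\<^sub>M lborel)"
      using measurable_compose[OF measurable_add_dim meas_h] unfolding case_prod_unfold M_def .
    then have "(\<lambda>r. \<integral>\<^sup>+y. ?h u (r(l := y)) \<partial>lborel) \<in> borel_measurable M"
      by (rule lborel.borel_measurable_nn_integral)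
    then have "(\<lambda>r. ennreal (v u r)) \<in> borel_measurable M" unfolding inner .
    then have "(\<lambda>r. enn2real (ennreal (v u r))) \<in> borel_measurable M" by measurable
    moreover have "v u r \<ge> 0" for r by (simp add: v_def)
    ultimately show ?thesis by simp
  qed
  have int_v: "integrable M (v u)" for u
  proof (rule integrableI_bounded[OF meas_v])
    have "(\<integral>\<^sup>+a. ennreal (norm (v u a)) \<partial>M) = hit_volume I (C(l := (*\<^sub>R) u ` K)) b"
      unfolding fub by (rule nn_integral_cong) (simp add: v_def)
    also have "\<dots> < \<infinity>" by (rule hit_volume_finite[OF I(1,2) Cu(1)])
    finally show "(\<integral>\<^sup>+a. ennreal (norm (v u a)) \<partial>M) < \<infinity>" .
  qed
  have eq: "enn2real (hit_volume I (C(l := (*\<^sub>R) u ` K)) b) = (\<integral>a. v u a \<partial>M)" for u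
    unfolding fub using meas_v by (subst integral_eq_nn_integral) (auto simp: v_def)
  show ?thesis unfolding eq poly_on_nonneg_def
  proof (intro allI impI)
    fix u :: real assume "u \<ge> 0"
    then have "(\<integral>a. v u a \<partial>M) = (\<integral>a. (\<Sum>k\<le>CARD('n). v (real k) a * poly (lagrange_basis CARD('n) k) u) \<partial>M)"
      using poly unfolding poly_on_nonneg_def by (intro Bochner_Integration.integral_cong) auto
    also have "\<dots> = (\<Sum>k\<le>CARD('n). (\<integral>a. v (real k) a \<partial>M) * poly (lagrange_basis CARD('n) k) u)"
      using int_v by (subst Bochner_Integration.integral_sum) auto
    finally show "(\<integral>a. v u a \<partial>M) = (\<Sum>k\<le>CARD('n). (\<integral>a. v (real k) a \<partial>M) * poly (lagrange_basis CARD('n) k) u)" .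
  qed
qed

text \<open>The base coordinate stays 0 on both sides, so a transformation acts on the other
  coordinates only and contributes one factor \<open>c\<close> for each of them.\<close>

lemma hit_volume_map:
  fixes C C' :: "'i \<Rightarrow> 'a::euclidean_space set"
  assumes I: "finite I" "b \<in> I" and C': "\<And>i. i \<in> I \<Longrightarrow> compact (C' i)" "\<And>i. i \<in> I \<Longrightarrow> C' i \<noteq> {}"
    and T: "\<And>i. T i \<in> borel_measurable borel"
      "\<And>i f. f \<in> borel_measurable borel \<Longrightarrow> (\<integral>\<^sup>+x. f (T i x) \<partial>lborel) = c * (\<integral>\<^sup>+x. f x \<partial>lborel)"
    and eq: "\<And>a. common_point I C (a(b := 0)) = common_point I C' ((\<lambda>i. T i (a i))(b := 0))"
  shows "hit_volume I C b = c ^ card (I - {b}) * hit_volume I C' b"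
proof -
  have "indicator {a. common_point I C a} (a(b := 0)) =
      (indicator {a. common_point I C' a} ((\<lambda>i\<in>I - {b}. T i (a i))(b := 0)) :: ennreal)" for a
  proof -
    have "common_point I C' ((\<lambda>i. T i (a i))(b := 0)) = common_point I C' ((\<lambda>i\<in>I - {b}. T i (a i))(b := 0))"
      by (rule common_point_cong) auto
    then show ?thesis using eq by (simp add: indicator_def)
  qed
  then have "hit_volume I C b = (\<integral>\<^sup>+a. indicator {a. common_point I C' a} ((\<lambda>i\<in>I - {b}. T i (a i))(b := 0)) \<partial>Pi\<^sub>M (I - {b}) (\<lambda>_. lborel))"
    unfolding hit_volume_def by simp
  also have "\<dots> = c ^ card (I - {b}) * hit_volume I C' b"
    unfolding hit_volume_def
    by (rule nn_integral_PiM_map[where f="\<lambda>a. indicator {a. common_point I C' a} (a(b := 0))"])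
      (use I T measurable_indicator_common_point[OF I C'] in auto)
  finally show ?thesis .
qed

lemma hit_volume_scale:
  fixes C :: "'i \<Rightarrow> 'a::euclidean_space set"
  assumes I: "finite I" "b \<in> I" and C: "\<And>i. i \<in> I \<Longrightarrow> compact (C i)" "\<And>i. i \<in> I \<Longrightarrow> C i \<noteq> {}" and r: "r > 0"
  shows "hit_volume I (\<lambda>i. (*\<^sub>R) r ` C i) b = ennreal (r ^ (DIM('a) * card (I - {b}))) * hit_volume I C b"
proof -
  have "hit_volume I C b = ennreal (1 / \<bar>r\<bar> ^ DIM('a)) ^ card (I - {b}) * hit_volume I (\<lambda>i. (*\<^sub>R) r ` C i) b"
  proof (rule hit_volume_map[OF I, where T="\<lambda>_ x. 0 + r *\<^sub>R x"])
    show "(\<integral>\<^sup>+x. f (0 + r *\<^sub>R x) \<partial>lborel) = ennreal (1 / \<bar>r\<bar> ^ DIM('a)) * (\<integral>\<^sup>+x. f x \<partial>lborel)"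
      if "f \<in> borel_measurable borel" for f :: "'a \<Rightarrow> ennreal"
      by (rule nn_integral_lborel_affine[OF that]) (use r in auto)
    fix a :: "'i \<Rightarrow> 'a"
    have *: "x + (a(b := 0)) i \<in> C i \<longleftrightarrow> r *\<^sub>R x + ((\<lambda>i. 0 + r *\<^sub>R a i)(b := 0)) i \<in> (*\<^sub>R) r ` C i" for x i
    proof -
      have "r *\<^sub>R x + ((\<lambda>i. 0 + r *\<^sub>R a i)(b := 0)) i = r *\<^sub>R (x + (a(b := 0)) i)"
        by (simp add: scaleR_add_right)
      then show ?thesis using r by (simp add: image_iff)
    qed
    show "common_point I C (a(b := 0)) = common_point I (\<lambda>i. (*\<^sub>R) r ` C i) ((\<lambda>i. 0 + r *\<^sub>R a i)(b := 0))"
      unfolding common_point_def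
    proof
      assume "\<exists>x. \<forall>i\<in>I. x + (a(b := 0)) i \<in> C i"
      then show "\<exists>x. \<forall>i\<in>I. x + ((\<lambda>i. 0 + r *\<^sub>R a i)(b := 0)) i \<in> (*\<^sub>R) r ` C i"
        using *[THEN iffD1] by blast
    next
      assume "\<exists>x. \<forall>i\<in>I. x + ((\<lambda>i. 0 + r *\<^sub>R a i)(b := 0)) i \<in> (*\<^sub>R) r ` C i"
      then obtain x where x: "\<forall>i\<in>I. x + ((\<lambda>i. 0 + r *\<^sub>R a i)(b := 0)) i \<in> (*\<^sub>R) r ` C i" by blast
      have "r *\<^sub>R ((1 / r) *\<^sub>R x) = x" using r by simp
      then have "\<forall>i\<in>I. (1 / r) *\<^sub>R x + (a(b := 0)) i \<in> C i"
        using x *[of "(1 / r) *\<^sub>R x"] by simp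
      then show "\<exists>x. \<forall>i\<in>I. x + (a(b := 0)) i \<in> C i" by blast
    qed
  qed (use C in \<open>auto intro!: compact_scaling\<close>)
  moreover have "ennreal (r ^ (DIM('a) * card (I - {b}))) * ennreal (1 / \<bar>r\<bar> ^ DIM('a)) ^ card (I - {b}) = 1"
  proof -
    have "r ^ (DIM('a) * card (I - {b})) * (1 / \<bar>r\<bar> ^ DIM('a)) ^ card (I - {b}) = 1"
      using r by (simp add: power_mult power_one_over power_divide)
    then show ?thesis using r by (simp add: ennreal_power ennreal_mult[symmetric])
  qed
  ultimately show ?thesis by (simp add: mult.assoc[symmetric])
qed

section \<open>Injective linear changes of variables\<close>

lemma nn_integral_linear_wellorder:
  fixes L :: "real^'m::{finite,wellorder} \<Rightarrow> real^'m::_"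
  assumes L: "linear L" "inj L"
  shows "\<exists>k>0. \<forall>f\<in>borel_measurable borel. (\<integral>\<^sup>+x. f (L x) \<partial>lborel) = ennreal k * (\<integral>\<^sup>+x. f x \<partial>lborel)"
proof -
  obtain G where G: "linear G" "G \<circ> L = id" "L \<circ> G = id"
    using linear_injective_isomorphism[OF L] by (metis comp_apply eq_id_iff fun.map_id0 ext)
  have GL: "G (L x) = x" "L (G x) = x" for x using G(2,3) by (metis comp_apply id_apply)+
  define k where "k = \<bar>det (matrix G)\<bar>"
  have k: "k > 0"
    using det_nz_iff_inj[OF G(1)] GL by (auto simp: k_def inj_def) (metis GL(2))
  have Lm: "L \<in> borel_measurable borel"
    by (rule borel_measurable_continuous_onI) (rule linear_continuous_on, use L in \<open>simp add: linear_conv_bounded_linear\<close>)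
  have eq: "lborel = scale_measure (ennreal (1 / k)) (distr lborel borel L)"
  proof (rule lborel_eqI)
    fix l u :: "real^'m::_" assume lu: "\<And>b. b \<in> Basis \<Longrightarrow> l \<bullet> b \<le> u \<bullet> b"
    have img: "L -` box l u = G ` box l u" using GL by (auto simp: image_iff) metis
    have lm: "box l u \<in> lmeasurable" by simp
    have "emeasure lborel (L -` box l u) = emeasure lebesgue (G ` box l u)"
      using measurable_sets[OF Lm, of "box l u"] by (simp add: img[symmetric])
    also have "\<dots> = ennreal (measure lebesgue (G ` box l u))"
      using measurable_linear_image[OF G(1) lm] by (simp add: emeasure_eq_measure2)
    also have "measure lebesgue (G ` box l u) = k * measure lebesgue (box l u)"
      unfolding k_def by (rule measure_linear_image[OF G(1) lm])
    also have "measure lebesgue (box l u) = (\<Prod>b\<in>Basis. (u - l) \<bullet> b)"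
      using lu by (simp add: measure_lborel_box_eq)
    finally have "emeasure lborel (L -` box l u) = ennreal (k * (\<Prod>b\<in>Basis. (u - l) \<bullet> b))" .
    then show "emeasure (scale_measure (ennreal (1 / k)) (distr lborel borel L)) (box l u) = ennreal (\<Prod>b\<in>Basis. (u - l) \<bullet> b)"
      using k Lm by (simp add: emeasure_distr ennreal_mult'[symmetric])
  qed simp
  have "(\<integral>\<^sup>+x. f (L x) \<partial>lborel) = ennreal k * (\<integral>\<^sup>+x. f x \<partial>lborel)" if f: "f \<in> borel_measurable borel" for f :: "real^'m::_ \<Rightarrow> ennreal"
  proof -
    have "(\<integral>\<^sup>+x. f x \<partial>lborel) = ennreal (1 / k) * (\<integral>\<^sup>+x. f (L x) \<partial>lborel)"
      using f Lm by (subst eq) (simp add: nn_integral_scale_measure nn_integral_distr)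
    moreover have "ennreal k * ennreal (1 / k) = 1"
      using k by (simp add: ennreal_mult[symmetric])
    ultimately show ?thesis by (simp add: mult.assoc[symmetric])
  qed
  then show ?thesis using k by blast
qed

lemma nn_integral_relabel:
  fixes \<sigma> :: "'m::finite \<Rightarrow> 'n::finite"
  assumes "bij \<sigma>" "f \<in> borel_measurable borel"
  shows "(\<integral>\<^sup>+x. f (relabel \<sigma> x) \<partial>lborel) = (\<integral>\<^sup>+x. f x \<partial>lborel)"
  using nn_integral_distr[of "relabel \<sigma>" lborel borel f] assms
  by (simp add: distr_relabel borel_measurable_continuous_onI continuous_on_relabel)

text \<open>Conjugation with a relabelling of the coordinates reduces to a well-ordered index type.
  Only the existence of the factor is recorded: it later cancels between the volume of the
  difference body and the power of the volume of the body.\<close>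

lemma nn_integral_linear:
  fixes L :: "real^'n \<Rightarrow> real^'n"
  assumes L: "linear L" "inj L"
  shows "\<exists>k>0. \<forall>f\<in>borel_measurable borel. (\<integral>\<^sup>+x. f (L x) \<partial>lborel) = ennreal k * (\<integral>\<^sup>+x. f x \<partial>lborel)"
proof -
  obtain \<sigma> :: "'n ranked \<Rightarrow> 'n" where \<sigma>: "bij \<sigma>" using ex_bij_ranked by blast
  let ?r = "relabel \<sigma>" and ?s = "relabel (inv \<sigma>)"
  have rm: "?r \<in> borel_measurable borel" "?s \<in> borel_measurable borel"
    by (auto intro!: borel_measurable_continuous_onI continuous_on_relabel)
  have Lm: "L \<in> borel_measurable borel"
    by (rule borel_measurable_continuous_onI) (rule linear_continuous_on, use L in \<open>simp add: linear_conv_bounded_linear\<close>)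
  have "linear (?r \<circ> L \<circ> ?s)" by (intro linear_compose linear_relabel L)
  moreover have "inj (?r \<circ> L \<circ> ?s)"
    by (intro inj_compose L) (metis \<sigma> injI relabel_inverse(1), metis \<sigma> injI relabel_inverse(2))
  ultimately obtain k where k: "k > 0" "\<And>f. f \<in> borel_measurable borel \<Longrightarrow>
      (\<integral>\<^sup>+x. f ((?r \<circ> L \<circ> ?s) x) \<partial>lborel) = ennreal k * (\<integral>\<^sup>+x. f x \<partial>lborel)"
    using nn_integral_linear_wellorder by blast
  have "(\<integral>\<^sup>+x. f (L x) \<partial>lborel) = ennreal k * (\<integral>\<^sup>+x. f x \<partial>lborel)" if f: "f \<in> borel_measurable borel" for f :: "real^'n \<Rightarrow> ennreal"
  proof -
    have fs: "(\<lambda>y. f (?s y)) \<in> borel_measurable borel" using f rm by measurable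
    have fL: "(\<lambda>x. f (L x)) \<in> borel_measurable borel" using f Lm by measurable
    have "(\<integral>\<^sup>+x. f (L x) \<partial>lborel) = (\<integral>\<^sup>+y. f (L (?s y)) \<partial>lborel)"
      by (rule nn_integral_relabel[symmetric, OF bij_imp_bij_inv[OF \<sigma>] fL])
    also have "\<dots> = (\<integral>\<^sup>+y. f (?s ((?r \<circ> L \<circ> ?s) y)) \<partial>lborel)"
      by (simp add: relabel_inverse(1)[OF \<sigma>])
    also have "\<dots> = ennreal k * (\<integral>\<^sup>+y. f (?s y) \<partial>lborel)" by (rule k(2)[OF fs])
    also have "(\<integral>\<^sup>+y. f (?s y) \<partial>lborel) = (\<integral>\<^sup>+x. f x \<partial>lborel)"
      by (rule nn_integral_relabel[OF bij_imp_bij_inv[OF \<sigma>] f])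
    finally show ?thesis .
  qed
  then show ?thesis using k(1) by blast
qed

section \<open>Higher-order difference bodies and mixed volumes\<close>

definition part :: "nat \<Rightarrow> (real^'n) set \<Rightarrow> nat \<Rightarrow> (nat \<Rightarrow> real^'n) set" where
  "part p K l = (if l = 0 then power_neg p (diag p ` K) else incl p l ` K)"

text \<open>The list \<open>bs\<close> records which of the p+1 bodies each summand of a mixed
  volume copies. Copies of one convex body merge, so the coefficients matter only through these
  totals.\<close>

definition block_sum :: "nat list \<Rightarrow> (nat \<Rightarrow> real) \<Rightarrow> nat \<Rightarrow> real" where
  "block_sum bs s l = (\<Sum>i | i < length bs \<and> bs ! i = l. s i)"

definition part_point :: "nat \<Rightarrow> nat \<Rightarrow> real^'n \<Rightarrow> nat \<Rightarrow> real^'n" where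
  "part_point p l w = (\<lambda>k\<in>{1..p}. if l = 0 then - w else if k = l then w else 0)"

lemma part_eq_image:
  fixes K :: "(real^'n) set"
  shows "part p K l = part_point p l ` K"
proof (cases "l = 0")
  case True
  have "(\<lambda>k\<in>{1..p}. - diag p w k) = part_point p 0 w" for w :: "real^'n"
    by (auto simp: diag_def part_point_def fun_eq_iff restrict_def)
  then show ?thesis using True by (simp add: part_def power_neg_def image_image)
next
  case False
  then have "incl p l w = part_point p l w" for w :: "real^'n"
    by (simp add: incl_def part_point_def)
  then show ?thesis using False by (simp add: part_def)
qed

definition comb_body :: "nat \<Rightarrow> (real^'n) set \<Rightarrow> (nat \<Rightarrow> real) \<Rightarrow> (nat \<Rightarrow> real^'n) set" where
  "comb_body p K t = {(\<lambda>k\<in>{1..p}. t k *\<^sub>R y k - t 0 *\<^sub>R y 0) | y. \<forall>l\<le>p. y l \<in> K}"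

text \<open>The identity aK + bK = (a+b)K for convex K, with finitely many nonnegative weights. A
  zero total forces all weights to be 0, and then any point of \<open>K\<close> will do.\<close>

lemma convex_weighted_sum:
  fixes K :: "'a::real_vector set"
  assumes "finite J" "convex K" "K \<noteq> {}" "\<And>i. i \<in> J \<Longrightarrow> s i \<ge> 0" "\<And>i. i \<in> J \<Longrightarrow> w i \<in> K"
  shows "\<exists>y\<in>K. (\<Sum>i\<in>J. s i *\<^sub>R w i) = (\<Sum>i\<in>J. s i) *\<^sub>R y"
proof (cases "(\<Sum>i\<in>J. s i) = 0")
  case True
  then have "\<forall>i\<in>J. s i = 0" using assms(1,4) by (simp add: sum_nonneg_eq_0_iff)
  then show ?thesis using assms(3) by auto
next
  case False
  let ?S = "\<Sum>i\<in>J. s i"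
  have pos: "?S > 0" using False sum_nonneg[of J s] assms(4) by force
  have "(\<Sum>i\<in>J. (s i / ?S) *\<^sub>R w i) \<in> K"
    using pos assms by (intro convex_sum) (auto simp: sum_divide_distrib[symmetric])
  moreover have "(\<Sum>i\<in>J. s i *\<^sub>R w i) = ?S *\<^sub>R (\<Sum>i\<in>J. (s i / ?S) *\<^sub>R w i)"
    using pos by (simp add: scaleR_sum_right)
  ultimately show ?thesis by blast
qed

lemma sum_part_point:
  assumes "k \<in> {1..p}"
  shows "(\<Sum>i<length bs. s i *\<^sub>R part_point p (bs ! i) (w i) k)
     = (\<Sum>i | i < length bs \<and> bs ! i = k. s i *\<^sub>R w i) - (\<Sum>i | i < length bs \<and> bs ! i = 0. s i *\<^sub>R w i)"
proof -
  have filt: "(\<Sum>i | i < length bs \<and> bs ! i = l. s i *\<^sub>R w i) = (\<Sum>i<length bs. if bs ! i = l then s i *\<^sub>R w i else 0)" for l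
    by (subst sum.inter_filter[symmetric]) auto
  have "(\<Sum>i<length bs. s i *\<^sub>R part_point p (bs ! i) (w i) k)
     = (\<Sum>i<length bs. (if bs ! i = k then s i *\<^sub>R w i else 0) - (if bs ! i = 0 then s i *\<^sub>R w i else 0))"
    by (rule sum.cong) (use assms in \<open>auto simp: part_point_def\<close>)
  then show ?thesis
    unfolding filt sum_subtractf .
qed

lemma minkowski_comb_parts:
  fixes K :: "(real^'n) set"
  assumes K: "convex K" "K \<noteq> {}" and bs: "set bs \<subseteq> {0..p}" and s: "\<And>i. i < length bs \<Longrightarrow> s i \<ge> 0"
  shows "minkowski_comb p s (map (part p K) bs) = comb_body p K (block_sum bs s)"
proof (intro equalityI subsetI)
  fix z assume "z \<in> minkowski_comb p s (map (part p K) bs)"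
  then obtain x where "z = (\<lambda>k\<in>{1..p}. \<Sum>i<length bs. s i *\<^sub>R x i k)"
      "\<forall>i<length bs. x i \<in> map (part p K) bs ! i"
    unfolding minkowski_comb_def length_map by blast
  then have x: "z = (\<lambda>k\<in>{1..p}. \<Sum>i<length bs. s i *\<^sub>R x i k)" "\<forall>i<length bs. x i \<in> part p K (bs ! i)"
    by simp_all
  then have "\<forall>i<length bs. \<exists>w\<in>K. x i = part_point p (bs ! i) w" unfolding part_eq_image by blast
  then obtain w where w: "\<And>i. i < length bs \<Longrightarrow> w i \<in> K" "\<And>i. i < length bs \<Longrightarrow> x i = part_point p (bs ! i) (w i)"
    by metis
  have "\<exists>y. y \<in> K \<and> (\<Sum>i | i < length bs \<and> bs ! i = l. s i *\<^sub>R w i) = block_sum bs s l *\<^sub>R y" for l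
    unfolding block_sum_def Bex_def[symmetric] by (rule convex_weighted_sum[OF _ K]) (auto intro: s w(1))
  then obtain y where "\<forall>l. y l \<in> K \<and> (\<Sum>i | i < length bs \<and> bs ! i = l. s i *\<^sub>R w i) = block_sum bs s l *\<^sub>R y l"
    using choice[of "\<lambda>l y. y \<in> K \<and> (\<Sum>i | i < length bs \<and> bs ! i = l. s i *\<^sub>R w i) = block_sum bs s l *\<^sub>R y"] by blast
  then have y: "y l \<in> K" "(\<Sum>i | i < length bs \<and> bs ! i = l. s i *\<^sub>R w i) = block_sum bs s l *\<^sub>R y l" for l
    by auto
  have "z = (\<lambda>k\<in>{1..p}. block_sum bs s k *\<^sub>R y k - block_sum bs s 0 *\<^sub>R y 0)"
    unfolding x(1)
  proof (rule restrict_ext)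
    fix k assume k: "k \<in> {1..p}"
    have "(\<Sum>i<length bs. s i *\<^sub>R x i k) = (\<Sum>i<length bs. s i *\<^sub>R part_point p (bs ! i) (w i) k)"
      by (rule sum.cong) (auto simp: w(2))
    then show "(\<Sum>i<length bs. s i *\<^sub>R x i k) = block_sum bs s k *\<^sub>R y k - block_sum bs s 0 *\<^sub>R y 0"
      unfolding sum_part_point[OF k] y(2) .
  qed
  then show "z \<in> comb_body p K (block_sum bs s)" unfolding comb_body_def using y(1) by blast
next
  fix z assume "z \<in> comb_body p K (block_sum bs s)"
  then obtain y where y: "z = (\<lambda>k\<in>{1..p}. block_sum bs s k *\<^sub>R y k - block_sum bs s 0 *\<^sub>R y 0)" "\<forall>l\<le>p. y l \<in> K"
    unfolding comb_body_def by blast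
  define x where "x i = part_point p (bs ! i) (y (bs ! i))" for i
  have "x i \<in> part p K (bs ! i)" if "i < length bs" for i
  proof -
    have "bs ! i \<le> p" using bs nth_mem[OF that] by auto
    then show ?thesis using y(2) unfolding x_def part_eq_image by blast
  qed
  moreover have "z = (\<lambda>k\<in>{1..p}. \<Sum>i<length bs. s i *\<^sub>R x i k)"
    unfolding y(1)
  proof (rule restrict_ext)
    fix k assume k: "k \<in> {1..p}"
    have "(\<Sum>i | i < length bs \<and> bs ! i = l. s i *\<^sub>R y (bs ! i)) = block_sum bs s l *\<^sub>R y l" for l
      unfolding block_sum_def scaleR_sum_left by (rule sum.cong) auto
    then show "block_sum bs s k *\<^sub>R y k - block_sum bs s 0 *\<^sub>R y 0 = (\<Sum>i<length bs. s i *\<^sub>R x i k)"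
      unfolding x_def sum_part_point[OF k] by simp
  qed
  ultimately show "z \<in> minkowski_comb p s (map (part p K) bs)"
    unfolding minkowski_comb_def length_map by (intro CollectI exI[of _ x] conjI) simp_all
qed

lemma comb_body_cong: "(\<And>l. l \<le> p \<Longrightarrow> t l = t' l) \<Longrightarrow> comb_body p K t = comb_body p K t'"
  unfolding comb_body_def by (intro Collect_cong ex_cong1 conj_cong refl arg_cong2[where f="(=)"] restrict_ext) auto

lemma diff_body_eq:
  fixes K :: "(real^'n) set"
  assumes "convex K" "K \<noteq> {}" "\<And>l. l \<le> p \<Longrightarrow> t l \<ge> 0"
  shows "diff_body p t K = comb_body p K t"
proof -
  have "[0..<Suc p] = 0 # [1..<Suc p]" by (simp add: upt_conv_Cons)
  then have "power_neg p (diag p ` K) # map (\<lambda>l. incl p l ` K) [1..<Suc p] = map (part p K) [0..<Suc p]"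
    by (auto simp: part_def)
  then have "diff_body p t K = minkowski_comb p t (map (part p K) [0..<Suc p])"
    unfolding diff_body_def by simp
  also have "\<dots> = comb_body p K (block_sum [0..<Suc p] t)"
    by (rule minkowski_comb_parts) (use assms in \<open>auto simp del: upt_Suc\<close>)
  also have "\<dots> = comb_body p K t"
  proof (rule comb_body_cong)
    fix l assume "l \<le> p"
    then have "{i. i < length [0..<Suc p] \<and> [0..<Suc p] ! i = l} = {l}" by (auto simp del: upt_Suc)
    then show "block_sum [0..<Suc p] t l = t l" unfolding block_sum_def by simp
  qed
  finally show ?thesis .
qed

definition diff_volume :: "nat \<Rightarrow> (real^'n) set \<Rightarrow> (nat \<Rightarrow> real) \<Rightarrow> real" where
  "diff_volume p K t = enn2real (hit_volume {0..p} (\<lambda>l. (*\<^sub>R) (t l) ` K) 0)"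

text \<open>Membership in the body is the common point condition for the sets t_l K with coordinate
  0 set to 0. The body is measurable already for the product of Borel measures, so its completed
  measure is the integral of its indicator.\<close>

lemma power_volume_comb_body:
  fixes K :: "(real^'n) set"
  assumes K: "compact K" "K \<noteq> {}"
  shows "power_volume p (comb_body p K t) = diff_volume p K t"
proof -
  let ?C = "\<lambda>l. (*\<^sub>R) (t l) ` K" and ?M = "Pi\<^sub>M {1..p} (\<lambda>_. lborel :: (real^'n) measure)"
  have I: "{0..p} - {0} = {1..p}" by auto
  have C: "compact (?C l)" "?C l \<noteq> {}" for l using K by (auto intro: compact_scaling)
  have eq: "z \<in> comb_body p K t \<longleftrightarrow> z \<in> space ?M \<and> common_point {0..p} ?C (z(0 := 0))" for z
  proof
    assume "z \<in> comb_body p K t"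
    then obtain y where y: "z = (\<lambda>k\<in>{1..p}. t k *\<^sub>R y k - t 0 *\<^sub>R y 0)" "\<forall>l\<le>p. y l \<in> K"
      unfolding comb_body_def by blast
    have "\<forall>l\<in>{0..p}. t 0 *\<^sub>R y 0 + (z(0 := 0)) l \<in> ?C l" using y by auto
    moreover have "z \<in> space ?M" unfolding y(1) space_PiM by auto
    ultimately show "z \<in> space ?M \<and> common_point {0..p} ?C (z(0 := 0))"
      unfolding common_point_def by blast
  next
    assume z: "z \<in> space ?M \<and> common_point {0..p} ?C (z(0 := 0))"
    then obtain x where x: "\<And>l. l \<in> {0..p} \<Longrightarrow> x + (z(0 := 0)) l \<in> ?C l" unfolding common_point_def by blast
    have "\<exists>y. y \<in> K \<and> x + (z(0 := 0)) l = t l *\<^sub>R y" if "l \<in> {0..p}" for l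
      using x[OF that] unfolding image_iff by blast
    then obtain y where y: "\<And>l. l \<in> {0..p} \<Longrightarrow> y l \<in> K" "\<And>l. l \<in> {0..p} \<Longrightarrow> x + (z(0 := 0)) l = t l *\<^sub>R y l"
      using bchoice[of "{0..p}" "\<lambda>l y. y \<in> K \<and> x + (z(0 := 0)) l = t l *\<^sub>R y"] by blast
    have "z = (\<lambda>k\<in>{1..p}. t k *\<^sub>R y k - t 0 *\<^sub>R y 0)"
    proof
      fix k
      show "z k = (\<lambda>k\<in>{1..p}. t k *\<^sub>R y k - t 0 *\<^sub>R y 0) k"
      proof (cases "k \<in> {1..p}")
        case True
        then show ?thesis using y(2)[of k] y(2)[of 0] by (simp add: algebra_simps)
      next
        case False
        then show ?thesis using z PiE_arb[of z "{1..p}" "\<lambda>_. UNIV" k] by (auto simp: space_PiM)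
      qed
    qed
    moreover have "\<forall>l\<le>p. y l \<in> K" using y(1) by simp
    ultimately show "z \<in> comb_body p K t" unfolding comb_body_def by blast
  qed
  have ind: "(\<lambda>a. indicator {a. common_point {0..p} ?C a} (a(0 := 0)) :: ennreal) \<in> borel_measurable ?M"
    using measurable_indicator_common_point[of "{0..p}" 0 ?C 0] C unfolding I by simp
  have meas: "comb_body p K t \<in> sets ?M"
  proof -
    have "comb_body p K t = (\<lambda>a. indicator {a. common_point {0..p} ?C a} (a(0 := 0)) :: ennreal) -` {1} \<inter> space ?M"
      by (rule set_eqI) (simp only: eq vimage_eq Int_iff singleton_iff indicator_eq_1_iff mem_Collect_eq conj_commute)
    also have "\<dots> \<in> sets ?M" by (rule measurable_sets[OF ind]) simp
    finally show ?thesis .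
  qed
  have "emeasure ?M (comb_body p K t) = (\<integral>\<^sup>+a. indicator (comb_body p K t) a \<partial>?M)"
    using meas by simp
  also have "\<dots> = hit_volume {0..p} ?C 0"
    unfolding hit_volume_def I by (rule nn_integral_cong) (auto simp: eq indicator_def)
  finally show ?thesis
    using meas by (simp add: power_volume_def diff_volume_def measure_def)
qed

text \<open>These are exactly the vectors n - j with j in J_p^n: p+1 entries between 0 and n with
  sum n(p+1) - n.\<close>

definition exponents :: "nat \<Rightarrow> nat \<Rightarrow> (nat \<Rightarrow> nat) set" where
  "exponents n p = {e \<in> {0..p} \<rightarrow>\<^sub>E {..n}. sum e {0..p} = n * p}"

lemma finite_exponents: "finite (exponents n p)"
  unfolding exponents_def by (rule finite_subset[of _ "{0..p} \<rightarrow>\<^sub>E {..n}"]) (auto intro: finite_PiE)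

lemma diff_volume_scale:
  fixes K :: "(real^'n) set"
  assumes K: "compact K" "K \<noteq> {}" and r: "r > 0"
  shows "diff_volume p K (\<lambda>l. r * t l) = r ^ (CARD('n) * p) * diff_volume p K t"
proof -
  have "(\<lambda>l. (*\<^sub>R) (r * t l) ` K) = (\<lambda>l. (*\<^sub>R) r ` (*\<^sub>R) (t l) ` K)"
    by (simp add: image_image)
  then have "hit_volume {0..p} (\<lambda>l. (*\<^sub>R) (r * t l) ` K) 0 =
     ennreal (r ^ (CARD('n) * p)) * hit_volume {0..p} (\<lambda>l. (*\<^sub>R) (t l) ` K) 0"
    using hit_volume_scale[of "{0..p}" 0 "\<lambda>l. (*\<^sub>R) (t l) ` K" r] K r
    by (simp add: compact_scaling)
  then show ?thesis using r by (simp add: diff_volume_def enn2real_mult)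
qed

text \<open>For each variable \<open>l\<close> the zero is placed at an index other than
  \<open>l\<close>: index 0 for positive \<open>l\<close>, index 1, available because
  \<open>p \<ge> 1\<close>, for \<open>l = 0\<close>. Separate polynomiality of degree at most n and
  homogeneity of degree np then fix the admissible exponents.\<close>

lemma diff_volume_poly:
  fixes K :: "(real^'n) set"
  assumes K: "compact K" "convex K" "K \<noteq> {}" and p: "p \<ge> 1"
  shows "\<exists>c. \<forall>t. (\<forall>l\<in>{0..p}. t l \<ge> 0) \<longrightarrow>
     diff_volume p K t = (\<Sum>e\<in>exponents CARD('n) p. c e * (\<Prod>l\<in>{0..p}. t l ^ e l))"
proof -
  have "\<exists>c. \<forall>t. (\<forall>l\<in>{0..p}. t l \<ge> 0) \<longrightarrow>
     diff_volume p K t = (\<Sum>e\<in>{0..p} \<rightarrow>\<^sub>E {..CARD('n)}. c e * (\<Prod>l\<in>{0..p}. t l ^ e l))"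
  proof (rule separately_polynomial)
    fix l t assume l: "l \<in> {0..p}"
    have C: "compact ((*\<^sub>R) (t i) ` K)" "convex ((*\<^sub>R) (t i) ` K)" "(*\<^sub>R) (t i) ` K \<noteq> {}" for t :: "nat \<Rightarrow> real" and i
      by (simp_all add: compact_scaling convex_scaling K)
    obtain b where b: "b \<in> {0..p}" "b \<noteq> l"
      "\<And>s. hit_volume {0..p} (\<lambda>i. (*\<^sub>R) (s i) ` K) 0 = hit_volume {0..p} (\<lambda>i. (*\<^sub>R) (s i) ` K) b"
    proof (cases "l = 0")
      case True
      have "hit_volume {0..p} (\<lambda>i. (*\<^sub>R) (s i) ` K) 0 = hit_volume {0..p} (\<lambda>i. (*\<^sub>R) (s i) ` K) 1" for s
        by (rule hit_volume_base[OF _ _ _ _ C(1,3)]) (use p in simp_all)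
      then show ?thesis using that[of 1] p True by simp
    qed (use that[of 0] in simp)
    have upd: "(\<lambda>i. (*\<^sub>R) ((t(l := u)) i) ` K) = (\<lambda>i. (*\<^sub>R) (t i) ` K)(l := (*\<^sub>R) u ` K)" for u
      by (simp add: fun_eq_iff)
    show "poly_on_nonneg CARD('n) (\<lambda>u. diff_volume p K (t(l := u)))"
      unfolding diff_volume_def b(3) unfolding upd
      by (rule hit_volume_poly[OF finite_atLeastAtMost b(1) l b(2) C K])
  next
    fix s t :: "nat \<Rightarrow> real" assume st: "\<forall>i\<in>{0..p}. s i = t i"
    have "comb_body p K s = comb_body p K t" by (rule comb_body_cong) (use st in auto)
    then show "diff_volume p K s = diff_volume p K t"
      by (simp only: power_volume_comb_body[OF K(1,3), symmetric])
  qed simp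
  then obtain c where c: "\<And>t. (\<forall>l\<in>{0..p}. t l \<ge> 0) \<Longrightarrow>
     diff_volume p K t = (\<Sum>e\<in>{0..p} \<rightarrow>\<^sub>E {..CARD('n)}. c e * (\<Prod>l\<in>{0..p}. t l ^ e l))" by blast
  have "finite ({0..p} \<rightarrow>\<^sub>E {..CARD('n)})" by (intro finite_PiE) auto
  from homogeneous_part[OF this c diff_volume_scale[OF K(1,3)]]
  show ?thesis unfolding exponents_def by blast
qed


text \<open>The \<open>m\<close>-th derivative of \<open>x ^ d\<close> has coefficient \<open>falling d m\<close>; truncated subtraction makes it vanish for \<open>m > d\<close>.\<close>

definition falling :: "nat \<Rightarrow> nat \<Rightarrow> real" where
  "falling d m = (\<Prod>i<m. real (d - i))"

lemma falling_Suc: "falling d (Suc m) = falling d m * real (d - m)"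
  by (simp add: falling_def)

lemma falling_eq_0: "d < m \<Longrightarrow> falling d m = 0"
  by (auto simp: falling_def intro!: bexI[of _ d])

lemma falling_self: "falling d d = fact d"
proof -
  have "falling d d = (\<Prod>i<d. real (Suc i))"
    unfolding falling_def by (rule prod.reindex_bij_witness[of _ "\<lambda>i. d - Suc i" "\<lambda>i. d - Suc i"]) auto
  then show ?thesis by (simp add: fact_prod_Suc atLeast0LessThan)
qed

section \<open>Iterated one-sided derivatives and mixed volumes\<close>

lemma partial_deriv_eqI:
  assumes "(h has_real_derivative D) (at (s i))" "s i \<ge> 0" "\<And>u. u \<ge> 0 \<Longrightarrow> f (s(i := u)) = h u"
  shows "partial_deriv i f s = D"
proof -
  \<comment> \<open>No point of the half-line is isolated in it, which makes the one-sided
    derivative unique.\<close>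
  have "at_right (s i) \<le> at (s i) within {0..}"
    by (rule at_le) (use assms(2) in auto)
  then have nb: "at (s i) within {0..} \<noteq> bot"
    using trivial_limit_at_right_real[of "s i"] by (metis bot_unique)
  have "(h has_vector_derivative D) (at (s i) within {0..})"
    using assms(1) by (simp add: has_real_derivative_iff_has_vector_derivative has_vector_derivative_at_within)
  then have "((\<lambda>u. f (s(i := u))) has_vector_derivative D) (at (s i) within {0..})"
    by (rule has_vector_derivative_transform[rotated 2]) (use assms in auto)
  then show ?thesis unfolding partial_deriv_def by (rule vector_derivative_within[OF nb])
qed

text \<open>The number of derivatives along \<open>xs\<close> that hit a coefficient belonging to
  body \<open>l\<close>.\<close>

definition multiplicity_in :: "nat list \<Rightarrow> nat list \<Rightarrow> nat \<Rightarrow> nat" where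
  "multiplicity_in bs xs l = length (filter (\<lambda>i. bs ! i = l) xs)"

lemma block_sum_upd:
  assumes "i < length bs"
  shows "block_sum bs (s(i := u)) l = block_sum bs s l + (if l = bs ! i then u - s i else 0)"
proof (cases "l = bs ! i")
  case True
  let ?J = "{j. j < length bs \<and> bs ! j = l}"
  have "i \<in> ?J" "finite ?J" using assms True by auto
  then have "block_sum bs (s(i := u)) l = u + (\<Sum>j\<in>?J - {i}. s j)" "block_sum bs s l = s i + (\<Sum>j\<in>?J - {i}. s j)"
    unfolding block_sum_def by (auto simp: sum.remove[where x=i])
  then show ?thesis using True by simp
next
  case False
  then show ?thesis unfolding block_sum_def by (auto intro!: sum.cong)
qed

text \<open>Every coefficient of body \<open>l\<close> acts through the same block sum with slope 1,
  so each derivative lowers the exponent of that block by one. The formula is kept on the whole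
  orthant, since the next derivative needs values away from the origin.\<close>

lemma foldr_partial_deriv:
  assumes bs: "set bs \<subseteq> {0..p}"
    and f: "\<And>s. (\<And>i. i < length bs \<Longrightarrow> s i \<ge> 0) \<Longrightarrow> f s = (\<Sum>e\<in>E. c e * (\<Prod>l\<in>{0..p}. block_sum bs s l ^ e l))"
    and "set xs \<subseteq> {..<length bs}" "\<And>i. i < length bs \<Longrightarrow> s i \<ge> 0"
  shows "foldr partial_deriv xs f s = (\<Sum>e\<in>E. c e * (\<Prod>l\<in>{0..p}.
     falling (e l) (multiplicity_in bs xs l) * block_sum bs s l ^ (e l - multiplicity_in bs xs l)))"
  using assms(3,4)
proof (induction xs arbitrary: s)
  case Nil
  then show ?case using f[of s] by (simp add: multiplicity_in_def falling_def)
next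
  case (Cons i xs)
  have i: "i < length bs" using Cons.prems by auto
  let ?b = "bs ! i" and ?m = "multiplicity_in bs xs"
  have b: "?b \<in> {0..p}" using bs nth_mem[OF i] by blast
  define A where "A e = (\<Prod>l\<in>{0..p} - {?b}. falling (e l) (?m l) * block_sum bs s l ^ (e l - ?m l))" for e
  let ?D = "\<lambda>e. c e * (A e * (falling (e ?b) (?m ?b) * (real (e ?b - ?m ?b) * block_sum bs s ?b ^ (e ?b - ?m ?b - 1))))"
  \<comment> \<open>Along the \<open>i\<close>-th axis only the block \<open>?b\<close> varies, and
    its block sum moves by \<open>u - s i\<close>.\<close>
  define h where "h u = (\<Sum>e\<in>E. c e * (A e * (falling (e ?b) (?m ?b) * (block_sum bs s ?b + (u - s i)) ^ (e ?b - ?m ?b))))" for u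
  have split: "(\<Prod>l\<in>{0..p}. g l) = (\<Prod>l\<in>{0..p} - {?b}. g l) * g ?b" for g :: "nat \<Rightarrow> real"
    using b by (subst prod.remove[of _ ?b]) auto
  have "partial_deriv i (foldr partial_deriv xs f) s =
     (\<Sum>e\<in>E. ?D e)"
  proof (rule partial_deriv_eqI)
    show "(h has_real_derivative (\<Sum>e\<in>E. ?D e)) (at (s i))"
      unfolding h_def by (auto intro!: derivative_eq_intros sum.cong)
    show "s i \<ge> 0" using Cons.prems i by auto
    fix u :: real assume u: "u \<ge> 0"
    have "foldr partial_deriv xs f (s(i := u)) = (\<Sum>e\<in>E. c e * (\<Prod>l\<in>{0..p}.
       falling (e l) (?m l) * block_sum bs (s(i := u)) l ^ (e l - ?m l)))"
      by (rule Cons.IH) (use Cons.prems u in auto)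
    also have "\<dots> = h u"
      unfolding h_def split A_def block_sum_upd[OF i] by simp
    finally show "foldr partial_deriv xs f (s(i := u)) = h u" .
  qed
  also have "\<dots> = (\<Sum>e\<in>E. c e * (\<Prod>l\<in>{0..p}.
     falling (e l) (multiplicity_in bs (i # xs) l) * block_sum bs s l ^ (e l - multiplicity_in bs (i # xs) l)))"
  proof (rule sum.cong[OF refl])
    fix e
    have "A e = (\<Prod>l\<in>{0..p} - {?b}. falling (e l) (multiplicity_in bs (i # xs) l) * block_sum bs s l ^ (e l - multiplicity_in bs (i # xs) l))"
      unfolding A_def by (rule prod.cong) (auto simp: multiplicity_in_def)
    moreover have "multiplicity_in bs (i # xs) ?b = Suc (?m ?b)" by (simp add: multiplicity_in_def)
    ultimately show "?D e =
      c e * (\<Prod>l\<in>{0..p}. falling (e l) (multiplicity_in bs (i # xs) l) * block_sum bs s l ^ (e l - multiplicity_in bs (i # xs) l))"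
      unfolding split by (simp add: falling_Suc mult_ac)
  qed
  finally show ?case by simp
qed

definition block_list :: "nat \<Rightarrow> (nat \<Rightarrow> nat) \<Rightarrow> nat list" where
  "block_list p e = concat (map (\<lambda>l. replicate (e l) l) [0..<Suc p])"

lemma set_block_list: "set (block_list p e) \<subseteq> {0..p}"
  unfolding block_list_def by (auto simp del: upt_Suc)

lemma length_block_list: "length (block_list p e) = sum e {0..p}"
  unfolding block_list_def by (induction p) simp_all

lemma multiplicity_in_block_list:
  assumes "l \<le> p"
  shows "multiplicity_in (block_list p e) [0..<length (block_list p e)] l = e l"
proof -
  have "multiplicity_in bs [0..<length bs] l = count_list bs l" for bs :: "nat list"
  proof -
    have "count_list bs l = length (filter ((=) l) (map ((!) bs) [0..<length bs]))"
      unfolding map_nth by (rule count_list_eq_length_filter)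
    also have "\<dots> = length (filter (\<lambda>i. l = bs ! i) [0..<length bs])"
      by (simp only: filter_map length_map comp_def)
    finally show ?thesis by (simp only: multiplicity_in_def eq_commute[of l])
  qed
  moreover have "count_list (concat (map (\<lambda>l. replicate (e l) l) [0..<q])) l = (if l < q then e l else 0)" for q
    by (induction q) (auto simp: count_list_eq_length_filter filter_replicate less_Suc_eq)
  ultimately show ?thesis using assms unfolding block_list_def by (simp del: upt_Suc)
qed

text \<open>At the origin a monomial with exponents \<open>d\<close> contributes only for
  \<open>d = e\<close>: a smaller exponent is differentiated away, a larger one leaves a power of 0.
  For \<open>d = e\<close> the convention 0^0 = 1 leaves the product of the factorials.\<close>

lemma mixed_volume_parts:
  fixes K :: "(real^'n) set"
  assumes K: "compact K" "convex K" "K \<noteq> {}"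
    and c: "\<And>t. (\<forall>l\<in>{0..p}. t l \<ge> 0) \<Longrightarrow> diff_volume p K t = (\<Sum>e\<in>exponents CARD('n) p. c e * (\<Prod>l\<in>{0..p}. t l ^ e l))"
    and e: "e \<in> exponents CARD('n) p"
  shows "mixed_volume p (map (part p K) (block_list p e)) = c e * (\<Prod>l\<in>{0..p}. fact (e l)) / fact (CARD('n) * p)"
proof -
  let ?bs = "block_list p e" and ?N = "CARD('n) * p"
  let ?T = "\<lambda>d. \<Prod>l\<in>{0..p}. falling (d l) (multiplicity_in ?bs [0..<?N] l) * block_sum ?bs (\<lambda>_. 0) l ^ (d l - multiplicity_in ?bs [0..<?N] l)"
  have len: "length ?bs = ?N" using e by (simp add: length_block_list exponents_def)
  have f: "power_volume p (minkowski_comb p s (map (part p K) ?bs)) =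
     (\<Sum>e\<in>exponents CARD('n) p. c e * (\<Prod>l\<in>{0..p}. block_sum ?bs s l ^ e l))"
    if "\<And>i. i < length ?bs \<Longrightarrow> s i \<ge> 0" for s
  proof -
    have "block_sum ?bs s l \<ge> 0" for l unfolding block_sum_def by (rule sum_nonneg) (use that in auto)
    then show ?thesis
      using that K by (simp add: minkowski_comb_parts[OF K(2,3) set_block_list] power_volume_comb_body c)
  qed
  have mult: "multiplicity_in ?bs [0..<?N] l = e l" if "l \<in> {0..p}" for l
    using multiplicity_in_block_list[of l p e] that len by simp
  have "foldr partial_deriv [0..<?N] (\<lambda>s. power_volume p (minkowski_comb p s (map (part p K) ?bs))) (\<lambda>_. 0)
     = (\<Sum>d\<in>exponents CARD('n) p. c d * ?T d)"
    by (rule foldr_partial_deriv[OF set_block_list f]) (use len in auto)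
  also have "\<dots> = (\<Sum>d\<in>exponents CARD('n) p. if d = e then c e * (\<Prod>l\<in>{0..p}. fact (e l)) else 0)"
  proof (rule sum.cong[OF refl])
    fix d assume d: "d \<in> exponents CARD('n) p"
    have m: "?T d
      = (\<Prod>l\<in>{0..p}. falling (d l) (e l) * 0 ^ (d l - e l))"
      by (rule prod.cong) (auto simp: mult block_sum_def)
    show "c d * ?T d
      = (if d = e then c e * (\<Prod>l\<in>{0..p}. fact (e l)) else 0)"
    proof (cases "d = e")
      case True
      then show ?thesis unfolding m by (simp add: falling_self)
    next
      case False
      \<comment> \<open>Both vectors have the same total, so if they differ, some entry of
        \<open>d\<close> is smaller than that of \<open>e\<close>.\<close>
      obtain l where "l \<in> {0..p}" "d l < e l"
      proof (rule ccontr)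
        assume "\<not> thesis"
        with that have ge: "\<forall>l\<in>{0..p}. e l \<le> d l" by force
        have "sum e {0..p} = sum d {0..p}" using d e by (simp add: exponents_def)
        then have "\<forall>l\<in>{0..p}. e l = d l"
          using sum_mono_inv[of e "{0..p}" d] ge by auto
        then have "d = e" using d e unfolding exponents_def by (intro PiE_ext[of d "{0..p}" "\<lambda>_. {..CARD('n)}" e]) auto
        then show False using False by simp
      qed
      then have "(\<Prod>l\<in>{0..p}. falling (d l) (e l) * 0 ^ (d l - e l)) = 0"
        by (intro prod_zero bexI[of _ l]) (simp_all add: falling_eq_0)
      then show ?thesis unfolding m using False by simp
    qed
  qed
  also have "\<dots> = c e * (\<Prod>l\<in>{0..p}. fact (e l))"
    using e finite_exponents by simp
  finally show ?thesis by (simp add: mixed_volume_def len)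
qed

lemma W_eq_mixed_volume:
  fixes K :: "(real^'n) set"
  shows "W p K j = mixed_volume p (map (part p K) (block_list p (\<lambda>l\<in>{0..p}. CARD('n) - j l)))"
proof -
  have 1: "[0..<Suc p] = 0 # [1..<Suc p]" by (simp add: upt_conv_Cons del: upt_Suc)
  have "map (part p K) (block_list p (\<lambda>l\<in>{0..p}. CARD('n) - j l)) =
    replicate (CARD('n) - j 0) (part p K 0) @
    concat (map (\<lambda>i. replicate (restrict (\<lambda>l. CARD('n) - j l) {0..p} i) (part p K i)) [1..<Suc p])"
    unfolding block_list_def 1 by (simp add: map_concat comp_def del: upt_Suc)
  also have "map (\<lambda>i. replicate (restrict (\<lambda>l. CARD('n) - j l) {0..p} i) (part p K i)) [1..<Suc p]
    = map (\<lambda>i. replicate (CARD('n) - j i) (incl p i ` K)) [1..<Suc p]"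
    by (rule map_cong) (auto simp: part_def simp del: upt_Suc)
  finally have eq: "map (part p K) (block_list p (\<lambda>l\<in>{0..p}. CARD('n) - j l)) =
    replicate (CARD('n) - j 0) (part p K 0) @
    concat (map (\<lambda>i. replicate (CARD('n) - j i) (incl p i ` K)) [1..<Suc p])" .
  have "part p K 0 = power_neg p (diag p ` K)" by (simp add: part_def)
  then show ?thesis unfolding W_def eq by (simp only:)
qed

text \<open>The involution j -> n - j matches multi-indices with exponents. The right-hand side
  multiplies each monomial of the volume polynomial by the factorials of its exponents, which is the
  effect of integrating against exponential weights.\<close>

lemma sum_monomial_W:
  fixes K :: "(real^'n) set"
  assumes K: "compact K" "convex K" "K \<noteq> {}"
    and c: "\<And>t. (\<forall>l\<in>{0..p}. t l \<ge> 0) \<Longrightarrow> diff_volume p K t = (\<Sum>e\<in>exponents CARD('n) p. c e * (\<Prod>l\<in>{0..p}. t l ^ e l))"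
  shows "(\<Sum>j\<in>multi_indices CARD('n) p. monomial CARD('n) p t j * W p K j) =
     (\<Sum>e\<in>exponents CARD('n) p. c e * (\<Prod>l\<in>{0..p}. fact (e l)) * (\<Prod>l\<in>{0..p}. t l ^ e l)) / fact (CARD('n) * p)"
proof -
  let ?n = "CARD('n)" and ?\<phi> = "\<lambda>j. \<lambda>l\<in>{0..p}. CARD('n) - j l"
  have le: "j l \<le> ?n" if "j \<in> multi_indices ?n p" "l \<in> {0..p}" for j l
    using that member_le_sum[of l "{0..p}" j] by (auto simp: multi_indices_def)
  have "(\<Sum>j\<in>multi_indices ?n p. monomial ?n p t j * W p K j) =
    (\<Sum>e\<in>exponents ?n p. c e * (\<Prod>l\<in>{0..p}. fact (e l)) * (\<Prod>l\<in>{0..p}. t l ^ e l) / fact (?n * p))"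
  proof (rule sum.reindex_bij_witness[of _ ?\<phi> ?\<phi>])
    fix j assume j: "j \<in> multi_indices ?n p"
    show "?\<phi> (?\<phi> j) = j"
    proof
      fix l show "?\<phi> (?\<phi> j) l = j l"
        using le[OF j, of l] j PiE_arb[of j "{0..p}" "\<lambda>_. UNIV" l] by (auto simp: multi_indices_def)
    qed
    have "(\<Sum>l\<in>{0..p}. ?n - j l) = ?n * p"
    proof -
      have "(\<Sum>l\<in>{0..p}. ?n - j l) = (\<Sum>l\<in>{0..p}. ?n) - (\<Sum>l\<in>{0..p}. j l)"
        by (rule sum_subtractf_nat) (use le[OF j] in auto)
      then show ?thesis using j by (simp add: multi_indices_def)
    qed
    then show e: "?\<phi> j \<in> exponents ?n p" by (simp add: exponents_def)
    show "c (?\<phi> j) * (\<Prod>l\<in>{0..p}. fact (?\<phi> j l)) * (\<Prod>l\<in>{0..p}. t l ^ ?\<phi> j l) / fact (?n * p) = monomial ?n p t j * W p K j"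
    proof -
      have "W p K j = c (?\<phi> j) * (\<Prod>l\<in>{0..p}. fact (?\<phi> j l)) / fact (?n * p)"
        unfolding W_eq_mixed_volume by (rule mixed_volume_parts[OF K c e])
      then show ?thesis by (simp add: monomial_def)
    qed
  next
    fix e assume e: "e \<in> exponents ?n p"
    have le': "e l \<le> ?n" if "l \<in> {0..p}" for l using e that by (auto simp: exponents_def)
    show "?\<phi> (?\<phi> e) = e"
    proof
      fix l show "?\<phi> (?\<phi> e) l = e l"
        using le'[of l] e PiE_arb[of e "{0..p}" "\<lambda>_. {..?n}" l] by (auto simp: exponents_def)
    qed
    have "(\<Sum>l\<in>{0..p}. ?n - e l) = (\<Sum>l\<in>{0..p}. ?n) - (\<Sum>l\<in>{0..p}. e l)"
      by (rule sum_subtractf_nat) (use le' in auto)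
    then show "?\<phi> e \<in> multi_indices ?n p" using e by (simp add: exponents_def multi_indices_def)
  qed
  then show ?thesis by (simp add: sum_divide_distrib)
qed

section \<open>Laplace transforms\<close>

lemma nn_integral_exp_atLeast:
  assumes "a > 0"
  shows "(\<integral>\<^sup>+x. ennreal (exp (- (a * x))) * indicator {u..} x \<partial>lborel) = ennreal (exp (- (a * u)) / a)"
proof -
  have "(\<integral>\<^sup>+x. ennreal (exp (- (a * x))) * indicator {u..} x \<partial>lborel) = ennreal (0 - (- exp (- (a * u)) / a))"
  proof (rule nn_integral_FTC_atLeast)
    show "((\<lambda>x. - exp (- (a * x)) / a) has_real_derivative exp (- (a * x))) (at x)" for x
      using assms by (auto intro!: derivative_eq_intros)
    show "((\<lambda>x. - exp (- (a * x)) / a) \<longlongrightarrow> 0) at_top"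
      using assms by real_asymp
  qed auto
  then show ?thesis by simp
qed

text \<open>The standard exponential distribution. Being a probability measure with k-th moment k!,
  it both produces the required factorials and guarantees that events of full measure are
  nonempty.\<close>

definition exp_measure :: "real measure" where
  "exp_measure = density lborel (\<lambda>x. ennreal (exp (- x)) * indicator {0..} x)"

lemma sets_exp_measure [simp, measurable_cong]: "sets exp_measure = sets borel"
  by (simp add: exp_measure_def)

lemma space_exp_measure [simp]: "space exp_measure = UNIV"
  by (simp add: exp_measure_def)

lemma nn_integral_exp_measure:
  "f \<in> borel_measurable borel \<Longrightarrow> (\<integral>\<^sup>+x. f x \<partial>exp_measure) = (\<integral>\<^sup>+x. ennreal (exp (- x)) * indicator {0..} x * f x \<partial>lborel)"
  unfolding exp_measure_def by (rule nn_integral_density) auto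

lemma nn_integral_power_exp_measure: "(\<integral>\<^sup>+x. ennreal (x ^ k) \<partial>exp_measure) = ennreal (fact k)"
proof -
  have "(\<integral>\<^sup>+x. ennreal (x ^ k) \<partial>exp_measure) = (\<integral>\<^sup>+x. ennreal (x ^ k * exp (- x)) * indicator {0..} x \<partial>lborel)"
    by (subst nn_integral_exp_measure)
      (auto intro!: nn_integral_cong simp: indicator_def ennreal_mult' mult.commute)
  then show ?thesis by (simp add: nn_intergal_power_times_exp_Ici)
qed

lemma prob_space_exp_measure: "prob_space exp_measure"
proof
  have "emeasure exp_measure (space exp_measure) = (\<integral>\<^sup>+x. ennreal (x ^ 0) \<partial>exp_measure)"
    by (simp del: space_exp_measure)
  then show "emeasure exp_measure (space exp_measure) = 1"
    by (simp only: nn_integral_power_exp_measure) simp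
qed

lemma AE_exp_measure_pos: "AE x in exp_measure. x > 0"
proof -
  have "AE x in lborel. x \<noteq> (0 :: real)" by (rule AE_lborel_singleton)
  then have "AE x in lborel. 0 < ennreal (exp (- x)) * indicator {0..} x \<longrightarrow> x > 0"
    by eventually_elim (auto simp: indicator_def)
  then show ?thesis unfolding exp_measure_def by (subst AE_density) auto
qed

lemma exp_measure_power:
  shows "integrable exp_measure (\<lambda>x. x ^ k)" and "(\<integral>x. x ^ k \<partial>exp_measure) = fact k"
proof -
  have "has_bochner_integral exp_measure (\<lambda>x. x ^ k) (fact k)"
  proof (rule has_bochner_integral_nn_integral)
    show "AE x in exp_measure. 0 \<le> x ^ k"
      using AE_exp_measure_pos by eventually_elim simp
  qed (auto simp: nn_integral_power_exp_measure)
  then show "integrable exp_measure (\<lambda>x. x ^ k)" "(\<integral>x. x ^ k \<partial>exp_measure) = fact k"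
    by (auto simp: has_bochner_integral_iff)
qed

lemma nn_integral_exp_measure_atLeast:
  assumes "u \<ge> 0"
  shows "(\<integral>\<^sup>+x. indicator {u..} x \<partial>exp_measure) = ennreal (exp (- u))"
proof -
  have "(\<integral>\<^sup>+x. indicator {u..} x \<partial>exp_measure) = (\<integral>\<^sup>+x. ennreal (exp (- (1 * x))) * indicator {u..} x \<partial>lborel)"
    using assms by (subst nn_integral_exp_measure) (auto intro!: nn_integral_cong simp: indicator_def)
  then show ?thesis using nn_integral_exp_atLeast[of 1 u] by simp
qed

definition laplace_measure :: "nat \<Rightarrow> (nat \<Rightarrow> real) measure" where
  "laplace_measure p = Pi\<^sub>M {0..p} (\<lambda>_. exp_measure)"

lemma prob_space_laplace_measure: "prob_space (laplace_measure p)"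
  unfolding laplace_measure_def by (intro prob_space_PiM prob_space_exp_measure)

lemma product_sigma_finite_exp_measure: "product_sigma_finite (\<lambda>_. exp_measure)"
  using prob_space_exp_measure
  by (simp add: product_sigma_finite_def prob_space_def finite_measure_def)

lemma AE_laplace_measure_pos: "AE x in laplace_measure p. \<forall>l\<in>{0..p}. x l > 0"
proof -
  have "AE x in laplace_measure p. x l > 0" if "l \<in> {0..p}" for l
    unfolding laplace_measure_def
    by (rule AE_PiM_component[OF prob_space_exp_measure that AE_exp_measure_pos])
  then show ?thesis by (simp add: AE_finite_all)
qed

lemma laplace_of_polynomial:
  fixes t :: "nat \<Rightarrow> real"
  shows "has_bochner_integral (laplace_measure p) (\<lambda>x. \<Sum>e\<in>E. c e * (\<Prod>l\<in>{0..p}. (x l * t l) ^ e l))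
      (\<Sum>e\<in>E. c e * (\<Prod>l\<in>{0..p}. fact (e l)) * (\<Prod>l\<in>{0..p}. t l ^ e l))"
proof -
  interpret product_sigma_finite "\<lambda>_::nat. exp_measure" by (rule product_sigma_finite_exp_measure)
  have mono: "has_bochner_integral (laplace_measure p) (\<lambda>x. \<Prod>l\<in>{0..p}. x l ^ e l) (\<Prod>l\<in>{0..p}. fact (e l))" for e :: "nat \<Rightarrow> nat"
    unfolding laplace_measure_def
    using product_integrable_prod[of "{0..p}" "\<lambda>l x. x ^ e l"] product_integral_prod[of "{0..p}" "\<lambda>l x. x ^ e l"]
    by (simp add: exp_measure_power has_bochner_integral_iff)
  have "has_bochner_integral (laplace_measure p)
      (\<lambda>x. \<Sum>e\<in>E. c e * (\<Prod>l\<in>{0..p}. t l ^ e l) * (\<Prod>l\<in>{0..p}. x l ^ e l))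
      (\<Sum>e\<in>E. c e * (\<Prod>l\<in>{0..p}. t l ^ e l) * (\<Prod>l\<in>{0..p}. fact (e l)))"
    by (intro has_bochner_integral_sum has_bochner_integral_mult_right mono)
  then show ?thesis by (simp add: power_mult_distrib prod.distrib mult_ac)
qed

text \<open>Induction over \<open>A\<close> with the binomial theorem. The separate bound
  \<open>N\<close> keeps the index set fixed while the exponent drops from \<open>n\<close> to
  \<open>n - m\<close>.\<close>

lemma multinomial_sum:
  fixes y :: "'i \<Rightarrow> real"
  assumes "finite A" "n \<le> N"
  shows "(\<Sum>i\<in>A. y i) ^ n / fact n =
    (\<Sum>j\<in>A \<rightarrow>\<^sub>E {..N}. if sum j A = n then \<Prod>i\<in>A. y i ^ j i / fact (j i) else 0)"
  using assms
proof (induction A arbitrary: n rule: finite_induct)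
  case empty
  then show ?case by (cases n) auto
next
  case (insert l A)
  let ?t = "\<lambda>j. \<Prod>i\<in>A. y i ^ j i / fact (j i)"
  have "(\<Sum>j\<in>insert l A \<rightarrow>\<^sub>E {..N}. if sum j (insert l A) = n then \<Prod>i\<in>insert l A. y i ^ j i / fact (j i) else 0)
     = (\<Sum>m\<le>N. \<Sum>j\<in>A \<rightarrow>\<^sub>E {..N}. if m + sum j A = n then y l ^ m / fact m * ?t j else 0)"
    unfolding sum_PiE_insert[OF insert.hyps(2,1)]
  proof (intro sum.cong refl)
    fix m j
    have "sum (j(l := m)) A = sum j A" "(\<Prod>i\<in>A. y i ^ (j(l := m)) i / fact ((j(l := m)) i)) = ?t j"
      using insert.hyps by (auto intro!: sum.cong prod.cong)
    then show "(if sum (j(l := m)) (insert l A) = n then \<Prod>i\<in>insert l A. y i ^ (j(l := m)) i / fact ((j(l := m)) i) else 0)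
      = (if m + sum j A = n then y l ^ m / fact m * ?t j else 0)"
      using insert.hyps by simp
  qed
  also have "\<dots> = (\<Sum>m\<le>N. if m \<le> n then y l ^ m / fact m * ((\<Sum>i\<in>A. y i) ^ (n - m) / fact (n - m)) else 0)"
  proof (intro sum.cong refl)
    fix m
    show "(\<Sum>j\<in>A \<rightarrow>\<^sub>E {..N}. if m + sum j A = n then y l ^ m / fact m * ?t j else 0)
      = (if m \<le> n then y l ^ m / fact m * ((\<Sum>i\<in>A. y i) ^ (n - m) / fact (n - m)) else 0)"
    proof (cases "m \<le> n")
      case True
      then have iff: "m + k = n \<longleftrightarrow> k = n - m" for k by auto
      have "n - m \<le> N" using insert.prems by simp
      then show ?thesis
        using True unfolding iff by (simp add: insert.IH sum_distrib_left if_distrib cong: if_cong)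
    qed simp
  qed
  also have "\<dots> = (\<Sum>m\<le>n. y l ^ m / fact m * ((\<Sum>i\<in>A. y i) ^ (n - m) / fact (n - m)))"
    using insert.prems by (intro sum.mono_neutral_cong_right) auto
  also have "\<dots> = (\<Sum>m\<le>n. real (n choose m) * y l ^ m * (\<Sum>i\<in>A. y i) ^ (n - m)) / fact n"
    unfolding sum_divide_distrib
    by (intro sum.cong refl) (simp add: binomial_fact)
  also have "\<dots> = (y l + (\<Sum>i\<in>A. y i)) ^ n / fact n"
    by (simp add: binomial_ring)
  finally show ?case using insert.hyps by simp
qed

text \<open>The multinomial theorem for y_c = prod_{l /= c} t_l. The variable t_l occurs in every
  y_c except y_l, so its exponent is the sum of the j_c with c /= l, that is n - j_l.\<close>

lemma sum_multinomial_monomial: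
  fixes t :: "nat \<Rightarrow> real"
  shows "(\<Sum>j\<in>multi_indices n p. multinomial n p j * monomial n p t j)
     = (\<Sum>c\<in>{0..p}. \<Prod>l\<in>{0..p} - {c}. t l) ^ n"
proof -
  let ?y = "\<lambda>c. \<Prod>l\<in>{0..p} - {c}. t l"
  have mi: "multi_indices n p = {j \<in> {0..p} \<rightarrow>\<^sub>E {..n}. sum j {0..p} = n}"
  proof (intro equalityI subsetI)
    fix j assume j: "j \<in> multi_indices n p"
    then have "j l \<le> n" if "l \<in> {0..p}" for l
      using that member_le_sum[of l "{0..p}" j] by (auto simp: multi_indices_def)
    then show "j \<in> {j \<in> {0..p} \<rightarrow>\<^sub>E {..n}. sum j {0..p} = n}"
      using j by (auto simp: multi_indices_def PiE_iff)
  qed (auto simp: multi_indices_def)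
  have "(\<Sum>c\<in>{0..p}. ?y c) ^ n = fact n * ((\<Sum>c\<in>{0..p}. ?y c) ^ n / fact n)" by simp
  also have "\<dots> = fact n * (\<Sum>j\<in>multi_indices n p. \<Prod>c\<in>{0..p}. ?y c ^ j c / fact (j c))"
    unfolding mi multinomial_sum[OF finite_atLeastAtMost order_refl]
    by (subst sum.inter_filter[symmetric]) (auto intro!: finite_PiE)
  also have "\<dots> = (\<Sum>j\<in>multi_indices n p. multinomial n p j * monomial n p t j)"
    unfolding sum_distrib_left
  proof (intro sum.cong refl)
    fix j assume "j \<in> multi_indices n p"
    then have sj: "sum j {0..p} = n" by (simp add: multi_indices_def)
    have "(\<Prod>c\<in>{0..p}. ?y c ^ j c) = (\<Prod>c\<in>{0..p}. \<Prod>l\<in>{0..p}. if l \<noteq> c then t l ^ j c else 1)"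
    proof (intro prod.cong refl)
      fix c assume "c \<in> {0..p}"
      have "{0..p} - {c} = {l \<in> {0..p}. l \<noteq> c}" by auto
      then show "?y c ^ j c = (\<Prod>l\<in>{0..p}. if l \<noteq> c then t l ^ j c else 1)"
        by (simp only: prod_power_distrib[symmetric] prod.inter_filter[symmetric] finite_atLeastAtMost)
    qed
    also have "\<dots> = (\<Prod>l\<in>{0..p}. \<Prod>c\<in>{0..p}. if l \<noteq> c then t l ^ j c else 1)" by (rule prod.swap)
    also have "\<dots> = (\<Prod>l\<in>{0..p}. t l ^ (n - j l))"
    proof (intro prod.cong refl)
      fix l assume l: "l \<in> {0..p}"
      have "{c \<in> {0..p}. l \<noteq> c} = {0..p} - {l}" by auto
      then have "(\<Prod>c\<in>{0..p}. if l \<noteq> c then t l ^ j c else 1) = t l ^ (\<Sum>c\<in>{0..p} - {l}. j c)"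
        by (simp only: power_sum prod.inter_filter[symmetric] finite_atLeastAtMost)
      moreover have "sum j ({0..p} - {l}) = n - j l"
        using l sj by (simp add: sum.remove[of "{0..p}" l])
      ultimately show "(\<Prod>c\<in>{0..p}. if l \<noteq> c then t l ^ j c else 1) = t l ^ (n - j l)" by simp
    qed
    finally show "fact n * (\<Prod>c\<in>{0..p}. ?y c ^ j c / fact (j c)) = multinomial n p j * monomial n p t j"
      by (simp add: multinomial_def monomial_def prod_dividef)
  qed
  finally show ?thesis by simp
qed


section \<open>The Laplace transform of the difference volume of the standard simplex\<close>

definition std_simplex_body :: "(real^'n) set" where
  "std_simplex_body = {y. (\<forall>k. 0 \<le> y $ k) \<and> (\<Sum>k\<in>UNIV. y $ k) \<le> 1}"

lemma std_simplex_body_eq: "(std_simplex_body :: (real^'n) set) = convex hull (insert 0 Basis)"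
proof -
  have "sum ((\<bullet>) x) (Basis :: (real^'n) set) = (\<Sum>k\<in>UNIV. x $ k)" for x :: "real^'n"
    unfolding Basis_real_vec by (subst sum.reindex) (simp_all add: inj_on_def axis_eq_axis inner_axis)
  moreover have "(\<forall>i\<in>Basis. 0 \<le> x \<bullet> i) \<longleftrightarrow> (\<forall>k. 0 \<le> x $ k)" for x :: "real^'n"
    unfolding Basis_real_vec by (simp add: inner_axis)
  ultimately show ?thesis unfolding std_simplex_body_def std_simplex by simp
qed

lemma compact_std_simplex_body: "compact (std_simplex_body :: (real^'n) set)"
  and convex_std_simplex_body: "convex (std_simplex_body :: (real^'n) set)"
  and std_simplex_body_nonempty: "(std_simplex_body :: (real^'n) set) \<noteq> {}"
  unfolding std_simplex_body_eq
  by (auto intro!: finite_imp_compact_convex_hull)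

lemma scaled_std_simplex_body:
  assumes "u > 0"
  shows "y \<in> (*\<^sub>R) u ` std_simplex_body \<longleftrightarrow> (\<forall>k. 0 \<le> y $ k) \<and> (\<Sum>k\<in>UNIV. y $ k) \<le> u"
proof -
  have "y \<in> (*\<^sub>R) u ` std_simplex_body \<longleftrightarrow> (1 / u) *\<^sub>R y \<in> std_simplex_body"
  proof
    assume "(1 / u) *\<^sub>R y \<in> std_simplex_body"
    then have "u *\<^sub>R ((1 / u) *\<^sub>R y) \<in> (*\<^sub>R) u ` std_simplex_body" by (rule imageI)
    then show "y \<in> (*\<^sub>R) u ` std_simplex_body" using assms by simp
  qed (use assms in auto)
  then show ?thesis
    using assms by (simp add: std_simplex_body_def sum_divide_distrib[symmetric] divide_le_eq zero_le_divide_iff)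
qed

definition max_coord :: "nat \<Rightarrow> (nat \<Rightarrow> real^'n) \<Rightarrow> 'n \<Rightarrow> real" where
  "max_coord p a k = Max ((\<lambda>l. - a l $ k) ` {0..p})"

text \<open>The least dilation factor for which the \<open>l\<close>-th shifted simplex reaches the
  point with coordinates \<open>max_coord\<close>.\<close>

definition excess :: "nat \<Rightarrow> (nat \<Rightarrow> real^'n) \<Rightarrow> nat \<Rightarrow> real" where
  "excess p a l = (\<Sum>k\<in>UNIV. max_coord p a k + a l $ k)"

lemma max_coord_le_iff: "max_coord p a k \<le> r \<longleftrightarrow> (\<forall>l\<in>{0..p}. - a l $ k \<le> r)"
  unfolding max_coord_def by (subst Max_le_iff) auto

lemma max_coord_ge: "l \<le> p \<Longrightarrow> - a l $ k \<le> max_coord p a k"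
  using max_coord_le_iff[of p a k "max_coord p a k"] by auto

lemma excess_nonneg:
  assumes "l \<le> p" shows "excess p a l \<ge> 0"
  unfolding excess_def
proof (rule sum_nonneg)
  fix k show "0 \<le> max_coord p a k + a l $ k" using max_coord_ge[OF assms, of a k] by linarith
qed

text \<open>Homothets of the standard simplex intersect iff the coordinatewise largest of their corners lies in all of them.\<close>

lemma common_point_std_simplex:
  fixes a :: "nat \<Rightarrow> real^'n"
  assumes "\<And>l. l \<le> p \<Longrightarrow> u l > 0"
  shows "common_point {0..p} (\<lambda>l. (*\<^sub>R) (u l) ` std_simplex_body) a \<longleftrightarrow> (\<forall>l\<in>{0..p}. excess p a l \<le> u l)"
proof
  assume "common_point {0..p} (\<lambda>l. (*\<^sub>R) (u l) ` std_simplex_body) a"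
  then obtain x where x: "\<And>l. l \<in> {0..p} \<Longrightarrow> x + a l \<in> (*\<^sub>R) (u l) ` std_simplex_body"
    unfolding common_point_def by blast
  have x': "0 \<le> (x + a l) $ k" "(\<Sum>k\<in>UNIV. (x + a l) $ k) \<le> u l" if "l \<in> {0..p}" for l k
    using x[OF that] scaled_std_simplex_body[of "u l" "x + a l"] assms[of l] that by auto
  have "- a l $ k \<le> x $ k" if "l \<in> {0..p}" for l k using x'(1)[OF that, of k] by simp
  then have m: "max_coord p a k \<le> x $ k" for k unfolding max_coord_le_iff by blast
  show "\<forall>l\<in>{0..p}. excess p a l \<le> u l"
  proof
    fix l assume l: "l \<in> {0..p}"
    have "excess p a l \<le> (\<Sum>k\<in>UNIV. (x + a l) $ k)"
      unfolding excess_def by (rule sum_mono) (simp add: m)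
    then show "excess p a l \<le> u l" using x'(2)[OF l] by simp
  qed
next
  assume e: "\<forall>l\<in>{0..p}. excess p a l \<le> u l"
  let ?x = "\<chi> k. max_coord p a k"
  have "?x + a l \<in> (*\<^sub>R) (u l) ` std_simplex_body" if l: "l \<in> {0..p}" for l
  proof -
    have "0 \<le> (?x + a l) $ k" for k
    proof -
      have "- a l $ k \<le> max_coord p a k" using max_coord_ge l by simp
      then have "0 \<le> max_coord p a k + a l $ k" by linarith
      then show ?thesis by simp
    qed
    moreover have "(\<Sum>k\<in>UNIV. (?x + a l) $ k) = excess p a l" by (simp add: excess_def)
    ultimately show ?thesis using scaled_std_simplex_body[of "u l" "?x + a l"] assms[of l] e l by simp
  qed
  then show "common_point {0..p} (\<lambda>l. (*\<^sub>R) (u l) ` std_simplex_body) a"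
    unfolding common_point_def by blast
qed

lemma nn_integral_prod_coords:
  fixes f :: "'n::finite \<Rightarrow> real \<Rightarrow> ennreal"
  assumes "\<And>k. f k \<in> borel_measurable borel"
  shows "(\<integral>\<^sup>+y. (\<Prod>k\<in>UNIV. f k (y $ k)) \<partial>(lborel :: (real^'n) measure)) = (\<Prod>k\<in>UNIV. \<integral>\<^sup>+x. f k x \<partial>lborel)"
proof -
  let ?ax = "\<lambda>k::'n. axis k (1::real)"
  have inv: "inv ?ax (?ax k) = k" for k by (rule inv_f_f) (simp add: inj_on_def axis_eq_axis)
  have "(\<integral>\<^sup>+y. (\<Prod>b\<in>Basis. f (inv ?ax b) (y \<bullet> b)) \<partial>(lborel :: (real^'n) measure))
     = (\<Prod>b\<in>(Basis :: (real^'n) set). \<integral>\<^sup>+x. f (inv ?ax b) x \<partial>lborel)"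
    by (rule nn_integral_lborel_prod) (auto simp: assms)
  then show ?thesis by (simp add: prod_Basis_vec inv inner_axis)
qed


lemma prod_indicator_atLeast:
  assumes "finite A"
  shows "(\<Prod>l\<in>A. indicator {c l..} (x l) :: ennreal) = (if \<forall>l\<in>A. c l \<le> x l then 1 else 0)"
proof (cases "\<forall>l\<in>A. c l \<le> x l")
  case True
  then show ?thesis by simp
next
  case False
  then obtain l where "l \<in> A" "\<not> c l \<le> x l" by blast
  then have "(\<Prod>l\<in>A. indicator {c l..} (x l) :: ennreal) = 0"
    using assms by (intro prod_zero bexI[of _ l]) auto
  then show ?thesis using False by simp
qed

text \<open>The intersection condition splits into one threshold for each \<open>x l\<close>, so the
  exponential weights can be integrated out separately.\<close>

lemma hit_volume_std_simplex:
  fixes t :: "nat \<Rightarrow> real"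
  assumes t: "\<And>l. l \<le> p \<Longrightarrow> t l > 0" and x: "\<forall>l\<in>{0..p}. x l > 0"
  shows "hit_volume {0..p} (\<lambda>l. (*\<^sub>R) (x l * t l) ` (std_simplex_body :: (real^'n) set)) 0
    = (\<integral>\<^sup>+a. (\<Prod>l\<in>{0..p}. indicator {excess p (a(0 := 0)) l / t l..} (x l)) \<partial>Pi\<^sub>M {1..p} (\<lambda>_. lborel :: (real^'n) measure))"
proof -
  have I: "{0..p} - {0} = {1..p}" by auto
  have "indicator {a. common_point {0..p} (\<lambda>l. (*\<^sub>R) (x l * t l) ` (std_simplex_body :: (real^'n) set)) a} b
     = (\<Prod>l\<in>{0..p}. indicator {excess p b l / t l..} (x l) :: ennreal)" for b
  proof -
    have "common_point {0..p} (\<lambda>l. (*\<^sub>R) (x l * t l) ` (std_simplex_body :: (real^'n) set)) b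
       \<longleftrightarrow> (\<forall>l\<in>{0..p}. excess p b l \<le> x l * t l)"
      by (rule common_point_std_simplex) (use t x in auto)
    also have "\<dots> \<longleftrightarrow> (\<forall>l\<in>{0..p}. excess p b l / t l \<le> x l)"
      by (rule ball_cong) (use t in \<open>auto simp: pos_divide_le_eq\<close>)
    finally show ?thesis by (simp add: prod_indicator_atLeast indicator_def)
  qed
  then show ?thesis unfolding hit_volume_def I by simp
qed

lemma measurable_excess [measurable]:
  assumes "l \<le> p"
  shows "(\<lambda>a. excess p (a(0 := 0)) l) \<in> borel_measurable (Pi\<^sub>M {1..p} (\<lambda>_. lborel :: (real^'n) measure))"
proof -
  have c: "(\<lambda>a. (a(0 := 0)) i $ k) \<in> borel_measurable (Pi\<^sub>M {1..p} (\<lambda>_. lborel :: (real^'n) measure))" if "i \<le> p" for i k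
  proof (cases "i = 0")
    case False
    then have "(\<lambda>a. a i) \<in> measurable (Pi\<^sub>M {1..p} (\<lambda>_. lborel :: (real^'n) measure)) lborel"
      using that by (intro measurable_component_singleton) auto
    then have "(\<lambda>a. a i $ k) \<in> borel_measurable (Pi\<^sub>M {1..p} (\<lambda>_. lborel :: (real^'n) measure))"
      by (rule measurable_compose) (auto intro!: borel_measurable_continuous_onI continuous_intros)
    then show ?thesis using False by simp
  qed simp
  show ?thesis
    unfolding excess_def max_coord_def
    by (intro borel_measurable_sum borel_measurable_add borel_measurable_Max borel_measurable_uminus c) (use assms in auto)
qed

text \<open>Integrating out \<open>x\<close> leaves the exponential of minus the sum of excess_l /
  t_l, in which each maximum m_k has the coefficient s = sum 1/t_l. The maximum couples the shifts;
  replacing exp(-s m_k) by the integral of s exp(-s r) over r >= m_k decouples them, since r >= m_k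
  is a conjunction of conditions on single shifts. After interchanging integrals, each coordinate
  contributes s times the product of all t_l, which is the sum over c of prod_{l /= c} t_l.\<close>

lemma laplace_std_simplex:
  fixes t :: "nat \<Rightarrow> real"
  assumes t: "\<And>l. l \<le> p \<Longrightarrow> t l > 0"
  shows "(\<integral>\<^sup>+x. hit_volume {0..p} (\<lambda>l. (*\<^sub>R) (x l * t l) ` (std_simplex_body :: (real^'n) set)) 0 \<partial>laplace_measure p)
     = ennreal ((\<Sum>c\<in>{0..p}. \<Prod>l\<in>{0..p} - {c}. t l) ^ CARD('n))"
proof -
  define M where "M = Pi\<^sub>M {1..p} (\<lambda>_. lborel :: (real^'n) measure)"
  define s where "s = (\<Sum>l\<in>{0..p}. 1 / t l)"
  have s: "s > 0" unfolding s_def by (rule sum_pos) (use t in auto)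
  interpret PL: product_sigma_finite "\<lambda>_::nat. lborel :: (real^'n) measure" by (rule product_sigma_finite_lborel)
  interpret PE: product_sigma_finite "\<lambda>_::nat. exp_measure" by (rule product_sigma_finite_exp_measure)
  interpret sM: sigma_finite_measure M unfolding M_def by (rule PL.sigma_finite) simp
  interpret L: prob_space "laplace_measure p" by (rule prob_space_laplace_measure)
  interpret P1: pair_sigma_finite "laplace_measure p" M by standard
  interpret P2: pair_sigma_finite "lborel :: (real^'n) measure" M by standard
  have I: "{0..p} = insert 0 {1..p}" by auto
  let ?A = "\<lambda>\<rho> :: real^'n. \<Prod>k\<in>UNIV. ennreal s * (ennreal (exp (- (s * \<rho> $ k))) * indicator {0..} (\<rho> $ k))"
  let ?vol = "lborel :: (real^'n) measure"
  let ?F = "\<lambda>l r y. ennreal (exp (- (1 / t l * y))) * indicator {- r..} y"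
  let ?ex = "\<lambda>a l. excess p (a(0 := 0)) l / t l"
  have ex: "(\<lambda>a. ?ex a l) \<in> borel_measurable M" if "l \<le> p" for l
    unfolding M_def using measurable_excess[OF that] by (intro borel_measurable_divide) auto
  have "(\<integral>\<^sup>+x. hit_volume {0..p} (\<lambda>l. (*\<^sub>R) (x l * t l) ` (std_simplex_body :: (real^'n) set)) 0 \<partial>laplace_measure p)
     = (\<integral>\<^sup>+x. \<integral>\<^sup>+a. (\<Prod>l\<in>{0..p}. indicator {?ex a l..} (x l)) \<partial>M \<partial>laplace_measure p)"
    unfolding M_def
    by (rule nn_integral_cong_AE) (use AE_laplace_measure_pos in eventually_elim, rule hit_volume_std_simplex, use t in auto)
  also have "\<dots> = (\<integral>\<^sup>+a. \<integral>\<^sup>+x. (\<Prod>l\<in>{0..p}. indicator {?ex a l..} (x l)) \<partial>laplace_measure p \<partial>M)"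
  proof (rule P1.Fubini'[symmetric])
    let ?LM = "laplace_measure p \<Otimes>\<^sub>M M"
    have "(\<lambda>w. if \<forall>l\<in>{0..p}. ?ex (snd w) l \<le> fst w l then 1 else 0 :: ennreal) \<in> borel_measurable ?LM"
    proof (rule measurable_If)
      have "{w \<in> space ?LM. ?ex (snd w) l \<le> fst w l} \<in> sets ?LM" if "l \<in> {0..p}" for l
      proof (rule borel_measurable_le)
        show "(\<lambda>w. ?ex (snd w) l) \<in> borel_measurable ?LM"
          by (rule measurable_compose[OF measurable_snd ex]) (use that in simp)
        have "(\<lambda>x. x l) \<in> borel_measurable (laplace_measure p)"
          using measurable_component_singleton[OF that, of "\<lambda>_. exp_measure"] unfolding laplace_measure_def
          by (simp cong: measurable_cong_sets)
        then show "(\<lambda>w. fst w l) \<in> borel_measurable ?LM"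
          by (rule measurable_compose[OF measurable_fst])
      qed
      then have "Measurable.pred ?LM (\<lambda>w. \<forall>l\<in>{0..p}. ?ex (snd w) l \<le> fst w l)"
        by (intro pred_intros_finite(3)) (auto simp: pred_def)
      then show "{w \<in> space ?LM. \<forall>l\<in>{0..p}. ?ex (snd w) l \<le> fst w l} \<in> sets ?LM"
        by (simp only: pred_def)
    qed auto
    then show "(\<lambda>(x, a). \<Prod>l\<in>{0..p}. indicator {?ex a l..} (x l) :: ennreal) \<in> borel_measurable ?LM"
      unfolding prod_indicator_atLeast[OF finite_atLeastAtMost] case_prod_unfold .
  qed
  also have "\<dots> = (\<integral>\<^sup>+a. (\<Prod>l\<in>{0..p}. ennreal (exp (- ?ex a l))) \<partial>M)"
  proof (rule nn_integral_cong)
    fix a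
    have "(\<integral>\<^sup>+x. (\<Prod>l\<in>{0..p}. indicator {?ex a l..} (x l)) \<partial>laplace_measure p) = (\<Prod>l\<in>{0..p}. \<integral>\<^sup>+x. indicator {?ex a l..} x \<partial>exp_measure)"
      unfolding laplace_measure_def by (rule PE.product_nn_integral_prod) auto
    also have "\<dots> = (\<Prod>l\<in>{0..p}. ennreal (exp (- ?ex a l)))"
    proof (rule prod.cong[OF refl], rule nn_integral_exp_measure_atLeast)
      fix l assume "l \<in> {0..p}"
      then show "0 \<le> ?ex a l" using excess_nonneg[of l p "a(0 := 0)"] t[of l] by simp
    qed
    finally show "(\<integral>\<^sup>+x. (\<Prod>l\<in>{0..p}. indicator {?ex a l..} (x l)) \<partial>laplace_measure p) = (\<Prod>l\<in>{0..p}. ennreal (exp (- ?ex a l)))" .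
  qed
  \<comment> \<open>The auxiliary variables r, one for each coordinate of the base space, are
    collected into the vector \<open>\<rho>\<close>.\<close>
  also have "\<dots> = (\<integral>\<^sup>+a. \<integral>\<^sup>+\<rho>. ?A \<rho> *
      (\<Prod>l\<in>{1..p}. \<Prod>k\<in>UNIV. ?F l (\<rho> $ k) (a l $ k)) \<partial>?vol \<partial>M)"
  proof (rule nn_integral_cong)
    fix a :: "nat \<Rightarrow> real^'n"
    let ?m = "\<lambda>k. max_coord p (a(0 := 0)) k"
    let ?f = "\<lambda>k r. (\<Prod>l\<in>{1..p}. ennreal (exp (- (1 / t l * a l $ k)))) * (ennreal s * (ennreal (exp (- (s * r))) * indicator {?m k..} r))"
    \<comment> \<open>The base shift is 0, so it contributes the condition \<open>0 \<le> r\<close>;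
      each other index contributes a lower bound on its own shift.\<close>
    have ind: "(indicator {?m k..} r :: ennreal) = indicator {0..} r * (\<Prod>l\<in>{1..p}. indicator {- r..} (a l $ k))" for k r
    proof -
      have "?m k \<le> r \<longleftrightarrow> 0 \<le> r \<and> (\<forall>l\<in>{1..p}. - r \<le> a l $ k)"
        unfolding max_coord_le_iff I by (auto simp: minus_le_iff)
      then show ?thesis by (simp add: prod_indicator_atLeast indicator_def)
    qed
    have "(\<Sum>l\<in>{0..p}. ?ex a l) = (\<Sum>l\<in>{0..p}. \<Sum>k\<in>UNIV. (?m k + (a(0 := 0)) l $ k) / t l)"
      by (simp add: excess_def sum_divide_distrib)
    also have "\<dots> = (\<Sum>k\<in>UNIV. \<Sum>l\<in>{0..p}. (?m k + (a(0 := 0)) l $ k) / t l)" by (rule sum.swap)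
    also have "\<dots> = (\<Sum>k\<in>UNIV. s * ?m k + (\<Sum>l\<in>{1..p}. 1 / t l * a l $ k))"
    proof (rule sum.cong[OF refl])
      fix k
      have "(\<Sum>l\<in>{0..p}. (?m k + (a(0 := 0)) l $ k) / t l) = (\<Sum>l\<in>{0..p}. 1 / t l * ?m k) + (\<Sum>l\<in>{0..p}. 1 / t l * (a(0 := 0)) l $ k)"
        by (simp add: add_divide_distrib sum.distrib)
      also have "(\<Sum>l\<in>{0..p}. 1 / t l * ?m k) = s * ?m k" by (simp add: s_def sum_distrib_right)
      also have "(\<Sum>l\<in>{0..p}. 1 / t l * (a(0 := 0)) l $ k) = (\<Sum>l\<in>{1..p}. 1 / t l * a l $ k)"
        unfolding I by (subst sum.insert) (auto intro!: sum.cong)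
      finally show "(\<Sum>l\<in>{0..p}. (?m k + (a(0 := 0)) l $ k) / t l) = s * ?m k + (\<Sum>l\<in>{1..p}. 1 / t l * a l $ k)" .
    qed
    finally have sum: "(\<Sum>l\<in>{0..p}. ?ex a l) = (\<Sum>k\<in>UNIV. s * ?m k + (\<Sum>l\<in>{1..p}. 1 / t l * a l $ k))" .
    have "(\<Prod>l\<in>{0..p}. ennreal (exp (- ?ex a l))) = ennreal (exp (- (\<Sum>l\<in>{0..p}. ?ex a l)))"
      by (simp add: prod_ennreal exp_sum sum_negf[symmetric])
    also have "\<dots> = (\<Prod>k\<in>UNIV. (\<Prod>l\<in>{1..p}. ennreal (exp (- (1 / t l * a l $ k)))) * ennreal (exp (- (s * ?m k))))"
      unfolding sum by (simp add: prod_ennreal exp_sum[symmetric] sum_negf[symmetric] ennreal_mult[symmetric] mult_exp_exp algebra_simps)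
    also have "\<dots> = (\<Prod>k\<in>UNIV. \<integral>\<^sup>+r. ?f k r \<partial>lborel)"
    proof (rule prod.cong[OF refl])
      fix k
      have "(\<integral>\<^sup>+r. ?f k r \<partial>lborel) = (\<Prod>l\<in>{1..p}. ennreal (exp (- (1 / t l * a l $ k)))) *
         (ennreal s * (\<integral>\<^sup>+r. ennreal (exp (- (s * r))) * indicator {?m k..} r \<partial>lborel))"
        by (subst nn_integral_cmult, measurable, subst nn_integral_cmult, auto)
      also have "ennreal s * (\<integral>\<^sup>+r. ennreal (exp (- (s * r))) * indicator {?m k..} r \<partial>lborel) = ennreal (exp (- (s * ?m k)))"
        unfolding nn_integral_exp_atLeast[OF s] using s by (simp add: ennreal_mult[symmetric])
      finally show "(\<Prod>l\<in>{1..p}. ennreal (exp (- (1 / t l * a l $ k)))) * ennreal (exp (- (s * ?m k))) = (\<integral>\<^sup>+r. ?f k r \<partial>lborel)"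
        by (rule sym)
    qed
    also have "\<dots> = (\<integral>\<^sup>+\<rho>. (\<Prod>k\<in>UNIV. ?f k (\<rho> $ k)) \<partial>?vol)"
      by (rule nn_integral_prod_coords[symmetric]) measurable
    also have "(\<lambda>\<rho> :: real^'n. \<Prod>k\<in>UNIV. ?f k (\<rho> $ k)) = (\<lambda>\<rho>. ?A \<rho> *
      (\<Prod>l\<in>{1..p}. \<Prod>k\<in>UNIV. ?F l (\<rho> $ k) (a l $ k)))"
      unfolding ind by (subst prod.swap[of _ UNIV]) (simp add: prod.distrib mult_ac)
    finally show "(\<Prod>l\<in>{0..p}. ennreal (exp (- ?ex a l))) =
      (\<integral>\<^sup>+\<rho>. ?A \<rho> *
      (\<Prod>l\<in>{1..p}. \<Prod>k\<in>UNIV. ?F l (\<rho> $ k) (a l $ k)) \<partial>?vol)" .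
  qed
  also have "\<dots> = (\<integral>\<^sup>+\<rho>. \<integral>\<^sup>+a. ?A \<rho> *
      (\<Prod>l\<in>{1..p}. \<Prod>k\<in>UNIV. ?F l (\<rho> $ k) (a l $ k)) \<partial>M \<partial>?vol)"
  proof (rule P2.Fubini')
    let ?LM = "?vol \<Otimes>\<^sub>M M"
    have co: "(\<lambda>y. y $ k) \<in> borel_measurable (borel :: (real^'n) measure)" for k
      by (auto intro!: borel_measurable_continuous_onI continuous_intros)
    have r: "(\<lambda>w. fst w $ k) \<in> borel_measurable ?LM" for k
      by (rule measurable_compose[OF measurable_fst, of "\<lambda>y. y $ k"]) (use co in simp)
    have al: "(\<lambda>w. snd w l $ k) \<in> borel_measurable ?LM" if "l \<in> {1..p}" for l k
    proof -
      have "(\<lambda>a. a l) \<in> borel_measurable M"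
        using measurable_component_singleton[OF that, of "\<lambda>_. lborel :: (real^'n) measure"] unfolding M_def by simp
      then show ?thesis by (intro measurable_compose[OF measurable_snd measurable_compose[OF _ co]])
    qed
    have ind: "(\<lambda>w. indicator {- fst w $ k..} (snd w l $ k) :: ennreal) \<in> borel_measurable ?LM" if "l \<in> {1..p}" for l k
    proof -
      have "(\<lambda>w. if - fst w $ k \<le> snd w l $ k then 1 else 0 :: ennreal) \<in> borel_measurable ?LM"
        by (intro measurable_If borel_measurable_const borel_measurable_le borel_measurable_uminus r al that)
      then show ?thesis by (simp only: indicator_def of_bool_def atLeast_iff)
    qed
    have e1: "(\<lambda>w. ennreal (exp (- (s * fst w $ k)))) \<in> borel_measurable ?LM" for k
      by (rule measurable_compose[OF r, of "\<lambda>r. ennreal (exp (- (s * r)))"]) measurable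
    have e2: "(\<lambda>w. indicator {0..} (fst w $ k) :: ennreal) \<in> borel_measurable ?LM" for k
      by (rule measurable_compose[OF r, of "indicator {0..}"]) (rule borel_measurable_indicator, simp)
    have e3: "(\<lambda>w. ennreal (exp (- (1 / t l * snd w l $ k)))) \<in> borel_measurable ?LM" if "l \<in> {1..p}" for l k
      by (rule measurable_compose[OF al[OF that], of "\<lambda>r. ennreal (exp (- (1 / t l * r)))"]) measurable
    show "(\<lambda>(\<rho>, a). ?A \<rho> *
      (\<Prod>l\<in>{1..p}. \<Prod>k\<in>UNIV. ?F l (\<rho> $ k) (a l $ k))) \<in> borel_measurable (lborel \<Otimes>\<^sub>M M)"
      unfolding case_prod_unfold
      by (intro borel_measurable_times_ennreal borel_measurable_prod_ennreal borel_measurable_const ind e1 e2 e3)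
  qed
  also have "\<dots> = (\<integral>\<^sup>+\<rho>. (\<Prod>k\<in>UNIV. ennreal (s * (\<Prod>l\<in>{1..p}. t l)) * (ennreal (exp (- (1 / t 0 * \<rho> $ k))) * indicator {0..} (\<rho> $ k))) \<partial>?vol)"
  proof (rule nn_integral_cong)
    fix \<rho> :: "real^'n"
    have co: "(\<lambda>y. y $ k) \<in> borel_measurable (borel :: (real^'n) measure)" for k
      by (auto intro!: borel_measurable_continuous_onI continuous_intros)
    have fm: "(\<lambda>y :: real^'n. \<Prod>k\<in>UNIV. ?F l (\<rho> $ k) (y $ k)) \<in> borel_measurable borel" for l
    proof (rule borel_measurable_prod_ennreal)
      show "(\<lambda>y :: real^'n. ?F l (\<rho> $ k) (y $ k)) \<in> borel_measurable borel" for k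
        by (rule measurable_compose[OF co, of "\<lambda>r. ?F l (\<rho> $ k) r"]) measurable
    qed
    have Mm: "(\<lambda>a. \<Prod>l\<in>{1..p}. \<Prod>k\<in>UNIV. ?F l (\<rho> $ k) (a l $ k)) \<in> borel_measurable M"
    proof (rule borel_measurable_prod_ennreal)
      fix l assume l: "l \<in> {1..p}"
      have "(\<lambda>a. a l) \<in> borel_measurable M"
        using measurable_component_singleton[OF l, of "\<lambda>_. lborel :: (real^'n) measure"] unfolding M_def by simp
      from measurable_compose[OF this fm[of l]]
      show "(\<lambda>a. \<Prod>k\<in>UNIV. ?F l (\<rho> $ k) (a l $ k)) \<in> borel_measurable M" .
    qed
    have "(\<integral>\<^sup>+a. ?A \<rho> * (\<Prod>l\<in>{1..p}. \<Prod>k\<in>UNIV. ?F l (\<rho> $ k) (a l $ k)) \<partial>M)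
      = ?A \<rho> * (\<integral>\<^sup>+a. (\<Prod>l\<in>{1..p}. \<Prod>k\<in>UNIV. ?F l (\<rho> $ k) (a l $ k)) \<partial>M)"
      by (rule nn_integral_cmult[OF Mm])
    also have "(\<integral>\<^sup>+a. (\<Prod>l\<in>{1..p}. \<Prod>k\<in>UNIV. ?F l (\<rho> $ k) (a l $ k)) \<partial>M)
      = (\<Prod>l\<in>{1..p}. \<integral>\<^sup>+y. (\<Prod>k\<in>UNIV. ?F l (\<rho> $ k) (y $ k)) \<partial>?vol)"
      unfolding M_def
      by (rule PL.product_nn_integral_prod[where f="\<lambda>l y. \<Prod>k\<in>UNIV. ?F l (\<rho> $ k) (y $ k)"])
        (use fm in auto)
    also have "\<dots> = (\<Prod>l\<in>{1..p}. \<Prod>k\<in>UNIV. ennreal (t l * exp (\<rho> $ k / t l)))"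
    proof (rule prod.cong[OF refl])
      fix l assume l: "l \<in> {1..p}"
      then have tl: "t l > 0" using t by simp
      have "(\<integral>\<^sup>+y. (\<Prod>k\<in>UNIV. ?F l (\<rho> $ k) (y $ k)) \<partial>?vol)
         = (\<Prod>k\<in>UNIV. \<integral>\<^sup>+r. ?F l (\<rho> $ k) r \<partial>lborel)"
        by (rule nn_integral_prod_coords) measurable
      also have "\<dots> = (\<Prod>k\<in>UNIV. ennreal (t l * exp (\<rho> $ k / t l)))"
      proof (rule prod.cong[OF refl])
        fix k
        have "1 / t l > 0" using tl by simp
        from nn_integral_exp_atLeast[OF this, of "- \<rho> $ k"]
        show "(\<integral>\<^sup>+r. ?F l (\<rho> $ k) r \<partial>lborel) = ennreal (t l * exp (\<rho> $ k / t l))"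
          by (simp only:) (simp add: mult.commute)
      qed
      finally show "(\<integral>\<^sup>+y. (\<Prod>k\<in>UNIV. ?F l (\<rho> $ k) (y $ k)) \<partial>?vol)
         = (\<Prod>k\<in>UNIV. ennreal (t l * exp (\<rho> $ k / t l)))" .
    qed
    also have "?A \<rho> * \<dots> = (\<Prod>k\<in>UNIV. ennreal s * (ennreal (exp (- (s * \<rho> $ k))) * indicator {0..} (\<rho> $ k)) * (\<Prod>l\<in>{1..p}. ennreal (t l * exp (\<rho> $ k / t l))))"
      by (subst prod.swap) (simp add: prod.distrib)
    also have "\<dots> = (\<Prod>k\<in>UNIV. ennreal (s * (\<Prod>l\<in>{1..p}. t l)) * (ennreal (exp (- (1 / t 0 * \<rho> $ k))) * indicator {0..} (\<rho> $ k)))"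
    proof (rule prod.cong[OF refl])
      fix k
      have P: "(\<Prod>l\<in>{1..p}. t l) > 0" by (rule prod_pos) (use t in auto)
      \<comment> \<open>The shifts with index at least 1 have produced factors exp(rho_k / t_l),
        which cancel all of \<open>s\<close> in the exponent except the term 1 / t_0.\<close>
      have "s = 1 / t 0 + (\<Sum>l\<in>{1..p}. 1 / t l)" unfolding s_def I by simp
      then have "exp (- (s * \<rho> $ k)) * (\<Prod>l\<in>{1..p}. exp (\<rho> $ k / t l)) = exp (- (1 / t 0 * \<rho> $ k))"
        by (simp add: exp_sum[symmetric] mult_exp_exp sum_distrib_right sum_distrib_left algebra_simps)
      then have real: "s * exp (- (s * \<rho> $ k)) * (\<Prod>l\<in>{1..p}. t l * exp (\<rho> $ k / t l)) = s * (\<Prod>l\<in>{1..p}. t l) * exp (- (1 / t 0 * \<rho> $ k))"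
        by (simp add: prod.distrib mult_ac)
      have "ennreal s * (ennreal (exp (- (s * \<rho> $ k))) * indicator {0..} (\<rho> $ k)) * (\<Prod>l\<in>{1..p}. ennreal (t l * exp (\<rho> $ k / t l)))
        = ennreal (s * exp (- (s * \<rho> $ k)) * (\<Prod>l\<in>{1..p}. t l * exp (\<rho> $ k / t l))) * indicator {0..} (\<rho> $ k)"
      proof -
        have "(\<Prod>l\<in>{1..p}. ennreal (t l * exp (\<rho> $ k / t l))) = ennreal (\<Prod>l\<in>{1..p}. t l * exp (\<rho> $ k / t l))"
          by (rule prod_ennreal) (use t in \<open>auto intro: less_imp_le\<close>)
        moreover have "(\<Prod>l\<in>{1..p}. t l * exp (\<rho> $ k / t l)) \<ge> 0"
          by (rule prod_nonneg) (use t in \<open>auto intro: less_imp_le\<close>)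
        ultimately show ?thesis using s by (simp add: ennreal_mult mult_ac)
      qed
      also have "\<dots> = ennreal (s * (\<Prod>l\<in>{1..p}. t l)) * (ennreal (exp (- (1 / t 0 * \<rho> $ k))) * indicator {0..} (\<rho> $ k))"
        unfolding real using s P by (simp add: ennreal_mult mult_ac)
      finally show "ennreal s * (ennreal (exp (- (s * \<rho> $ k))) * indicator {0..} (\<rho> $ k)) * (\<Prod>l\<in>{1..p}. ennreal (t l * exp (\<rho> $ k / t l)))
        = ennreal (s * (\<Prod>l\<in>{1..p}. t l)) * (ennreal (exp (- (1 / t 0 * \<rho> $ k))) * indicator {0..} (\<rho> $ k))" .
    qed
    finally show "(\<integral>\<^sup>+a. ?A \<rho> * (\<Prod>l\<in>{1..p}. \<Prod>k\<in>UNIV. ?F l (\<rho> $ k) (a l $ k)) \<partial>M)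
      = (\<Prod>k\<in>UNIV. ennreal (s * (\<Prod>l\<in>{1..p}. t l)) * (ennreal (exp (- (1 / t 0 * \<rho> $ k))) * indicator {0..} (\<rho> $ k)))" .
  qed
  also have "\<dots> = (\<Prod>k\<in>(UNIV :: 'n set). \<integral>\<^sup>+r. ennreal (s * (\<Prod>l\<in>{1..p}. t l)) * (ennreal (exp (- (1 / t 0 * r))) * indicator {0..} r) \<partial>lborel)"
    by (rule nn_integral_prod_coords) measurable
  also have "(\<integral>\<^sup>+r. ennreal (s * (\<Prod>l\<in>{1..p}. t l)) * (ennreal (exp (- (1 / t 0 * r))) * indicator {0..} r) \<partial>lborel)
     = ennreal (s * (\<Prod>l\<in>{1..p}. t l)) * ennreal (t 0)"
    using nn_integral_exp_atLeast[of "1 / t 0" 0] t[of 0] by (subst nn_integral_cmult) auto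
  also have "\<dots> = ennreal (\<Sum>c\<in>{0..p}. \<Prod>l\<in>{0..p} - {c}. t l)"
  proof -
    have "(\<Prod>l\<in>{0..p} - {c}. t l) = 1 / t c * (\<Prod>l\<in>{0..p}. t l)" if "c \<in> {0..p}" for c
      using t[of c] that by (subst (2) prod.remove[of _ c]) auto
    then have "(\<Sum>c\<in>{0..p}. \<Prod>l\<in>{0..p} - {c}. t l) = s * (\<Prod>l\<in>{0..p}. t l)"
      by (simp add: s_def sum_distrib_right)
    also have "\<dots> = s * (\<Prod>l\<in>{1..p}. t l) * t 0" unfolding I by simp
    moreover have "(\<Prod>l\<in>{1..p}. t l) \<ge> 0" by (rule prod_nonneg) (use t in \<open>auto intro: less_imp_le\<close>)
    ultimately show ?thesis using s t[of 0] by (simp add: ennreal_mult)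
  qed
  also have "(\<Prod>k\<in>(UNIV :: 'n set). ennreal (\<Sum>c\<in>{0..p}. \<Prod>l\<in>{0..p} - {c}. t l)) = ennreal ((\<Sum>c\<in>{0..p}. \<Prod>l\<in>{0..p} - {c}. t l) ^ CARD('n))"
  proof -
    have "(\<Sum>c\<in>{0..p}. \<Prod>l\<in>{0..p} - {c}. t l) \<ge> 0"
      by (intro sum_nonneg prod_nonneg) (use t in \<open>auto intro: less_imp_le\<close>)
    then show ?thesis by (simp add: ennreal_power)
  qed
  finally show ?thesis .
qed

section \<open>The comparison with simplices\<close>

text \<open>One vertex becomes the translation part and the other n are the images of the basis
  vectors; affine independence of the vertices makes the linear part injective.\<close>

lemma simplex_eq_affine_image:
  fixes S :: "(real^'n) set"
  assumes "int CARD('n) simplex S"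
  obtains L :: "real^'n \<Rightarrow> real^'n" and v0 where "linear L" "inj L" "S = (\<lambda>y. v0 + L y) ` std_simplex_body"
proof -
  obtain C where C: "\<not> affine_dependent C" "int (card C) = int CARD('n) + 1" "S = convex hull C"
    using assms unfolding simplex by blast
  have fin: "finite C" by (rule aff_independent_finite[OF C(1)])
  have "C \<noteq> {}" using C(2) by auto
  then obtain v0 where v0: "v0 \<in> C" by blast
  have "card (UNIV :: 'n set) = card (C - {v0})" using C(2) v0 fin by simp
  then obtain h where h: "bij_betw h (UNIV :: 'n set) (C - {v0})"
    using finite_same_card_bij[of "UNIV :: 'n set" "C - {v0}"] fin by auto
  define L where "L y = (\<Sum>k\<in>UNIV. y $ k *\<^sub>R (h k - v0))" for y :: "real^'n"
  have linL: "linear L"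
    by (rule linearI) (simp_all add: L_def scaleR_add_left sum.distrib scaleR_sum_right)
  have Lax: "L (axis k 1) = h k - v0" for k
    by (simp add: L_def axis_def if_distrib[of "\<lambda>r. r *\<^sub>R _"] cong: if_cong)
  have img: "L ` Basis = (\<lambda>x. - v0 + x) ` (C - {v0})"
  proof -
    have "L ` Basis = range (\<lambda>k. - v0 + h k)" unfolding Basis_real_vec image_image Lax by simp
    also have "\<dots> = (\<lambda>x. - v0 + x) ` range h" by (simp add: image_image)
    finally show ?thesis using h by (simp add: bij_betw_def)
  qed
  have "independent (L ` Basis)"
    unfolding img using C(1) affine_dependent_iff_dependent2[OF v0] by simp
  moreover have "inj_on L Basis"
  proof (rule inj_onI)
    fix x y :: "real^'n" assume xy: "x \<in> Basis" "y \<in> Basis" "L x = L y"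
    then obtain i j where "x = axis i 1" "y = axis j 1" unfolding Basis_real_vec by blast
    then show "x = y" using xy(3) h by (simp add: Lax bij_betw_def inj_eq)
  qed
  ultimately have "inj_on L (span Basis)"
    using linear_inj_on_span_independent_image[OF linL] by blast
  then have injL: "inj L" by simp
  have "(\<lambda>y. v0 + L y) ` std_simplex_body = (+) v0 ` L ` (convex hull (insert 0 Basis))"
    unfolding std_simplex_body_eq by (simp add: image_image)
  also have "\<dots> = convex hull ((+) v0 ` L ` insert 0 Basis)"
    by (simp only: convex_hull_linear_image[OF linL] convex_hull_translation)
  also have "(+) v0 ` L ` insert 0 Basis = C"
  proof -
    have "(+) v0 ` L ` insert 0 Basis = insert v0 ((+) v0 ` L ` Basis)"
      using linear_0[OF linL] by simp
    also have "(+) v0 ` L ` Basis = C - {v0}" unfolding img by (simp add: image_image)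
    finally show ?thesis using v0 by auto
  qed
  finally have "S = (\<lambda>y. v0 + L y) ` std_simplex_body" using C(3) by simp
  with linL injL show thesis by (rule that)
qed

text \<open>The linear part acts on each of the p free shifts and gives one factor
  \<open>\<kappa>\<close> for each. The same \<open>\<kappa>\<close> relates the volumes of the two
  bodies, so the quotient by the p-th power of the volume is affinely invariant.\<close>

lemma diff_volume_affine_image:
  fixes K S :: "(real^'n) set" and L :: "real^'n \<Rightarrow> real^'n"
  assumes K: "compact K" "K \<noteq> {}" and L: "linear L" "inj L" and S: "S = (\<lambda>y. v0 + L y) ` K"
  shows "\<exists>\<kappa>>0. (\<forall>t. diff_volume p K t = \<kappa> ^ p * diff_volume p S t) \<and> measure lborel K = \<kappa> * measure lborel S"
proof -
  obtain \<kappa> where \<kappa>: "\<kappa> > 0"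
    "\<And>f. f \<in> borel_measurable borel \<Longrightarrow> (\<integral>\<^sup>+x. f (L x) \<partial>lborel) = ennreal \<kappa> * (\<integral>\<^sup>+x. f x \<partial>lborel)"
    using nn_integral_linear[OF L] by blast
  have Lc: "continuous_on UNIV L" using L(1) linear_continuous_on linear_conv_bounded_linear by blast
  then have Lm: "L \<in> borel_measurable borel" by (rule borel_measurable_continuous_onI)
  have aff: "(\<integral>\<^sup>+x. f (c + L x) \<partial>lborel) = ennreal \<kappa> * (\<integral>\<^sup>+x. f x \<partial>lborel)"
    if f: "f \<in> borel_measurable borel" for f :: "real^'n \<Rightarrow> ennreal" and c
  proof -
    have "(\<lambda>y. f (c + y)) \<in> borel_measurable borel" using f by measurable
    then have "(\<integral>\<^sup>+x. f (c + L x) \<partial>lborel) = ennreal \<kappa> * (\<integral>\<^sup>+x. f (c + x) \<partial>lborel)" by (rule \<kappa>(2))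
    also have "(\<integral>\<^sup>+x. f (c + x) \<partial>lborel) = (\<integral>\<^sup>+x. f x \<partial>lborel)"
      using nn_integral_lborel_affine[OF f, of 1 c] by simp
    finally show ?thesis .
  qed
  have Sc: "compact S" "S \<noteq> {}"
  proof -
    have "continuous_on K (\<lambda>y. v0 + L y)"
      by (intro continuous_intros continuous_on_subset[OF Lc]) auto
    then show "compact S" unfolding S by (rule compact_continuous_image[OF _ K(1)])
    show "S \<noteq> {}" unfolding S using K(2) by auto
  qed
  have surj: "surj L" using L by (simp add: linear_injective_imp_surjective)
  have "hit_volume {0..p} (\<lambda>l. (*\<^sub>R) (t l) ` K) 0 = ennreal \<kappa> ^ card ({0..p} - {0}) * hit_volume {0..p} (\<lambda>l. (*\<^sub>R) (t l) ` S) 0" for t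
  \<comment> \<open>The translation moves the \<open>l\<close>-th body by t_l v_0. The common point
    absorbs t_0 v_0, leaving the shift (t_l - t_0) v_0, which is 0 at the base index.\<close>
  proof (rule hit_volume_map[where T="\<lambda>l y. (t l - t 0) *\<^sub>R v0 + L y"])
    show "(\<lambda>y. (t l - t 0) *\<^sub>R v0 + L y) \<in> borel_measurable borel" for l using Lm by measurable
    show "(\<integral>\<^sup>+x. f ((t l - t 0) *\<^sub>R v0 + L x) \<partial>lborel) = ennreal \<kappa> * (\<integral>\<^sup>+x. f x \<partial>lborel)"
      if "f \<in> borel_measurable borel" for f :: "real^'n \<Rightarrow> ennreal" and l by (rule aff[OF that])
    fix a :: "nat \<Rightarrow> real^'n"
    let ?b = "(\<lambda>l. (t l - t 0) *\<^sub>R v0 + L (a l))(0 := 0)"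
    have iff: "x + (a(0 := 0)) l \<in> (*\<^sub>R) (t l) ` K \<longleftrightarrow> (t 0 *\<^sub>R v0 + L x) + ?b l \<in> (*\<^sub>R) (t l) ` S" for x l
    proof -
      have e1: "(t 0 *\<^sub>R v0 + L x) + ?b l = t l *\<^sub>R v0 + L (x + (a(0 := 0)) l)"
        using linear_add[OF L(1)] linear_0[OF L(1)] by (simp add: algebra_simps)
      have e2: "(*\<^sub>R) (t l) ` S = (\<lambda>z. t l *\<^sub>R v0 + L z) ` (*\<^sub>R) (t l) ` K"
        unfolding S image_image by (simp add: scaleR_add_right linear_scale[OF L(1)])
      have e3: "inj (\<lambda>z. t l *\<^sub>R v0 + L z)" using L(2) by (simp add: inj_def)
      show ?thesis unfolding e1 e2 by (rule inj_image_mem_iff[OF e3, symmetric])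
    qed
    show "common_point {0..p} (\<lambda>l. (*\<^sub>R) (t l) ` K) (a(0 := 0)) = common_point {0..p} (\<lambda>l. (*\<^sub>R) (t l) ` S) ?b"
    proof
      assume "common_point {0..p} (\<lambda>l. (*\<^sub>R) (t l) ` K) (a(0 := 0))"
      then show "common_point {0..p} (\<lambda>l. (*\<^sub>R) (t l) ` S) ?b"
        unfolding common_point_def using iff by blast
    next
      assume "common_point {0..p} (\<lambda>l. (*\<^sub>R) (t l) ` S) ?b"
      then obtain x' where x': "\<forall>l\<in>{0..p}. x' + ?b l \<in> (*\<^sub>R) (t l) ` S" unfolding common_point_def by blast
      obtain x where "L x = x' - t 0 *\<^sub>R v0" using surj by (metis surjD)
      then have "x' = t 0 *\<^sub>R v0 + L x" by simp
      then have "\<forall>l\<in>{0..p}. x + (a(0 := 0)) l \<in> (*\<^sub>R) (t l) ` K" using x' unfolding iff by blast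
      then show "common_point {0..p} (\<lambda>l. (*\<^sub>R) (t l) ` K) (a(0 := 0))" unfolding common_point_def by blast
    qed
  qed (use Sc in \<open>simp_all add: compact_scaling\<close>)
  moreover have "card ({0..p} - {0}) = p" by simp
  ultimately have "diff_volume p K t = \<kappa> ^ p * diff_volume p S t" for t
    unfolding diff_volume_def using \<kappa>(1) by (simp add: enn2real_mult ennreal_power)
  moreover have "measure lborel K = \<kappa> * measure lborel S"
  proof -
    have ind: "indicator S (v0 + L x) = (indicator K x :: ennreal)" for x
    proof -
      have "inj (\<lambda>y. v0 + L y)" using L(2) by (simp add: inj_def)
      then have "v0 + L x \<in> S \<longleftrightarrow> x \<in> K" unfolding S by (rule inj_image_mem_iff)
      then show ?thesis by (simp add: indicator_def)
    qed
    have "(\<integral>\<^sup>+x. indicator S (v0 + L x) \<partial>lborel) = ennreal \<kappa> * (\<integral>\<^sup>+x. indicator S x \<partial>lborel)"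
      by (rule aff, rule borel_measurable_indicator) (use Sc in \<open>simp add: borel_compact\<close>)
    then have "emeasure lborel K = ennreal \<kappa> * emeasure lborel S"
      unfolding ind using Sc K by (simp add: borel_compact)
    then show ?thesis using \<kappa>(1) by (simp add: measure_def enn2real_mult)
  qed
  ultimately show ?thesis using \<kappa>(1) by blast
qed

text \<open>Transfers the nonnegative integral to the polynomial form of the volume. Polynomial and
  volume are compared only at positive \<open>x\<close>, which is almost everywhere.\<close>

lemma laplace_std_simplex_poly:
  fixes t :: "nat \<Rightarrow> real"
  assumes t: "\<And>l. l \<le> p \<Longrightarrow> t l > 0"
    and c: "\<And>t. (\<forall>l\<in>{0..p}. t l \<ge> 0) \<Longrightarrow> diff_volume p (std_simplex_body :: (real^'n) set) t
        = (\<Sum>e\<in>exponents CARD('n) p. c e * (\<Prod>l\<in>{0..p}. t l ^ e l))"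
  shows "has_bochner_integral (laplace_measure p) (\<lambda>x. \<Sum>e\<in>exponents CARD('n) p. c e * (\<Prod>l\<in>{0..p}. (x l * t l) ^ e l))
     (\<Sum>j\<in>multi_indices CARD('n) p. multinomial CARD('n) p j * monomial CARD('n) p t j)"
proof (rule has_bochner_integral_nn_integral)
  let ?S0 = "std_simplex_body :: (real^'n) set"
  let ?H = "\<lambda>x. hit_volume {0..p} (\<lambda>l. (*\<^sub>R) (x l * t l) ` ?S0) 0"
  let ?P = "\<lambda>x. \<Sum>e\<in>exponents CARD('n) p. c e * (\<Prod>l\<in>{0..p}. (x l * t l) ^ e l)"
  show "?P \<in> borel_measurable (laplace_measure p)"
    by (rule borel_measurable_has_bochner_integral[OF laplace_of_polynomial])
  have P: "?P x = diff_volume p ?S0 (\<lambda>l. x l * t l)" if "\<forall>l\<in>{0..p}. x l > 0" for x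
    by (rule c[symmetric]) (use that t in \<open>auto intro!: mult_nonneg_nonneg less_imp_le\<close>)
  show "AE x in laplace_measure p. 0 \<le> ?P x"
    using AE_laplace_measure_pos by eventually_elim (simp only: P, simp add: diff_volume_def)
  show "0 \<le> (\<Sum>j\<in>multi_indices CARD('n) p. multinomial CARD('n) p j * monomial CARD('n) p t j)"
    unfolding sum_multinomial_monomial
    by (intro zero_le_power sum_nonneg prod_nonneg) (use t in \<open>auto intro: less_imp_le\<close>)
  have "(\<integral>\<^sup>+x. ennreal (?P x) \<partial>laplace_measure p)
     = (\<integral>\<^sup>+x. ?H x \<partial>laplace_measure p)"
  proof (rule nn_integral_cong_AE)
    have "?H x < \<infinity>" for x
      by (rule hit_volume_finite) (auto intro: compact_scaling compact_std_simplex_body)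
    then have fin: "ennreal (diff_volume p ?S0 (\<lambda>l. x l * t l)) =
       ?H x" for x
      unfolding diff_volume_def by (simp add: ennreal_enn2real)
    show "AE x in laplace_measure p. ennreal (?P x) = ?H x"
      using AE_laplace_measure_pos by eventually_elim (simp only: P fin)
  qed
  then show "(\<integral>\<^sup>+x. ennreal (?P x) \<partial>laplace_measure p) = ennreal (\<Sum>j\<in>multi_indices CARD('n) p. multinomial CARD('n) p j * monomial CARD('n) p t j)"
    by (simp only: laplace_std_simplex[OF t] sum_multinomial_monomial)
qed

lemma diff_volume_cong:
  fixes K :: "(real^'n) set"
  assumes "compact K" "K \<noteq> {}" "\<And>l. l \<le> p \<Longrightarrow> s l = t l"
  shows "diff_volume p K s = diff_volume p K t"
  using comb_body_cong[of p s t K] assms(3) by (simp only: power_volume_comb_body[OF assms(1,2), symmetric])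

text \<open>Division by the sum \<open>\<sigma>\<close> brings arbitrary positive weights into the
  simplex of weights, at the price of a power of \<open>\<sigma>\<close>. Both \<open>t'\<close> and
  \<open>\<sigma>\<close> are independent of the body, so K and the reference simplex can be
  compared at the same weights.\<close>

lemma diff_volume_normalize:
  fixes u :: "nat \<Rightarrow> real"
  assumes u: "\<And>l. l \<le> p \<Longrightarrow> u l > 0"
  obtains t' \<sigma> where "t' \<in> relint_Theta p" "\<sigma> > 0"
    "\<And>K :: (real^'n) set. K \<in> convex_bodies \<Longrightarrow> diff_volume p K u = \<sigma> ^ (CARD('n) * p) * power_volume p (diff_body p t' K)"
proof -
  define \<sigma> where "\<sigma> = (\<Sum>l=0..p. u l)"
  have \<sigma>: "\<sigma> > 0" unfolding \<sigma>_def by (rule sum_pos) (use u in auto)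
  define t' where "t' = (\<lambda>l\<in>{0..p}. u l / \<sigma>)"
  have "(\<Sum>l=0..p. t' l) = 1"
    using \<sigma> by (simp add: t'_def sum_divide_distrib[symmetric] \<sigma>_def)
  then have t': "t' \<in> relint_Theta p"
    unfolding relint_Theta_def Theta_def using u \<sigma> by (auto simp: t'_def less_imp_le)
  have eq: "diff_volume p K u = \<sigma> ^ (CARD('n) * p) * power_volume p (diff_body p t' K)" if "K \<in> convex_bodies" for K :: "(real^'n) set"
  proof -
    have K: "compact K" "convex K" "K \<noteq> {}" using that by (auto simp: convex_bodies_def)
    have "diff_volume p K u = diff_volume p K (\<lambda>l. \<sigma> * t' l)"
      by (rule diff_volume_cong[OF K(1,3)]) (use \<sigma> in \<open>simp add: t'_def\<close>)
    also have "\<dots> = \<sigma> ^ (CARD('n) * p) * diff_volume p K t'" by (rule diff_volume_scale[OF K(1,3) \<sigma>])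
    also have "diff_volume p K t' = power_volume p (diff_body p t' K)"
    proof -
      have "diff_body p t' K = comb_body p K t'"
        by (rule diff_body_eq[OF K(2,3)]) (use t' in \<open>auto simp: relint_Theta_def Theta_def\<close>)
      then show ?thesis by (simp add: power_volume_comb_body[OF K(1,3)])
    qed
    finally show ?thesis .
  qed
  from t' \<sigma> eq show thesis by (rule that)
qed

text \<open>If K lies in a hyperplane, then u_1 K - u_0 K lies in a parallel one, so the product
  bound on the volume has a vanishing factor; index 1 exists because
  \<open>p \<ge> 1\<close>.\<close>

lemma diff_volume_degenerate:
  fixes K :: "(real^'n) set"
  assumes K: "compact K" "aff_dim K < int CARD('n)" and p: "p \<ge> 1"
  shows "diff_volume p K u = 0" "measure lborel K = 0"
proof -
  obtain a \<beta> where a: "a \<noteq> 0" "K \<subseteq> {x. a \<bullet> x = \<beta>}"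
    using aff_lowdim_subset_hyperplane[of K] K(2) by auto
  have null: "emeasure lborel D = 0" if "compact D" "D \<subseteq> {x. a \<bullet> x = \<gamma>}" for D \<gamma>
  proof -
    have "negligible D" by (rule negligible_subset[OF negligible_hyperplane that(2)]) (use a in simp)
    then have "emeasure lebesgue D = 0" by (auto simp: negligible_iff_null_sets null_sets_def)
    then show ?thesis using that(1) by (simp add: borel_compact)
  qed
  show "measure lborel K = 0" using null[OF K(1) a(2)] by (simp add: measure_def)
  let ?D = "\<lambda>l. dilated_sum (uminus ` (*\<^sub>R) (u 0) ` K) 1 ((*\<^sub>R) (u l) ` K)"
  have "hit_volume {0..p} (\<lambda>l. (*\<^sub>R) (u l) ` K) 0 \<le> (\<Prod>l\<in>{0..p} - {0}. emeasure lborel (?D l))"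
    by (rule hit_volume_le) (use K in \<open>auto intro: compact_scaling\<close>)
  also have "\<dots> = 0"
  proof (rule prod_zero)
    have "?D 1 \<subseteq> {x. a \<bullet> x = u 1 * \<beta> - u 0 * \<beta>}"
    proof
      fix y assume "y \<in> ?D 1"
      then obtain v w where "v \<in> K" "w \<in> K" "y = - (u 0 *\<^sub>R v) + 1 *\<^sub>R (u 1 *\<^sub>R w)"
        unfolding dilated_sum_def by blast
      moreover from this have "a \<bullet> v = \<beta>" "a \<bullet> w = \<beta>" using a(2) by blast+
      ultimately show "y \<in> {x. a \<bullet> x = u 1 * \<beta> - u 0 * \<beta>}" by (simp add: inner_diff_right)
    qed
    moreover have "compact (?D 1)"
      by (intro compact_dilated_sum compact_negations compact_scaling K(1))
    ultimately have "emeasure lborel (?D 1) = 0" by (rule null[rotated])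
    then show "\<exists>l\<in>{0..p} - {0}. emeasure lborel (?D l) = 0" using p by (intro bexI[of _ 1]) auto
  qed simp
  finally show "diff_volume p K u = 0" by (simp add: diff_volume_def)
qed

lemma convex_body_volume_pos:
  fixes K :: "(real^'n) set"
  assumes "K \<in> convex_bodies" "aff_dim K = int CARD('n)"
  shows "measure lebesgue K > 0"
proof -
  have K: "compact K" "convex K" "K \<noteq> {}" using assms(1) by (auto simp: convex_bodies_def)
  have "interior K \<noteq> {}"
    using assms(2) K by (simp add: interior_rel_interior_gen rel_interior_eq_empty)
  then have "\<not> negligible K" using negligible_convex_interior[OF K(2)] by simp
  then have "measure lebesgue K \<noteq> 0" using negligible_iff_measure0[OF lmeasurable_compact[OF K(1)]] by simp
  then show ?thesis using measure_nonneg[of lebesgue K] by linarith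
qed


theorem proposition7p8:
  fixes S :: "(real^'n) set"
  assumes "CARD('n) \<ge> 2"
    and "int CARD('n) simplex S"
    and "\<forall>p\<ge>1. \<forall>K\<in>convex_bodies :: (real^'n) set set. aff_dim K = int CARD('n) \<longrightarrow>
           (\<forall>t\<in>Theta p.
              power_volume p (diff_body p t K) / measure lebesgue K ^ p
                \<le> power_volume p (diff_body p t S) / measure lebesgue S ^ p) \<and>
           ((\<exists>t\<in>relint_Theta p.
              power_volume p (diff_body p t K) / measure lebesgue K ^ p
                = power_volume p (diff_body p t S) / measure lebesgue S ^ p)
            \<longrightarrow> (\<exists>r. r simplex K))"
  shows "\<forall>p\<ge>1. \<forall>K\<in>convex_bodies :: (real^'n) set set.
           (\<forall>t\<in>Theta p.
              (\<Sum>j\<in>multi_indices CARD('n) p. monomial CARD('n) p t j * W p K j)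
                \<le> fact CARD('n) ^ p / fact (CARD('n) * p) *
                  (\<Sum>j\<in>multi_indices CARD('n) p.
                     multinomial CARD('n) p j * monomial CARD('n) p t j * measure lebesgue K ^ p)) \<and>
           (aff_dim K = int CARD('n) \<and>
            (\<exists>t\<in>relint_Theta p.
              (\<Sum>j\<in>multi_indices CARD('n) p. monomial CARD('n) p t j * W p K j)
                = fact CARD('n) ^ p / fact (CARD('n) * p) *
                  (\<Sum>j\<in>multi_indices CARD('n) p.
                     multinomial CARD('n) p j * monomial CARD('n) p t j * measure lebesgue K ^ p))
            \<longrightarrow> (\<exists>r. r simplex K))"
proof (intro allI impI ballI)
  let ?n = "CARD('n)"
  fix p :: nat and K :: "(real^'n) set"
  assume p: "p \<ge> 1" and KB: "K \<in> convex_bodies"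
  have K: "compact K" "convex K" "K \<noteq> {}" using KB by (auto simp: convex_bodies_def)
  define N :: real where "N = fact (?n * p)"
  have N: "N > 0" by (simp add: N_def)
  define A where "A t = (\<Sum>j\<in>multi_indices ?n p. monomial ?n p t j * W p K j)" for t
  define B where "B t = (\<Sum>j\<in>multi_indices ?n p. multinomial ?n p j * monomial ?n p t j)" for t
  have rhs: "fact ?n ^ p / fact (?n * p) *
      (\<Sum>j\<in>multi_indices ?n p. multinomial ?n p j * monomial ?n p t j * measure lebesgue K ^ p)
      = fact ?n ^ p / N * B t * measure lebesgue K ^ p" for t
    by (simp add: B_def N_def sum_distrib_right)
  obtain c where c: "\<And>t. (\<forall>l\<in>{0..p}. t l \<ge> 0) \<Longrightarrow> diff_volume p K t = (\<Sum>e\<in>exponents ?n p. c e * (\<Prod>l\<in>{0..p}. t l ^ e l))"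
    using diff_volume_poly[OF K p] by blast
  \<comment> \<open>The integrand is the polynomial instead of the volume: its integral is then
    known directly, and the two agree at positive \<open>x\<close>.\<close>
  define P where "P t x = (\<Sum>e\<in>exponents ?n p. c e * (\<Prod>l\<in>{0..p}. (x l * t l) ^ e l))" for t x :: "nat \<Rightarrow> real"
  have P_int: "has_bochner_integral (laplace_measure p) (P t) (N * A t)" for t
  proof -
    have "N * A t = (\<Sum>e\<in>exponents ?n p. c e * (\<Prod>l\<in>{0..p}. fact (e l)) * (\<Prod>l\<in>{0..p}. t l ^ e l))"
    proof -
      have "A t = (\<Sum>e\<in>exponents ?n p. c e * (\<Prod>l\<in>{0..p}. fact (e l)) * (\<Prod>l\<in>{0..p}. t l ^ e l)) / fact (?n * p)"
        unfolding A_def by (rule sum_monomial_W[OF K c])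
      then show ?thesis by (simp add: N_def)
    qed
    then show ?thesis unfolding P_def using laplace_of_polynomial[where p=p and E="exponents ?n p" and c=c and t=t] by simp
  qed
  have P_eq: "P t x = diff_volume p K (\<lambda>l. x l * t l)" if "\<forall>l\<in>{0..p}. x l > 0" "\<And>l. l \<le> p \<Longrightarrow> t l \<ge> 0" for t x
    unfolding P_def by (rule c[symmetric]) (use that in \<open>simp add: mult_nonneg_nonneg less_imp_le\<close>)
  let ?goal = "\<lambda>t. A t \<le> fact ?n ^ p / N * B t * measure lebesgue K ^ p"
  have "(\<forall>t\<in>Theta p. ?goal t) \<and>
    (aff_dim K = int ?n \<and> (\<exists>t\<in>relint_Theta p. A t = fact ?n ^ p / N * B t * measure lebesgue K ^ p) \<longrightarrow> (\<exists>r. r simplex K))"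
  proof (cases "aff_dim K = int ?n")
    \<comment> \<open>In lower dimension both sides are 0: the volume polynomial vanishes almost
      everywhere, and \<open>p \<ge> 1\<close> makes the power of the volume vanish.\<close>
    case False
    then have low: "aff_dim K < int ?n" using aff_dim_le_DIM[of K] by simp
    have "?goal t" if t: "t \<in> Theta p" for t
    proof -
      have "AE x in laplace_measure p. P t x = 0"
        using AE_laplace_measure_pos
        by eventually_elim (use t diff_volume_degenerate(1)[OF K(1) low p] P_eq in \<open>auto simp: Theta_def\<close>)
      then have "(\<integral>x. P t x \<partial>laplace_measure p) = 0" by (rule integral_eq_zero_AE)
      then have "A t = 0" using P_int[of t] N by (simp add: has_bochner_integral_iff)
      moreover have "measure lebesgue K = 0"
        using diff_volume_degenerate(2)[OF K(1) low p] by (simp add: measure_lebesgue_compact K(1))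
      ultimately show ?thesis using p by (cases p) simp_all
    qed
    then show ?thesis using False by blast
  next
    case True
    define V where "V = measure lebesgue K ^ p"
    have V: "V > 0" unfolding V_def using convex_body_volume_pos[OF KB True] by simp
    let ?S0 = "std_simplex_body :: (real^'n) set"
    note S0 = compact_std_simplex_body[where 'n='n] std_simplex_body_nonempty[where 'n='n]
    obtain L v0 where L: "linear L" "inj L" "S = (\<lambda>y. v0 + L y) ` ?S0"
      using simplex_eq_affine_image[OF assms(2)] .
    obtain \<kappa> where \<kappa>: "\<kappa> > 0" "\<And>t. diff_volume p ?S0 t = \<kappa> ^ p * diff_volume p S t"
        "measure lborel ?S0 = \<kappa> * measure lborel S"
      using diff_volume_affine_image[OF S0 L] by blast
    have SB: "S \<in> convex_bodies"
      using convex_simplex[OF assms(2)] compact_simplex[OF assms(2)] L(3) S0(2) by (auto simp: convex_bodies_def)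
    \<comment> \<open>This is the origin of the factor (n!)^p in the bound: the standard simplex has
      volume 1/n!.\<close>
    have "measure lborel ?S0 = 1 / fact ?n"
      unfolding std_simplex_body_eq using content_std_simplex[where 'a="real^'n"] by simp
    then have "\<kappa> * measure lebesgue S = 1 / fact ?n"
      using \<kappa>(3) compact_simplex[OF assms(2)] by (simp add: measure_lebesgue_compact)
    then have "(\<kappa> * measure lebesgue S) ^ p = (1 / fact ?n) ^ p" by simp
    then have volS: "measure lebesgue S ^ p = 1 / (fact ?n ^ p * \<kappa> ^ p)"
      using \<kappa>(1) by (simp add: power_mult_distrib power_divide field_simps)
    obtain cS where cS: "\<And>t. (\<forall>l\<in>{0..p}. t l \<ge> 0) \<Longrightarrow> diff_volume p ?S0 t = (\<Sum>e\<in>exponents ?n p. cS e * (\<Prod>l\<in>{0..p}. t l ^ e l))"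
      using diff_volume_poly[OF S0(1) convex_std_simplex_body S0(2) p] by blast
    define Q where "Q t x = (\<Sum>e\<in>exponents ?n p. cS e * (\<Prod>l\<in>{0..p}. (x l * t l) ^ e l))" for t x :: "nat \<Rightarrow> real"
    have Q_int: "has_bochner_integral (laplace_measure p) (Q t) (B t)" if "\<And>l. l \<le> p \<Longrightarrow> t l > 0" for t
      unfolding Q_def B_def by (rule laplace_std_simplex_poly[OF that cS])
    have Q_eq: "Q t x = diff_volume p ?S0 (\<lambda>l. x l * t l)" if "\<forall>l\<in>{0..p}. x l > 0" "\<And>l. l \<le> p \<Longrightarrow> t l > 0" for t x
      unfolding Q_def by (rule cS[symmetric]) (use that in \<open>auto intro!: mult_nonneg_nonneg less_imp_le\<close>)
    \<comment> \<open>The hypothesis at the normalised weights, multiplied by the common power of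
      the scale. These weights lie in the relative interior, so the equality clause applies for each
      positive \<open>x\<close>.\<close>
    have hyp: "P t x / V \<le> fact ?n ^ p * Q t x \<and> (P t x / V = fact ?n ^ p * Q t x \<longrightarrow> (\<exists>r. r simplex K))"
      if x: "\<forall>l\<in>{0..p}. x l > 0" and t: "\<And>l. l \<le> p \<Longrightarrow> t l > 0" for t x
    proof -
      have "x l * t l > 0" if "l \<le> p" for l using x t that by simp
      then obtain t' \<sigma> where t': "t' \<in> relint_Theta p" "\<sigma> > 0"
        "\<And>K :: (real^'n) set. K \<in> convex_bodies \<Longrightarrow> diff_volume p K (\<lambda>l. x l * t l) = \<sigma> ^ (?n * p) * power_volume p (diff_body p t' K)"
        using diff_volume_normalize[of p "\<lambda>l. x l * t l"] by blast
      define s where "s = \<sigma> ^ (?n * p)"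
      have s: "s > 0" using t'(2) by (simp add: s_def)
      have PK: "P t x / V = s * (power_volume p (diff_body p t' K) / measure lebesgue K ^ p)"
        using P_eq[OF x less_imp_le[OF t]] t'(3)[OF KB] by (simp add: V_def s_def)
      have "fact ?n ^ p * Q t x = s * (fact ?n ^ p * \<kappa> ^ p * power_volume p (diff_body p t' S))"
      proof -
        have "Q t x = diff_volume p ?S0 (\<lambda>l. x l * t l)" by (rule Q_eq[OF x t])
        then show ?thesis by (simp add: \<kappa>(2) t'(3)[OF SB] s_def)
      qed
      then have QS: "fact ?n ^ p * Q t x = s * (power_volume p (diff_body p t' S) / measure lebesgue S ^ p)"
        unfolding volS by (simp add: mult_ac)
      have "t' \<in> Theta p" using t'(1) by (simp add: relint_Theta_def)
      moreover have H: "(\<forall>t\<in>Theta p. power_volume p (diff_body p t K) / measure lebesgue K ^ p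
                \<le> power_volume p (diff_body p t S) / measure lebesgue S ^ p) \<and>
           ((\<exists>t\<in>relint_Theta p. power_volume p (diff_body p t K) / measure lebesgue K ^ p
                = power_volume p (diff_body p t S) / measure lebesgue S ^ p)
            \<longrightarrow> (\<exists>r. r simplex K))"
        using assms(3) p KB True by blast
      ultimately have "power_volume p (diff_body p t' K) / measure lebesgue K ^ p
                \<le> power_volume p (diff_body p t' S) / measure lebesgue S ^ p" by blast
      moreover have "power_volume p (diff_body p t' K) / measure lebesgue K ^ p
                = power_volume p (diff_body p t' S) / measure lebesgue S ^ p \<longrightarrow> (\<exists>r. r simplex K)"
        using H t'(1) by blast
      ultimately show ?thesis unfolding PK QS using s by (simp only: mult_le_cancel_left_pos mult_cancel_left) simp
    qed
    have ineq: "?goal t" if t: "\<And>l. l \<le> p \<Longrightarrow> t l > 0" for t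
    proof -
      have "(\<integral>x. P t x / V \<partial>laplace_measure p) \<le> (\<integral>x. fact ?n ^ p * Q t x \<partial>laplace_measure p)"
      proof (rule integral_mono_AE)
        show "AE x in laplace_measure p. P t x / V \<le> fact ?n ^ p * Q t x"
          using AE_laplace_measure_pos by eventually_elim (use hyp t in blast)
      qed (use P_int[of t] Q_int[OF t] in \<open>auto simp: has_bochner_integral_iff\<close>)
      then have "N * A t / V \<le> fact ?n ^ p * B t"
        using P_int[of t] Q_int[OF t] by (simp add: has_bochner_integral_iff)
      then show ?thesis using V N by (simp add: V_def[symmetric] field_simps)
    qed
    have closed: "?goal t" if t: "t \<in> Theta p" for t
    proof (rule LIMSEQ_le)
      \<comment> \<open>Boundary weights are approached by positive ones. The perturbed weights do
        not sum to 1, which is harmless because \<open>ineq\<close> asks only for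
        positivity.\<close>
      let ?t = "\<lambda>m l. t l + 1 / real (Suc m)"
      have "(\<lambda>m. 1 / real (Suc m)) \<longlonglongrightarrow> 0" by real_asymp
      then have "(\<lambda>m. ?t m l) \<longlonglongrightarrow> t l" for l using tendsto_add[OF tendsto_const[of "t l"]] by fastforce
      then have mono: "(\<lambda>m. monomial ?n p (?t m) j) \<longlonglongrightarrow> monomial ?n p t j" for j
        unfolding monomial_def by (intro tendsto_prod tendsto_power)
      show "(\<lambda>m. A (?t m)) \<longlonglongrightarrow> A t"
        unfolding A_def by (intro tendsto_sum tendsto_mult mono tendsto_const)
      show "(\<lambda>m. fact ?n ^ p / N * B (?t m) * measure lebesgue K ^ p) \<longlonglongrightarrow> fact ?n ^ p / N * B t * measure lebesgue K ^ p"
        unfolding B_def by (intro tendsto_sum tendsto_mult mono tendsto_const)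
      have "?goal (?t m)" for m
      proof (rule ineq)
        fix l assume "l \<le> p"
        then have "t l \<ge> 0" using t by (simp add: Theta_def)
        moreover have "1 / real (Suc m) > 0" by simp
        ultimately show "?t m l > 0" by (rule add_nonneg_pos)
      qed
      then show "\<exists>M. \<forall>m\<ge>M. A (?t m) \<le> fact ?n ^ p / N * B (?t m) * measure lebesgue K ^ p" by blast
    qed
    have equality: "\<exists>r. r simplex K" if t: "t \<in> relint_Theta p" and eq: "A t = fact ?n ^ p / N * B t * measure lebesgue K ^ p" for t
    proof -
      have tp: "t l > 0" if "l \<le> p" for l using t that by (simp add: relint_Theta_def)
      let ?f = "\<lambda>x. fact ?n ^ p * Q t x - P t x / V"
      have int: "integrable (laplace_measure p) ?f"
        using P_int[of t] Q_int[OF tp] by (auto simp: has_bochner_integral_iff)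
      have "(\<integral>x. ?f x \<partial>laplace_measure p) = fact ?n ^ p * B t - N * A t / V"
        using P_int[of t] Q_int[OF tp] by (simp add: has_bochner_integral_iff)
      also have "\<dots> = 0" using eq V N by (simp add: V_def[symmetric])
      finally have "(\<integral>x. ?f x \<partial>laplace_measure p) = 0" .
      moreover have "AE x in laplace_measure p. 0 \<le> ?f x"
        using AE_laplace_measure_pos by eventually_elim (use hyp[OF _ tp] in simp)
      ultimately have "AE x in laplace_measure p. ?f x = 0"
        using integral_nonneg_eq_0_iff_AE[OF int] by blast
      then have ae: "AE x in laplace_measure p. (\<forall>l\<in>{0..p}. x l > 0) \<and> ?f x = 0"
        using AE_laplace_measure_pos by eventually_elim simp
      \<comment> \<open>Under a probability measure a property holding almost everywhere holds
        somewhere, so one positive \<open>x\<close> with pointwise equality is available for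
        \<open>hyp\<close>.\<close>
      have "\<exists>x. (\<forall>l\<in>{0..p}. x l > 0) \<and> ?f x = 0"
      proof (rule ccontr)
        assume "\<not> ?thesis"
        then have "AE x in laplace_measure p. \<not> ((\<forall>l\<in>{0..p}. x l > 0) \<and> ?f x = 0)" by (intro AE_I2) blast
        then show False by (rule prob_space.AE_contr[OF prob_space_laplace_measure ae])
      qed
      then obtain x where "\<forall>l\<in>{0..p}. x l > 0" "?f x = 0" by blast
      then show ?thesis using hyp[of x t] tp by simp
    qed
    show ?thesis using closed equality by blast
  qed
  then show "(\<forall>t\<in>Theta p.
      (\<Sum>j\<in>multi_indices ?n p. monomial ?n p t j * W p K j)
        \<le> fact ?n ^ p / fact (?n * p) *
          (\<Sum>j\<in>multi_indices ?n p. multinomial ?n p j * monomial ?n p t j * measure lebesgue K ^ p)) \<and>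
    (aff_dim K = int ?n \<and>
      (\<exists>t\<in>relint_Theta p.
        (\<Sum>j\<in>multi_indices ?n p. monomial ?n p t j * W p K j)
          = fact ?n ^ p / fact (?n * p) *
            (\<Sum>j\<in>multi_indices ?n p. multinomial ?n p j * monomial ?n p t j * measure lebesgue K ^ p))
      \<longrightarrow> (\<exists>r. r simplex K))"
    unfolding rhs A_def .
qed

end
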